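(* Let $n\ge 1$. The weak rectangulotope $\mathbb{WR}(n)$ is realized by the polytope in $\mathbb{R}^n$ equivalently described as: (i) the convex hull of the points $$\sum_{i\in[n]} \big(h^{T}_i\, v^{T}_i - h^{S}_i\, v^{S}_i\big)\, \boldsymbol{e}_i$$ for all weak rectangulations $R$ of size $n$, where $S=S(R)$ and $T=T(R)$ are the source and target trees of $R$, and for $U\in\{S,T\}$, $h^U_i$ and $v^U_i$ denote the number of leaves in the horizontal and vertical subtrees of node $i$ in $U$; (ii) the intersection of the hyperplane $\sum_{i\in[n]}x_i=0$ with the halfspaces $$\sum_{i\in X}x_i\ \le\ \#\{I \text{ interval of }[n] : I\not\subseteq X \text{ and } I\not\subseteq [n]\setminus X\}$$ for all subsets $\varnothing\ne X\subsetneq[n]$. That is, the sets described in (i) and (ii) are the same polytope, and the normal fan of this polytope is the weak rectangulation fan $\mathcal{F}_w$.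
   Context: Notation: $[n]=\{1,\dots,n\}$, $\boldsymbol{e}_1,\dots,\boldsymbol{e}_n$ is the standard basis of $\mathbb{R}^n$. An interval of $[n]$ is a nonempty set of consecutive integers in $[n]$. Rectangulations. A rectangulation of size $n$ is a decomposition of an axis-parallel square into $n$ axis-parallel rectangles with disjoint interiors; all rectangulations are assumed generic, i.e. no four rectangles have a common vertex. The segments of a rectangulation are the inclusionwise maximal line segments composed of edges of the rectangles, excluding the edges of the square. A rectangle $r$ is above a rectangle $s$ (and $s$ is below $r$) if there is a sequence $r=r_0,\dots,r_k=s$ ($k\ge1$) of rectangles such that the bottom edge of $r_{i-1}$ lies in the same segment as the top edge of $r_i$ for all $i\in[k]$; "on the left of" and "on the right of" are defined similarly (the right edge of $r_{i-1}$ lies in the same segment as the left edge of $r_i$). Two rectangulations are weakly equivalent if there is a bijection between their rectangles preserving both the relation "$r$ is above $s$" and the relation "$r$ is on the left of $s$"; weak rectangulations are the weak equivalence classes. Labels. The rectangles of $R$ are labeled by $[n]$ by the inorder: this is the total order given by the transitive closure of the union of the below and right relations, i.e. $i<j$ when $r_j$ is below or on the right of $r_i$, where $r_i$ denotes the rectangle labeled $i$. Source and target trees. For a rectangle $r$, let $s(r)$ be its bottom--left corner (source) and $t(r)$ its top--right corner (target). Consider the directed graph $D(R)$ on all vertices of $R$ with, for each rectangle $r$, the four edges joining consecutive corners of $r$, horizontal ones oriented left to right, vertical ones bottom to top. The source tree $S(R)$ is the subgraph of $D(R)$ induced by all sources $s(r)$, and the target tree $T(R)$ is the subgraph induced by all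 targets $t(r)$. These are binary trees, rooted at the bottom--left corner (for $S(R)$), respectively the top--right corner (for $T(R)$), of the square; each node has at most one horizontal child (reached by a horizontal edge) and at most one vertical child (reached by a vertical edge). They depend only on the weak class of $R$. The node $s(r_i)$ of $S(R)$ and the node $t(r_i)$ of $T(R)$ are labeled $i$, so both trees have node set $[n]$. Each node is completed with a horizontal (resp. vertical) leaf if it has no horizontal (resp. vertical) child. The horizontal (resp. vertical) subtree of a node is its subtree reached by the horizontal (resp. vertical) edge (possibly a single leaf, which then counts as $1$ leaf). Weak poset and weak rectangulotope. Orient the horizontal edges of $S(R)$ and $T(R)$ from left to right and the vertical edges from bottom to top. The weak poset $\prec_w^R$ on $[n]$ is the transitive closure of the union of the two partial orders so defined (an edge $i\to j$ gives $i\prec_w^R j$). Its sets of linear extensions $\{\sigma\in\mathfrak{S}_n : i\prec_w^R j\Rightarrow\sigma^{-1}(i)<\sigma^{-1}(j)\}$, over all weak rectangulations $R$, are the classes of a lattice congruence of the weak Bruhat order on $\mathfrak{S}_n$ (the weak rectangulation congruence). Its quotient fan $\mathcal{F}_w$ is the complete fan in $\mathbb{R}^n$ whose maximal cones are $\{x\in\mathbb{R}^n : x_i\le x_j \text{ whenever } i\prec_w^R j\}$, one for each weak rectangulation $R$ of size $n$. The weak rectangulotope $\mathbb{WR}(n)$ is the quotientope of this congruence; a polytope realizes $\mathbb{WR}(n)$ if its normal fan is $\mathcal{F}_w$, where the normal cone of a face $F$ of a polytope $P$ is the set of $v\in\mathbb{R}^n$ such that $x\mapsto\langle v,x\rangle$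 is maximized over $P$ at every point of $F$. *)

theory Defs
  imports "HOL-Analysis.Analysis"
begin

text \<open>The index set [n] is rendered throughout as a type of class finite and linorder with n
  elements.\<close>

datatype rect = Rect (xmin: real) (xmax: real) (ymin: real) (ymax: real)

definition region :: "rect \<Rightarrow> (real \<times> real) set" where
  "region r = cbox (xmin r, ymin r) (xmax r, ymax r)"

definition bottom_left :: "rect \<Rightarrow> real \<times> real" where
  "bottom_left r = (xmin r, ymin r)"

definition bottom_right :: "rect \<Rightarrow> real \<times> real" where
  "bottom_right r = (xmax r, ymin r)"

definition top_left :: "rect \<Rightarrow> real \<times> real" where
  "top_left r = (xmin r, ymax r)"

definition top_right :: "rect \<Rightarrow> real \<times> real" where
  "top_right r = (xmax r, ymax r)"

definition corners :: "rect \<Rightarrow> (real \<times> real) set" where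
  "corners r = {bottom_left r, bottom_right r, top_left r, top_right r}"

definition bottom_edge :: "rect \<Rightarrow> (real \<times> real) set" where
  "bottom_edge r = closed_segment (bottom_left r) (bottom_right r)"

definition top_edge :: "rect \<Rightarrow> (real \<times> real) set" where
  "top_edge r = closed_segment (top_left r) (top_right r)"

definition left_edge :: "rect \<Rightarrow> (real \<times> real) set" where
  "left_edge r = closed_segment (bottom_left r) (top_left r)"

definition right_edge :: "rect \<Rightarrow> (real \<times> real) set" where
  "right_edge r = closed_segment (bottom_right r) (top_right r)"

definition edges :: "rect \<Rightarrow> (real \<times> real) set set" where
  "edges r = {bottom_edge r, top_edge r, left_edge r, right_edge r}"

definition proper_rect :: "rect \<Rightarrow> bool" where
  "proper_rect r \<longleftrightarrow> xmin r < xmax r \<and> ymin r < ymax r"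

definition is_square :: "rect \<Rightarrow> bool" where
  "is_square r \<longleftrightarrow> proper_rect r \<and> xmax r - xmin r = ymax r - ymin r"

text \<open>If rectangles decompose some square, that square is their bounding box, so a rectangulation
  can be represented by its set of rectangles alone.\<close>

definition bounding_box :: "rect set \<Rightarrow> rect" where
  "bounding_box R = Rect (Min (xmin ` R)) (Max (xmax ` R)) (Min (ymin ` R)) (Max (ymax ` R))"

definition rectangulation :: "rect set \<Rightarrow> bool" where
  "rectangulation R \<longleftrightarrow>
     finite R \<and> (\<forall>r\<in>R. proper_rect r) \<and> is_square (bounding_box R) \<and>
     (region ` R) division_of region (bounding_box R)"

definition generic :: "rect set \<Rightarrow> bool" where
  "generic R \<longleftrightarrow> (\<forall>p. card {r \<in> R. p \<in> corners r} < 4)"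

definition rectangulations :: "nat \<Rightarrow> rect set set" where
  "rectangulations n = {R. rectangulation R \<and> generic R \<and> card R = n}"

definition composed_of_edges :: "rect set \<Rightarrow> (real \<times> real) set \<Rightarrow> bool" where
  "composed_of_edges R L \<longleftrightarrow>
     (\<exists>p q. L = closed_segment p q) \<and> (\<exists>E \<subseteq> (\<Union>r\<in>R. edges r). L = \<Union>E)"

definition segments :: "rect set \<Rightarrow> (real \<times> real) set set" where
  "segments R =
     {L. composed_of_edges R L \<and> (\<forall>L'. composed_of_edges R L' \<and> L \<subseteq> L' \<longrightarrow> L' = L) \<and>
         L \<notin> edges (bounding_box R)}"

definition above :: "rect set \<Rightarrow> rect \<Rightarrow> rect \<Rightarrow> bool" where
  "above R = (\<lambda>r s. r \<in> R \<and> s \<in> R \<and>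
     (\<exists>L \<in> segments R. bottom_edge r \<subseteq> L \<and> top_edge s \<subseteq> L))\<^sup>+\<^sup>+"

definition left_of :: "rect set \<Rightarrow> rect \<Rightarrow> rect \<Rightarrow> bool" where
  "left_of R = (\<lambda>r s. r \<in> R \<and> s \<in> R \<and>
     (\<exists>L \<in> segments R. right_edge r \<subseteq> L \<and> left_edge s \<subseteq> L))\<^sup>+\<^sup>+"

definition weak_equivalence :: "nat \<Rightarrow> (rect set \<times> rect set) set" where
  "weak_equivalence n =
     {(R, R'). R \<in> rectangulations n \<and> R' \<in> rectangulations n \<and>
        (\<exists>f. bij_betw f R R' \<and>
           (\<forall>r\<in>R. \<forall>s\<in>R. (above R r s \<longleftrightarrow> above R' (f r) (f s)) \<and>
                         (left_of R r s \<longleftrightarrow> left_of R' (f r) (f s))))}"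

definition weak_rectangulations :: "nat \<Rightarrow> rect set set set" where
  "weak_rectangulations n = rectangulations n // weak_equivalence n"

text \<open>For a generic rectangulation this transitive closure is a total order on the rectangles, so
  exactly one labeling exists.\<close>

definition inorder_labeling :: "rect set \<Rightarrow> ('n::{finite,linorder} \<Rightarrow> rect) \<Rightarrow> bool" where
  "inorder_labeling R l \<longleftrightarrow>
     bij_betw l UNIV R \<and>
     (\<forall>i j. i < j \<longleftrightarrow> (\<lambda>r s. above R r s \<or> left_of R r s)\<^sup>+\<^sup>+ (l i) (l j))"

definition rect_of :: "rect set \<Rightarrow> 'n::{finite,linorder} \<Rightarrow> rect" where
  "rect_of R = (THE l. inorder_labeling R l)"

datatype direction = Hor | Ver

fun D_edges :: "rect set \<Rightarrow> direction \<Rightarrow> ((real \<times> real) \<times> (real \<times> real)) set" where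
  "D_edges R Hor = (\<Union>r\<in>R. {(bottom_left r, bottom_right r), (top_left r, top_right r)})"
| "D_edges R Ver = (\<Union>r\<in>R. {(bottom_left r, top_left r), (bottom_right r, top_right r)})"

definition induced :: "('a \<times> 'a) set \<Rightarrow> 'a set \<Rightarrow> ('a \<times> 'a) set" where
  "induced E V = E \<inter> V \<times> V"

definition source_edge ::
    "rect set \<Rightarrow> direction \<Rightarrow> 'n::{finite,linorder} \<Rightarrow> 'n \<Rightarrow> bool" where
  "source_edge R d i j \<longleftrightarrow>
     (bottom_left (rect_of R i), bottom_left (rect_of R j)) \<in> induced (D_edges R d) (bottom_left ` R)"

definition target_edge ::
    "rect set \<Rightarrow> direction \<Rightarrow> 'n::{finite,linorder} \<Rightarrow> 'n \<Rightarrow> bool" where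
  "target_edge R d i j \<longleftrightarrow>
     (top_right (rect_of R i), top_right (rect_of R j)) \<in> induced (D_edges R d) (top_right ` R)"

text \<open>A binary tree is given by its child relation: U d i j says that j is the child of i in
  direction d. The edges of D(R) point away from the root of the source tree (bottom-left corner of
  the square), but towards the root of the target tree (top-right corner).\<close>

definition source_tree ::
    "rect set \<Rightarrow> direction \<Rightarrow> 'n::{finite,linorder} \<Rightarrow> 'n \<Rightarrow> bool" where
  "source_tree R d i j \<longleftrightarrow> source_edge R d i j"

definition target_tree ::
    "rect set \<Rightarrow> direction \<Rightarrow> 'n::{finite,linorder} \<Rightarrow> 'n \<Rightarrow> bool" where
  "target_tree R d i j \<longleftrightarrow> target_edge R d j i"

text \<open>Completion of a tree: Leaf i d is the leaf attached to node i when i has no child in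
  direction d.\<close>

datatype 'n vertex = Node 'n | Leaf 'n direction

inductive completed_child ::
    "(direction \<Rightarrow> 'n \<Rightarrow> 'n \<Rightarrow> bool) \<Rightarrow> direction \<Rightarrow> 'n vertex \<Rightarrow> 'n vertex \<Rightarrow> bool" for U where
  node: "U d i j \<Longrightarrow> completed_child U d (Node i) (Node j)"
| leaf: "\<nexists>j. U d i j \<Longrightarrow> completed_child U d (Node i) (Leaf i d)"

definition num_leaves :: "(direction \<Rightarrow> 'n \<Rightarrow> 'n \<Rightarrow> bool) \<Rightarrow> direction \<Rightarrow> 'n \<Rightarrow> nat" where
  "num_leaves U d i =
     card {(k, e). \<exists>c. completed_child U d (Node i) c \<and>
                       (\<lambda>v w. \<exists>e'. completed_child U e' v w)\<^sup>*\<^sup>* c (Leaf k e)}"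

definition weak_poset :: "rect set \<Rightarrow> 'n::{finite,linorder} \<Rightarrow> 'n \<Rightarrow> bool" where
  "weak_poset R =
     (\<lambda>i j. (\<lambda>i j. \<exists>d. source_edge R d i j)\<^sup>+\<^sup>+ i j \<or> (\<lambda>i j. \<exists>d. target_edge R d i j)\<^sup>+\<^sup>+ i j)\<^sup>+\<^sup>+"

definition weak_cone :: "rect set \<Rightarrow> (real ^ 'n::{finite,linorder}) set" where
  "weak_cone R = {x. \<forall>i j. weak_poset R i j \<longrightarrow> x $ i \<le> x $ j}"

text \<open>Fans are sets of cones: a fan consists of all (nonempty) faces of its maximal cones.\<close>

definition weak_fan :: "(real ^ 'n::{finite,linorder}) set set" where
  "weak_fan = {F. F \<noteq> {} \<and>
     (\<exists>W \<in> weak_rectangulations CARD('n). \<exists>R \<in> W. F face_of weak_cone R)}"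

definition normal_cone :: "'a::real_inner set \<Rightarrow> 'a set \<Rightarrow> 'a set" where
  "normal_cone P F = {v. \<forall>x\<in>F. \<forall>y\<in>P. v \<bullet> y \<le> v \<bullet> x}"

definition normal_fan :: "'a::real_inner set \<Rightarrow> 'a set set" where
  "normal_fan P = {normal_cone P F | F. F face_of P \<and> F \<noteq> {}}"

definition realizes_weak_rectangulotope :: "(real ^ 'n::{finite,linorder}) set \<Rightarrow> bool" where
  "realizes_weak_rectangulotope P \<longleftrightarrow> polytope P \<and> normal_fan P = weak_fan"

definition weak_vertex :: "rect set \<Rightarrow> real ^ 'n::{finite,linorder}" where
  "weak_vertex R = (\<Sum>i\<in>UNIV.
     (real (num_leaves (target_tree R) Hor i) * real (num_leaves (target_tree R) Ver i)
      - real (num_leaves (source_tree R) Hor i) * real (num_leaves (source_tree R) Ver i))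
     *\<^sub>R axis i 1)"

definition intervals :: "'n::linorder set set" where
  "intervals = {I. \<exists>a b. a \<le> b \<and> I = {a..b}}"

definition weak_hull :: "(real ^ 'n::{finite,linorder}) set" where
  "weak_hull = convex hull {weak_vertex R | R W. W \<in> weak_rectangulations CARD('n) \<and> R \<in> W}"

definition weak_halfspaces :: "(real ^ 'n::{finite,linorder}) set" where
  "weak_halfspaces =
     {x. (\<Sum>i\<in>UNIV. x $ i) = 0} \<inter>
     {x. \<forall>X. X \<noteq> {} \<and> X \<noteq> UNIV \<longrightarrow>
        (\<Sum>i\<in>X. x $ i) \<le> real (card {I \<in> intervals. \<not> I \<subseteq> X \<and> \<not> I \<subseteq> UNIV - X})}"

end

theory Submission
  imports Defs
begin

text \<open>For v in R^n let spread v be the sum over all intervals I of max_I v - min_I v. It is the Lovasz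
  extension of the set function counting the intervals that cross X, hence the polytope (ii) consists
  of the x with v . x \<le> spread v for all v. In a rectangulation the source and target trees are binary
  search trees for the inorder labels, so h_i v_i counts the intervals whose lowest common ancestor is i;
  therefore v . x_R is the sum over all I of v at the target root of I minus v at the source root of I.
  It is at most spread v, with equality iff the target (source) root carries the maximum (minimum) of v
  on every I, i.e. iff v lies in the weak cone of R. Every v lies in some weak cone, as the diagonal
  rectangulation of a linear extension of v shows. Thus both polytopes have support function spread, and
  the normal cone at x_R is the weak cone of R.

  That the inorder labels exist is the statement that the relation "above or left of" is acyclic. The
  open rectangles and the open segments are pairwise disjoint convex sets, and each elementary step of
  the relation passes from a rectangle through a segment to a rectangle that it blocks when translating
  in direction north-west; such a blocking relation has no cycles. Totality follows from the source tree.\<close>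

subsection \<open>Normal fans of polytopes\<close>

text \<open>Three obstacles shape the proof. The search tree property compares labels, but labels
  exist only once the inorder is known to be a total order, and totality is read off the source
  tree. So \<open>search_tree\<close> works with an abstract relation \<open>lt\<close>, first
  instantiated with \<open>precedes\<close> under an arbitrary numbering of the rectangles; only
  afterwards is \<open>lt\<close> replaced by the order of the labels. Genericity enters through one
  fact: no point is a corner of four rectangles. It keeps the interiors of segments from crossing,
  gives every tree node a single parent, and prevents a top right corner from being a bottom left
  corner, so that the edges of D(R) between sources are bottom and left edges only. Two disjoint
  convex sets appear in the same order on every line of slope -1 that meets both, but three sets
  need not meet a common line, so blocking is not transitive. Transitivity survives through a middle
  set whose levels end first; this is the set removed in the induction for acyclicity.\<close>

lemma normal_cone_singleton_hull:
  assumes "finite V"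
  shows "normal_cone (convex hull V) {x} = {v. \<forall>y\<in>V. v \<bullet> y \<le> v \<bullet> x}"
proof -
  have "v \<bullet> y \<le> v \<bullet> x" if v: "\<forall>y\<in>V. v \<bullet> y \<le> v \<bullet> x" and y: "y \<in> convex hull V" for v y
  proof -
    have "convex hull V \<subseteq> {y. v \<bullet> y \<le> v \<bullet> x}"
      using v by (intro hull_minimal) (auto simp: convex_halfspace_le)
    then show ?thesis using y by blast
  qed
  then show ?thesis
    by (auto simp: normal_cone_def hull_inc)
qed

lemma convex_normal_cone: "convex (normal_cone P F)"
proof -
  have "normal_cone P F = (\<Inter>x\<in>F. \<Inter>y\<in>P. {v. (y - x) \<bullet> v \<le> 0})"
    by (auto simp: normal_cone_def inner_diff inner_commute)
  then show ?thesis
    by (auto intro!: convex_INT convex_halfspace_le)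
qed

text \<open>Inside the normal cone at \<open>x\<close>, the cone of \<open>F\<close> is cut out by
  making the inequalities at the points of \<open>F\<close> tight. If a positive combination of two
  nonnegative slacks vanishes, both slacks vanish, which is the face property.\<close>

lemma normal_cone_face_of:
  assumes "x \<in> F" "F \<subseteq> P"
  shows "normal_cone P F face_of normal_cone P {x}"
  unfolding face_of_def
proof (intro conjI ballI impI)
  show "normal_cone P F \<subseteq> normal_cone P {x}"
    using assms by (auto simp: normal_cone_def)
  show "convex (normal_cone P F)" by (rule convex_normal_cone)
  fix a b c
  assume a: "a \<in> normal_cone P {x}" and b: "b \<in> normal_cone P {x}"
    and c: "c \<in> normal_cone P F" and seg: "c \<in> open_segment a b"
  obtain t where t: "0 < t" "t < 1" "c = (1 - t) *\<^sub>R a + t *\<^sub>R b"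
    using seg by (auto simp: in_segment)
  have eq: "a \<bullet> z = a \<bullet> x \<and> b \<bullet> z = b \<bullet> x" if "z \<in> F" for z
  proof -
    have "z \<in> P" "x \<in> P" using that assms by auto
    then have 1: "a \<bullet> z \<le> a \<bullet> x" "b \<bullet> z \<le> b \<bullet> x" "c \<bullet> z = c \<bullet> x"
      using a b c that assms by (auto simp: normal_cone_def intro: antisym)
    have "(1 - t) * (a \<bullet> x - a \<bullet> z) + t * (b \<bullet> x - b \<bullet> z) = 0"
      using 1(3) by (simp add: t(3) inner_add_left algebra_simps)
    moreover have "(1 - t) * (a \<bullet> x - a \<bullet> z) \<ge> 0" "t * (b \<bullet> x - b \<bullet> z) \<ge> 0"
      using 1 t by auto
    ultimately have "(1 - t) * (a \<bullet> x - a \<bullet> z) = 0" "t * (b \<bullet> x - b \<bullet> z) = 0" by linarith+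
    then show ?thesis using t by auto
  qed
  show "a \<in> normal_cone P F" "b \<in> normal_cone P F"
    using a b eq by (auto simp: normal_cone_def)
qed

text \<open>Take \<open>v\<close> in the relative interior of \<open>K\<close> and let
  \<open>F\<close> be the face of the polytope that \<open>v\<close> exposes. The normal cone of
  \<open>F\<close> is a face meeting the relative interior of \<open>K\<close>, hence contains
  \<open>K\<close>. Conversely, for \<open>w\<close> in that cone, \<open>v\<close> can be pushed
  slightly away from \<open>w\<close> without leaving the cone at \<open>x\<close>; then
  \<open>v\<close> lies strictly between the new point and \<open>w\<close>, so the face
  \<open>K\<close> contains \<open>w\<close>.\<close>

lemma face_of_normal_cone:
  fixes V :: "'a::euclidean_space set"
  assumes V: "finite V" and x: "x \<in> convex hull V" and K: "K face_of normal_cone (convex hull V) {x}" "K \<noteq> {}"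
  shows "K \<in> normal_fan (convex hull V)"
proof -
  let ?P = "convex hull V"
  have "rel_interior K \<noteq> {}"
    using K face_of_imp_convex rel_interior_eq_empty convex_normal_cone by metis
  then obtain v where v: "v \<in> rel_interior K" by auto
  then have vK: "v \<in> K" using rel_interior_subset by auto
  define F where "F = ?P \<inter> {y. v \<bullet> y = v \<bullet> x}"
  have vmax: "v \<bullet> y \<le> v \<bullet> x" if "y \<in> ?P" for y
    using vK K(1) that by (auto simp: normal_cone_def face_of_def)
  have F: "F face_of ?P" unfolding F_def
    by (rule face_of_Int_supporting_hyperplane_le) (use vmax in auto)
  have xF: "x \<in> F" using x by (simp add: F_def)
  have NF: "normal_cone ?P F face_of normal_cone ?P {x}"
    by (rule normal_cone_face_of) (use xF in \<open>auto simp: F_def\<close>)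
  have vN: "v \<in> normal_cone ?P F"
    using vmax by (auto simp: normal_cone_def F_def)
  have "K \<subseteq> normal_cone ?P F"
    using subset_of_face_of[OF NF] K(1) v vN by (auto simp: face_of_def)
  moreover have "w \<in> K" if w: "w \<in> normal_cone ?P F" for w
  proof (cases "w = v")
    case False
    \<comment> \<open>\<open>B\<close> exceeds the change, per unit step along \<open>v - w\<close>,
      of the difference between the values at a vertex and at \<open>x\<close>; the added 1 keeps it
      positive. \<open>m\<close> is the least slack of \<open>v\<close> at a vertex outside
      \<open>F\<close>, with 1 inserted so that the minimum also exists when \<open>Y\<close> is
      empty. A step of length \<open>m / B\<close> then uses up no slack completely.\<close>
    define B where "B = (\<Sum>y\<in>V. \<bar>w \<bullet> (y - x)\<bar> + \<bar>v \<bullet> (y - x)\<bar>) + 1"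
    have B: "\<bar>w \<bullet> (y - x)\<bar> + \<bar>v \<bullet> (y - x)\<bar> < B" if "y \<in> V" for y
    proof -
      have "\<bar>w \<bullet> (y - x)\<bar> + \<bar>v \<bullet> (y - x)\<bar> \<le> (\<Sum>y\<in>V. \<bar>w \<bullet> (y - x)\<bar> + \<bar>v \<bullet> (y - x)\<bar>)"
        by (rule member_le_sum[of y V "\<lambda>y. \<bar>w \<bullet> (y - x)\<bar> + \<bar>v \<bullet> (y - x)\<bar>"]) (use that V in auto)
      then show ?thesis by (simp add: B_def)
    qed
    have B1: "B \<ge> 1" unfolding B_def by (simp add: sum_nonneg)
    define Y where "Y = {y\<in>V. v \<bullet> (y - x) < 0}"
    define m where "m = Min (insert 1 ((\<lambda>y. - (v \<bullet> (y - x))) ` Y))"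
    have fin: "finite (insert 1 ((\<lambda>y. - (v \<bullet> (y - x))) ` Y))" using V by (simp add: Y_def)
    have m0: "m > 0" unfolding m_def using fin by (subst Min_gr_iff) (auto simp: Y_def)
    have m: "m \<le> - (v \<bullet> (y - x))" if "y \<in> Y" for y
      unfolding m_def using fin that by (intro Min_le) auto
    define e where "e = m / B"
    have e0: "e > 0" using m0 B1 by (simp add: e_def)
    define z where "z = v + e *\<^sub>R (v - w)"
    have "z \<bullet> (y - x) \<le> 0" if y: "y \<in> V" for y
    proof (cases "y \<in> Y")
      case True
      have "e * (v \<bullet> (y - x) - w \<bullet> (y - x)) \<le> e * B"
        using B[OF y] e0 by (intro mult_left_mono) auto
      also have "\<dots> = m" using B1 by (simp add: e_def)
      finally have "e * (v \<bullet> (y - x) - w \<bullet> (y - x)) \<le> m" .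
      then show ?thesis using m[OF True] by (simp add: z_def inner_add_left inner_diff_left)
    next
      case False
      have "y \<in> ?P" using y by (simp add: hull_inc)
      then have "y \<in> F" using False y vmax[of y] by (auto simp: Y_def F_def inner_diff_right)
      then have "v \<bullet> y = v \<bullet> x" "w \<bullet> y = w \<bullet> x"
        using w xF \<open>y \<in> ?P\<close> x by (auto simp: F_def normal_cone_def intro: antisym)
      then show ?thesis by (simp add: z_def inner_add_left inner_diff_left inner_diff_right)
    qed
    then have z: "z \<in> normal_cone ?P {x}"
      by (simp add: normal_cone_singleton_hull[OF V] inner_diff_right)
    have "v \<in> open_segment z w"
    proof -
      let ?t = "e / (1 + e)"
      have t: "1 - ?t = 1 / (1 + e)" using e0 by (simp add: field_simps)
      have "z = (1 + e) *\<^sub>R v - e *\<^sub>R w" by (simp add: z_def algebra_simps)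
      then have "(1 - ?t) *\<^sub>R z + ?t *\<^sub>R w = ((1 / (1 + e)) * (1 + e)) *\<^sub>R v"
        unfolding t by (simp add: scaleR_diff_right)
      then have "v = (1 - ?t) *\<^sub>R z + ?t *\<^sub>R w" using e0 by simp
      moreover have "0 < ?t" "?t < 1" using e0 by auto
      moreover have "z \<noteq> w"
      proof
        assume "z = w"
        then have "(1 + e) *\<^sub>R (v - w) = 0" by (simp add: z_def algebra_simps)
        then show False using e0 False by simp
      qed
      ultimately show ?thesis unfolding in_segment by blast
    qed
    moreover have "w \<in> normal_cone ?P {x}" using w NF by (auto simp: face_of_def)
    ultimately show ?thesis
      using K(1) z vK unfolding face_of_def by blast
  qed (use vK in simp)
  ultimately have "K = normal_cone ?P F" by blast
  then show ?thesis using F xF unfolding normal_fan_def by blast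
qed

text \<open>A nonempty face is compact and convex, so it has an extreme point, which is one of the
  generators in \<open>V\<close>. Hence the fan is known as soon as the cones at the points of
  \<open>V\<close> are.\<close>

lemma normal_fan_convex_hull:
  fixes V :: "'a::euclidean_space set"
  assumes V: "finite V"
  shows "normal_fan (convex hull V)
    = {K. K \<noteq> {} \<and> (\<exists>x\<in>V. K face_of normal_cone (convex hull V) {x})}"
proof -
  let ?P = "convex hull V"
  have "K \<noteq> {} \<and> (\<exists>x\<in>V. K face_of normal_cone ?P {x})" if "K \<in> normal_fan ?P" for K
  proof -
    obtain F where F: "F face_of ?P" "F \<noteq> {}" "K = normal_cone ?P F"
      using \<open>K \<in> normal_fan ?P\<close> by (auto simp: normal_fan_def)
    have "compact F" "convex F"
      using F V face_of_imp_compact face_of_imp_convex compact_convex_hull finite_imp_compact convex_convex_hull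
      by metis+
    then obtain x where x: "x extreme_point_of F"
      using extreme_point_exists_convex F(2) by blast
    then have "x extreme_point_of ?P" using extreme_point_of_face F(1) by blast
    then have "x \<in> V" by (simp add: extreme_point_of_convex_hull)
    moreover have "K face_of normal_cone ?P {x}"
      unfolding F(3) using x F(1) by (intro normal_cone_face_of) (auto simp: extreme_point_of_def face_of_def)
    moreover have "0 \<in> K" by (simp add: F(3) normal_cone_def)
    ultimately show ?thesis by blast
  qed
  moreover have "K \<in> normal_fan ?P" if "K \<noteq> {}" "x \<in> V" "K face_of normal_cone ?P {x}" for K x
    using face_of_normal_cone[OF V _ that(3)] that by (simp add: hull_inc)
  ultimately show ?thesis by blast
qed

subsection \<open>Binary search trees\<close>

text \<open>\<open>right_child\<close> and \<open>left_child\<close> compare a node only with one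
  chain: a child in one direction, followed by steps in the other direction. Such a chain is a row
  of rectangles along a single segment, so this is what the geometry provides. The directions are
  parameters because left is \<open>Ver\<close> in the source tree and \<open>Hor\<close> in the
  target tree.\<close>

locale search_tree =
  fixes U :: "direction \<Rightarrow> 'a::finite \<Rightarrow> 'a \<Rightarrow> bool" and dl dr :: direction and lt :: "'a \<Rightarrow> 'a \<Rightarrow> bool"
  assumes dirs: "dl \<noteq> dr"
    and child_unique: "U d i j \<Longrightarrow> U d i k \<Longrightarrow> j = k"
    and parent_unique: "U d i k \<Longrightarrow> U e j k \<Longrightarrow> i = j \<and> d = e"
    and rooted: "\<exists>r. \<forall>j. (\<lambda>i j. \<exists>d. U d i j)\<^sup>*\<^sup>* r j"
    and lt_trans: "lt i j \<Longrightarrow> lt j k \<Longrightarrow> lt i k"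
    and lt_irrefl: "\<not> lt i i"
    and right_child: "U dr i c \<Longrightarrow> (U dl)\<^sup>*\<^sup>* c w \<Longrightarrow> lt i w"
    and left_child: "U dl i c \<Longrightarrow> (U dr)\<^sup>*\<^sup>* c w \<Longrightarrow> lt w i"
begin

abbreviation child :: "'a \<Rightarrow> 'a \<Rightarrow> bool" where
  "child i j \<equiv> \<exists>d. U d i j"

definition sub :: "'a \<Rightarrow> 'a set" where
  "sub i = {j. child\<^sup>*\<^sup>* i j}"

text \<open>Adding \<open>i\<close> to its subtree in direction \<open>d\<close> makes the
  cardinality equal to the number of leaves of that subtree, as a binary tree with N nodes has N + 1
  leaves; a missing subtree counts as one leaf.\<close>

definition ext :: "direction \<Rightarrow> 'a \<Rightarrow> 'a set" where
  "ext d i = insert i (\<Union>c\<in>Collect (U d i). sub c)"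

lemma dir_cases: "d = dl \<or> d = dr"
  using dirs direction.exhaust by metis

lemma mirror: "search_tree U dr dl (\<lambda>i j. lt j i)"
proof
  show "\<exists>r. \<forall>j. (\<lambda>i j. \<exists>d. U d i j)\<^sup>*\<^sup>* r j" by (rule rooted)
qed (fact dirs[symmetric] child_unique parent_unique lt_irrefl left_child right_child | (rule lt_trans; assumption))+

text \<open>The disjunction records the last right turn of the path, so that a whole final run of left
  turns can be compared with it in one step.\<close>

lemma lt_right_sub:
  assumes i: "U dr i c" and j: "j \<in> sub c"
  shows "lt i j"
proof -
  have "child\<^sup>*\<^sup>* c j" using j by (simp add: sub_def)
  then have "lt i j \<and> ((U dl)\<^sup>*\<^sup>* c j \<or> (\<exists>k m. lt i k \<and> U dr k m \<and> (U dl)\<^sup>*\<^sup>* m j))"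
  proof induction
    case base
    show ?case using right_child[OF i] by blast
  next
    case (step j j')
    then obtain d where d: "U d j j'" by blast
    show ?case
    proof (cases "d = dr")
      case True
      then have "lt j j'" using d right_child by blast
      then show ?thesis using step.IH d True lt_trans by blast
    next
      case False
      then have "U dl j j'" using d dir_cases by metis
      then have run: "(U dl)\<^sup>*\<^sup>* m j'" if "(U dl)\<^sup>*\<^sup>* m j" for m using that by simp
      from step.IH consider "(U dl)\<^sup>*\<^sup>* c j"
        | k m where "lt i k" "U dr k m" "(U dl)\<^sup>*\<^sup>* m j" by blast
      then show ?thesis
      proof cases
        case 1
        then show ?thesis using run right_child[OF i] by blast
      next
        case (2 k m)
        then show ?thesis using run right_child[of k m j'] lt_trans by blast
      qed
    qed
  qed
  then show ?thesis ..
qed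

lemma lt_left_sub: "U dl i c \<Longrightarrow> j \<in> sub c \<Longrightarrow> lt j i"
  using search_tree.lt_right_sub[OF mirror] search_tree.sub_def[OF mirror] sub_def by metis

lemma sub_refl: "i \<in> sub i"
  by (simp add: sub_def)

lemma sub_trans: "j \<in> sub i \<Longrightarrow> k \<in> sub j \<Longrightarrow> k \<in> sub i"
  by (auto simp: sub_def)

lemma sub_child: "U d i c \<Longrightarrow> c \<in> sub i"
  by (auto simp: sub_def)

lemma not_in_child_sub: "U d i c \<Longrightarrow> i \<notin> sub c"
  using lt_left_sub lt_right_sub lt_irrefl dir_cases by metis

lemma sub_cases:
  assumes "j \<in> sub i" obtains "j = i" | d c where "U d i c" "j \<in> sub c"
proof -
  have "child\<^sup>*\<^sup>* i j" using assms by (simp add: sub_def)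
  then show ?thesis
    by (cases rule: converse_rtranclpE) (use that in \<open>auto simp: sub_def\<close>)
qed

lemma ext_subset_sub: "ext d i \<subseteq> sub i"
  using sub_refl by (auto simp: ext_def intro: sub_trans[OF sub_child])

lemma sub_eq_ext: "sub i = ext dl i \<union> ext dr i"
proof -
  have "sub i \<subseteq> ext dl i \<union> ext dr i"
  proof
    fix j assume "j \<in> sub i"
    then show "j \<in> ext dl i \<union> ext dr i"
    proof (cases rule: sub_cases)
      case (2 d c)
      then have "j \<in> ext d i" by (auto simp: ext_def)
      then show ?thesis using dir_cases[of d] by auto
    qed (simp add: ext_def)
  qed
  then show ?thesis using ext_subset_sub by blast
qed

lemma ext_right: "j \<in> ext dr i \<Longrightarrow> j = i \<or> lt i j"
  using lt_right_sub by (auto simp: ext_def)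

lemma ext_left: "j \<in> ext dl i \<Longrightarrow> j = i \<or> lt j i"
  using lt_left_sub by (auto simp: ext_def)

text \<open>Among the common ancestors choose one with the smallest subtree. No child of it has both
  \<open>c\<close> and \<open>d\<close> below it, so they lie in different extents.\<close>

lemma lowest_common_ancestor:
  obtains i where "c \<in> ext dl i \<and> d \<in> ext dr i \<or> c \<in> ext dr i \<and> d \<in> ext dl i"
proof -
  obtain r where "\<forall>j. child\<^sup>*\<^sup>* r j" using rooted by blast
  then have "c \<in> sub r \<and> d \<in> sub r" by (simp add: sub_def)
  then obtain i where i: "c \<in> sub i" "d \<in> sub i"
    and least: "\<And>k. c \<in> sub k \<Longrightarrow> d \<in> sub k \<Longrightarrow> card (sub i) \<le> card (sub k)"
    using ex_has_least_nat[of "\<lambda>i. c \<in> sub i \<and> d \<in> sub i" r "\<lambda>i. card (sub i)"] by blast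
  have split: "\<not> (c \<in> sub k \<and> d \<in> sub k)" if "U e i k" for e k
  proof -
    have "sub k \<subset> sub i"
      using sub_trans[OF sub_child[OF that]] sub_refl[of i] not_in_child_sub[OF that] by blast
    then have "card (sub k) < card (sub i)" by (simp add: psubset_card_mono)
    then show ?thesis using least[of k] by auto
  qed
  from i(1) show ?thesis
  proof (cases rule: sub_cases)
    case 1
    then show ?thesis using i(2) that[of i] by (auto simp: sub_eq_ext) (auto simp: ext_def)
  next
    case c: (2 e k)
    from i(2) show ?thesis
    proof (cases rule: sub_cases)
      case 1
      then show ?thesis using i(1) that[of i] by (auto simp: sub_eq_ext) (auto simp: ext_def)
    next
      case d: (2 e' k')
      have "e \<noteq> e'" using split[OF c(1)] c d child_unique by metis
      then have "e = dl \<and> e' = dr \<or> e = dr \<and> e' = dl" using dir_cases by metis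
      moreover have "c \<in> ext e i" "d \<in> ext e' i" using c d by (auto simp: ext_def)
      ultimately show ?thesis using that[of i] by blast
    qed
  qed
qed

text \<open>Two nodes are compared through their lowest common ancestor. For the source tree of a
  rectangulation this becomes the totality of the inorder.\<close>

lemma lt_total: "i = j \<or> lt i j \<or> lt j i"
proof -
  obtain k where "i \<in> ext dl k \<and> j \<in> ext dr k \<or> i \<in> ext dr k \<and> j \<in> ext dl k"
    by (rule lowest_common_ancestor)
  then show ?thesis
    using ext_left[of i k] ext_right[of j k] ext_right[of i k] ext_left[of j k] by (auto dest: lt_trans)
qed

text \<open>If \<open>i\<close> and \<open>j\<close> separate at a node \<open>k\<close> other than
  \<open>i\<close>, then all of \<open>sub i\<close> lies strictly on one side of \<open>k\<close>
  while \<open>j\<close> is \<open>k\<close> or lies on the other side, so \<open>j\<close> cannot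
  be between two members of \<open>sub i\<close>.\<close>

lemma sub_convex:
  assumes "c \<in> sub i" "d \<in> sub i" "c = j \<or> lt c j" "j = d \<or> lt j d"
  shows "j \<in> sub i"
proof -
  obtain k where k: "j \<in> ext dl k \<and> i \<in> ext dr k \<or> j \<in> ext dr k \<and> i \<in> ext dl k"
    by (rule lowest_common_ancestor)
  show ?thesis
  proof (cases "i = k")
    case True
    then show ?thesis using k ext_subset_sub by blast
  next
    case False
    from k show ?thesis
    proof
      assume a: "j \<in> ext dl k \<and> i \<in> ext dr k"
      then obtain m where "U dr k m" "i \<in> sub m" using False by (auto simp: ext_def)
      then have "lt k c" using lt_right_sub sub_trans assms(1) by blast
      then have "lt j c" using a ext_left[of j k] by (auto dest: lt_trans)
      then show ?thesis using assms(3) lt_trans[of j c j] by (auto simp: lt_irrefl)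
    next
      assume a: "j \<in> ext dr k \<and> i \<in> ext dl k"
      then obtain m where "U dl k m" "i \<in> sub m" using False by (auto simp: ext_def)
      then have "lt d k" using lt_left_sub sub_trans assms(2) by blast
      then have "lt d j" using a ext_right[of j k] by (auto dest: lt_trans)
      then show ?thesis using assms(4) lt_trans[of j d j] by (auto simp: lt_irrefl)
    qed
  qed
qed

text \<open>If one root is a proper descendant of the other, both ends of the interval lie in a
  single child subtree of the upper root, so one end is on its wrong side. If instead a third node
  \<open>k\<close> separates the roots, the right end lies below \<open>k\<close> in the order and
  the left end above it, so the ends are in the wrong order.\<close>

lemma interval_root_unique:
  assumes "c \<in> ext dl i" "d \<in> ext dr i" "c \<in> ext dl j" "d \<in> ext dr j"
  shows "i = j"
proof -
  have cd: "c = d \<or> lt c d"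
    using ext_left[OF assms(1)] ext_right[OF assms(2)] by (auto dest: lt_trans)
  have *: "i = j" if i: "i \<in> sub j" "c \<in> ext dl i" "d \<in> ext dr i" "c \<in> ext dl j" "d \<in> ext dr j" for i j
    using i(1)
  proof (cases rule: sub_cases)
    case (2 e k)
    have cd: "c \<in> sub k" "d \<in> sub k" using 2 i(2,3) ext_subset_sub sub_trans by blast+
    have "e = dl \<or> e = dr" by (rule dir_cases)
    then show ?thesis
    proof
      assume "e = dl"
      then have "lt d j" using lt_left_sub 2(1) cd(2) by blast
      then show ?thesis using ext_right[OF i(5)] lt_trans[of d j d] by (auto simp: lt_irrefl)
    next
      assume "e = dr"
      then have "lt j c" using lt_right_sub 2(1) cd(1) by blast
      then show ?thesis using ext_left[OF i(4)] lt_trans[of c j c] by (auto simp: lt_irrefl)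
    qed
  qed
  have **: "i \<in> sub j \<or> j \<in> sub i" if k: "i \<in> ext dl k" "j \<in> ext dr k" "d \<in> ext dr i" "c \<in> ext dl j" for i j k
  proof (cases "k = i \<or> k = j")
    case True
    then show ?thesis using k(1,2) ext_subset_sub by blast
  next
    case False
    obtain m where m: "U dl k m" "i \<in> sub m" using False k(1) by (auto simp: ext_def)
    obtain m' where m': "U dr k m'" "j \<in> sub m'" using False k(2) by (auto simp: ext_def)
    have "d \<in> sub m" "c \<in> sub m'" using m m' k(3,4) ext_subset_sub sub_trans by blast+
    then have "lt d c" using lt_left_sub[OF m(1)] lt_right_sub[OF m'(1)] lt_trans by blast
    moreover have "c = j \<or> lt c j" "d = i \<or> lt i d" "lt i k" "lt k j"
      using ext_left[OF k(4)] ext_right[OF k(3)] lt_left_sub[OF m] lt_right_sub[OF m'] by auto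
    ultimately show ?thesis using cd lt_trans[of c d c] by (auto simp: lt_irrefl)
  qed
  obtain k where "i \<in> ext dl k \<and> j \<in> ext dr k \<or> i \<in> ext dr k \<and> j \<in> ext dl k"
    by (rule lowest_common_ancestor)
  then have "i \<in> sub j \<or> j \<in> sub i" using **[of i k j] **[of j k i] assms by blast
  then show ?thesis using *[of i j] *[of j i] assms by blast
qed

section \<open>Counting the leaves of the completed tree\<close>

lemma completed_reach_leaf:
  "(\<lambda>v w. \<exists>e'. completed_child U e' v w)\<^sup>*\<^sup>* (Node c) (Leaf k e) \<longleftrightarrow> k \<in> sub c \<and> (\<nexists>j. U e k j)"
proof
  let ?E = "\<lambda>v w. \<exists>e'. completed_child U e' v w"
  \<comment> \<open>The induction runs backwards from the leaf. It makes no claim when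
    \<open>v\<close> is itself a leaf; that case is settled below, because a leaf has no
    successors.\<close>
  have "\<forall>i. v = Node i \<longrightarrow> k \<in> sub i \<and> (\<nexists>j. U e k j)" if "?E\<^sup>*\<^sup>* v (Leaf k e)" for v
    using that
  proof (induction rule: converse_rtranclp_induct)
    case (step y z)
    then obtain e' where e': "completed_child U e' y z" by blast
    show ?case using e' step.hyps(2)
    proof cases
      case (node i j)
      then have "j \<in> sub i" using sub_child by blast
      then show ?thesis using node step.IH sub_trans by blast
    next
      case (leaf i)
      have "z = Leaf k e" using step.hyps(2) leaf(2)
        by (cases rule: converse_rtranclpE) (auto elim: completed_child.cases)
      then show ?thesis using leaf sub_refl by auto
    qed
  qed simp
  then show "k \<in> sub c \<and> (\<nexists>j. U e k j)" if "?E\<^sup>*\<^sup>* (Node c) (Leaf k e)" using that by blast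
  assume k: "k \<in> sub c \<and> (\<nexists>j. U e k j)"
  then have "child\<^sup>*\<^sup>* c k" by (simp add: sub_def)
  then have "?E\<^sup>*\<^sup>* (Node c) (Node k)"
    by (induction rule: rtranclp_induct) (blast intro: completed_child.node rtranclp.rtrancl_into_rtrancl)+
  then show "?E\<^sup>*\<^sup>* (Node c) (Leaf k e)"
    using k by (blast intro: completed_child.leaf rtranclp.rtrancl_into_rtrancl)
qed

text \<open>Each of the N nodes below \<open>c\<close> has two child slots. The filled slots
  correspond to the nodes other than \<open>c\<close>, so N - 1 of the 2N slots are filled and N + 1
  carry a leaf.\<close>

lemma card_leaves: "card {(k, e). k \<in> sub c \<and> (\<nexists>j. U e k j)} = Suc (card (sub c))"
proof -
  let ?L = "{(k, e). k \<in> sub c \<and> (\<nexists>j. U e k j)}" and ?N = "{(k, e). k \<in> sub c \<and> (\<exists>j. U e k j)}"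
  have D: "UNIV = {dl, dr}" using dir_cases by auto
  then have fD: "finite (UNIV :: direction set)" and cD: "card (UNIV :: direction set) = 2"
    using dirs by (metis finite.emptyI finite_insert, metis card_2_iff)
  have union: "?L \<union> ?N = sub c \<times> UNIV" by auto
  have fin: "finite (sub c \<times> (UNIV :: direction set))" using fD by simp
  have "bij_betw (\<lambda>(k, e). THE j. U e k j) ?N (sub c - {c})"
  proof -
    have the: "(THE j. U e k j) = j" if "U e k j" for e k j
      using that child_unique by blast
    show ?thesis unfolding bij_betw_def
    proof
      show "inj_on (\<lambda>(k, e). THE j. U e k j) ?N"
        by (rule inj_onI) (use the parent_unique in fastforce)
      have "\<exists>k e. k \<in> sub c \<and> U e k j" if "j \<in> sub c" "j \<noteq> c" for j
      proof -
        have "child\<^sup>*\<^sup>* c j" using that by (simp add: sub_def)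
        then show ?thesis by (cases rule: rtranclp.cases) (use that in \<open>auto simp: sub_def\<close>)
      qed
      moreover have "j \<in> sub c - {c}" if "k \<in> sub c" "U e k j" for k e j
        using that sub_trans sub_child not_in_child_sub by blast
      ultimately show "(\<lambda>(k, e). THE j. U e k j) ` ?N = sub c - {c}"
        by (force simp: the image_def)
    qed
  qed
  then have "card ?N = card (sub c) - 1"
    using sub_refl by (simp add: bij_betw_same_card)
  moreover have "card ?L + card ?N = 2 * card (sub c)"
  proof -
    have "card ?L + card ?N = card (sub c \<times> (UNIV :: direction set))"
      unfolding union[symmetric] using fin union
      by (intro card_Un_disjoint[symmetric]) (auto intro: finite_subset)
    then show ?thesis by (simp add: card_cartesian_product cD)
  qed
  \<comment> \<open>This ensures that the natural number subtraction for \<open>?N\<close> is not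
    truncated.\<close>
  moreover have "card (sub c) > 0" using sub_refl by (auto simp: card_gt_0_iff)
  ultimately show ?thesis by linarith
qed

lemma num_leaves_eq_card_ext: "num_leaves U d i = card (ext d i)"
proof (cases "\<exists>c. U d i c")
  case True
  then obtain c where c: "U d i c" by blast
  then have "completed_child U d (Node i) v \<longleftrightarrow> v = Node c" for v
    using child_unique by (auto elim: completed_child.cases intro: completed_child.intros)
  then have "num_leaves U d i = Suc (card (sub c))"
    using card_leaves by (simp add: num_leaves_def completed_reach_leaf)
  moreover have "ext d i = insert i (sub c)" using c child_unique by (auto simp: ext_def)
  ultimately show ?thesis using not_in_child_sub[OF c] by simp
next
  case False
  then have "completed_child U d (Node i) v \<longleftrightarrow> v = Leaf i d" for v
    by (auto elim: completed_child.cases intro: completed_child.intros)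
  moreover have "(\<lambda>v w. \<exists>e'. completed_child U e' v w)\<^sup>*\<^sup>* (Leaf i d) (Leaf k e) \<longleftrightarrow> k = i \<and> e = d" for k e
    by (auto elim: converse_rtranclpE completed_child.cases)
  ultimately have "num_leaves U d i = card {(i, d)}"
    unfolding num_leaves_def by (intro arg_cong[where f = card]) auto
  then show ?thesis using False by (simp add: ext_def)
qed

end

section \<open>Roots of intervals\<close>

locale binary_search_tree = search_tree U dl dr "(<)"
  for U :: "direction \<Rightarrow> 'n::{finite,linorder} \<Rightarrow> 'n \<Rightarrow> bool" and dl dr
begin

text \<open>The lowest common ancestor of the interval, determined by its two ends alone; by
  \<open>sub_root\<close> every other element descends from it as well.\<close>

definition root :: "'n set \<Rightarrow> 'n" where
  "root I = (THE i. Min I \<in> ext dl i \<and> Max I \<in> ext dr i)"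

lemma root_atLeastAtMost:
  assumes "c \<in> ext dl i" "d \<in> ext dr i"
  shows "root {c..d} = i"
proof -
  have "c \<le> i" "i \<le> d" using ext_left ext_right assms by force+
  then have cd: "c \<le> d" by simp
  have "Min {c..d} = c" "Max {c..d} = d" using cd by (auto intro!: Min_eqI Max_eqI)
  then show ?thesis
    unfolding root_def using assms interval_root_unique by (intro the_equality) auto
qed

lemma ex_root:
  assumes "c \<le> d" obtains i where "c \<in> ext dl i" "d \<in> ext dr i"
proof -
  obtain i where i: "c \<in> ext dl i \<and> d \<in> ext dr i \<or> c \<in> ext dr i \<and> d \<in> ext dl i"
    by (rule lowest_common_ancestor)
  show ?thesis
  proof (cases "c \<in> ext dl i \<and> d \<in> ext dr i")
    case False
    then have "c \<in> ext dr i" "d \<in> ext dl i" using i by auto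
    \<comment> \<open>The reversed placement means \<open>d\<close> is at most \<open>i\<close> and
      \<open>c\<close> at least \<open>i\<close>, which together with \<open>c \<le> d\<close>
      leaves only the one-point interval.\<close>
    then have "c = i \<and> d = i" using ext_left[of d i] ext_right[of c i] assms by auto
    then show ?thesis using that[of i] by (auto simp: ext_def)
  qed (use that in blast)
qed

lemma root_in: "I \<in> intervals \<Longrightarrow> root I \<in> I"
proof -
  assume "I \<in> intervals"
  then obtain c d where I: "c \<le> d" "I = {c..d}" by (auto simp: intervals_def)
  obtain i where i: "c \<in> ext dl i" "d \<in> ext dr i" using I(1) by (rule ex_root)
  then show ?thesis using root_atLeastAtMost[OF i] ext_left[of c i] ext_right[of d i] I by auto
qed

lemma sub_root: assumes "I \<in> intervals" "j \<in> I" shows "j \<in> sub (root I)"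
proof -
  obtain c d where I: "c \<le> d" "I = {c..d}" using assms by (auto simp: intervals_def)
  obtain i where i: "c \<in> ext dl i" "d \<in> ext dr i" using I(1) by (rule ex_root)
  have "j \<in> sub i"
    by (rule sub_convex[of c i d]) (use i ext_subset_sub assms(2) I in auto)
  then show ?thesis using root_atLeastAtMost[OF i] I by simp
qed

text \<open>The interval with ends \<open>i\<close> and \<open>j\<close> has root \<open>i\<close>.
  Hence the inequalities attached to roots of intervals include one for every tree edge.\<close>

lemma root_edge:
  assumes "U d i j" shows "\<exists>I\<in>intervals. root I = i \<and> j \<in> I"
proof -
  have j: "j \<in> ext d i" using assms sub_refl by (auto simp: ext_def)
  have i: "i \<in> ext e i" for e by (simp add: ext_def)
  have "d = dl \<or> d = dr" by (rule dir_cases)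
  then show ?thesis
  proof
    assume "d = dl"
    then have "root {j..i} = i" "j \<le> i" using root_atLeastAtMost[of j i i] i j ext_left[of j i] by auto
    then show ?thesis by (intro bexI[of _ "{j..i}"]) (auto simp: intervals_def)
  next
    assume "d = dr"
    then have "root {i..j} = i" "i \<le> j" using root_atLeastAtMost[of i i j] i j ext_right[of j i] by auto
    then show ?thesis by (intro bexI[of _ "{i..j}"]) (auto simp: intervals_def)
  qed
qed

text \<open>A node is the root of exactly as many intervals as there are choices of a left end in its left
  extent and a right end in its right extent.\<close>

lemma sum_num_leaves:
  fixes f :: "'n \<Rightarrow> real"
  shows "(\<Sum>i\<in>UNIV. real (num_leaves U dl i) * real (num_leaves U dr i) * f i) = (\<Sum>I\<in>intervals. f (root I))"
proof -
  let ?A = "SIGMA i:UNIV. ext dl i \<times> ext dr i"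
  have "bij_betw (\<lambda>(i, c, d). {c..d}) ?A intervals"
    unfolding bij_betw_def
  proof
    have le: "c \<le> d" if "(i, c, d) \<in> ?A" for i c d
      using that ext_left[of c i] ext_right[of d i] by auto
    show "inj_on (\<lambda>(i, c, d). {c..d}) ?A"
    proof (rule inj_onI)
      fix p q assume p: "p \<in> ?A" and q: "q \<in> ?A"
        and eq: "(case p of (i, c, d) \<Rightarrow> {c..d}) = (case q of (i, c, d) \<Rightarrow> {c..d})"
      obtain i c d i' c' d' where pq: "p = (i, c, d)" "q = (i', c', d')" by (cases p; cases q) auto
      then have "c \<le> d" using le[of i c d] p by auto
      then have "c = c' \<and> d = d'" using eq pq by (simp add: Icc_eq_Icc)
      then show "p = q" using p q pq interval_root_unique by auto
    qed
    show "(\<lambda>(i, c, d). {c..d}) ` ?A = intervals"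
    proof
      show "(\<lambda>(i, c, d). {c..d}) ` ?A \<subseteq> intervals"
        using le unfolding intervals_def by blast
      show "intervals \<subseteq> (\<lambda>(i, c, d). {c..d}) ` ?A"
      proof
        fix I :: "'n set" assume "I \<in> intervals"
        then obtain c d where I: "c \<le> d" "I = {c..d}" by (auto simp: intervals_def)
        obtain i where "c \<in> ext dl i" "d \<in> ext dr i" using I(1) by (rule ex_root)
        then show "I \<in> (\<lambda>(i, c, d). {c..d}) ` ?A" using I by force
      qed
    qed
  qed
  from sum.reindex_bij_betw[OF this, of "\<lambda>I. f (root I)"]
  have "(\<Sum>I\<in>intervals. f (root I)) = (\<Sum>(i, c, d)\<in>?A. f (root {c..d}))"
    by (simp add: case_prod_beta)
  also have "\<dots> = (\<Sum>(i, c, d)\<in>?A. f i)"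
    by (rule sum.cong) (auto simp: root_atLeastAtMost)
  also have "\<dots> = (\<Sum>i\<in>UNIV. \<Sum>p\<in>ext dl i \<times> ext dr i. f i)"
    by (subst sum.Sigma) (auto simp: case_prod_beta finite_SigmaI)
  finally show ?thesis
    using num_leaves_eq_card_ext by (simp add: card_cartesian_product)
qed

end

subsection \<open>Local structure of rectangulations\<close>

lemma region_eq: "region r = {xmin r..xmax r} \<times> {ymin r..ymax r}"
  by (auto simp: region_def mem_box Basis_prod_def inner_prod_def)

lemma interior_region: "interior (region r) = {xmin r<..<xmax r} \<times> {ymin r<..<ymax r}"
  by (auto simp: region_eq interior_Times)

locale rectangulated =
  fixes R :: "rect set"
  assumes rectangulation: "rectangulation R"
begin

abbreviation "X0 \<equiv> xmin (bounding_box R)"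
abbreviation "X1 \<equiv> xmax (bounding_box R)"
abbreviation "Y0 \<equiv> ymin (bounding_box R)"
abbreviation "Y1 \<equiv> ymax (bounding_box R)"

lemma finite_R: "finite R"
  using rectangulation by (simp add: rectangulation_def)

lemma proper: "r \<in> R \<Longrightarrow> xmin r < xmax r" "r \<in> R \<Longrightarrow> ymin r < ymax r"
  using rectangulation by (auto simp: rectangulation_def proper_rect_def)

lemma box_proper: "X0 < X1" "Y0 < Y1"
  using rectangulation by (auto simp: rectangulation_def is_square_def proper_rect_def)

lemma bounds:
  assumes "r \<in> R"
  shows "X0 \<le> xmin r" "xmax r \<le> X1" "Y0 \<le> ymin r" "ymax r \<le> Y1"
  using assms finite_R by (auto simp: bounding_box_def)

lemma covers:
  assumes "X0 \<le> x" "x \<le> X1" "Y0 \<le> y" "y \<le> Y1"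
  obtains r where "r \<in> R" "xmin r \<le> x" "x \<le> xmax r" "ymin r \<le> y" "y \<le> ymax r"
proof -
  have "(\<Union>r\<in>R. region r) = region (bounding_box R)"
    using rectangulation by (auto simp: rectangulation_def division_of_def)
  moreover have "(x, y) \<in> region (bounding_box R)" using assms by (simp add: region_eq)
  ultimately obtain r where "r \<in> R" "(x, y) \<in> region r" by blast
  then show ?thesis using that[of r] by (simp add: region_eq)
qed

lemma overlap_eq:
  assumes rs: "r \<in> R" "s \<in> R"
    and lt: "xmin r < xmax s" "xmin s < xmax r" "ymin r < ymax s" "ymin s < ymax r"
  shows "r = s"
proof (rule ccontr)
  assume "r \<noteq> s"
  \<comment> \<open>\<open>division_of\<close> speaks about regions, not rectangles; a proper
    rectangle can be recovered from its region, so distinct rectangles have distinct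
    regions.\<close>
  then have "region r \<noteq> region s"
    using proper[OF rs(1)] proper[OF rs(2)]
    by (auto simp: region_eq times_eq_iff Icc_eq_Icc intro: rect.expand)
  then have disjoint: "interior (region r) \<inter> interior (region s) = {}"
    using rectangulation rs unfolding rectangulation_def division_of_def by blast
  obtain x where "max (xmin r) (xmin s) < x" "x < min (xmax r) (xmax s)"
    using dense[of "max (xmin r) (xmin s)" "min (xmax r) (xmax s)"] proper rs lt by auto
  moreover obtain y where "max (ymin r) (ymin s) < y" "y < min (ymax r) (ymax s)"
    using dense[of "max (ymin r) (ymin s)" "min (ymax r) (ymax s)"] proper rs lt by auto
  ultimately have "(x, y) \<in> interior (region r)" "(x, y) \<in> interior (region s)"
    by (simp_all add: interior_region)
  then show False using disjoint by blast
qed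

section \<open>Rectangles filling the quadrants at a point\<close>

lemma small_displacement:
  fixes x y :: real
  obtains e where "e > 0"
    "\<And>r. r \<in> insert (bounding_box R) R \<Longrightarrow>
       (x < xmin r \<longrightarrow> x + e < xmin r) \<and> (xmin r < x \<longrightarrow> xmin r < x - e) \<and>
       (x < xmax r \<longrightarrow> x + e < xmax r) \<and> (xmax r < x \<longrightarrow> xmax r < x - e) \<and>
       (y < ymin r \<longrightarrow> y + e < ymin r) \<and> (ymin r < y \<longrightarrow> ymin r < y - e) \<and>
       (y < ymax r \<longrightarrow> y + e < ymax r) \<and> (ymax r < y \<longrightarrow> ymax r < y - e)"
proof -
  \<comment> \<open>Each of the finitely many strict inequalities survives every sufficiently small
    displacement, so one \<open>e\<close> serves them all. The bounding box takes part in order that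
    the displaced point stays inside the square.\<close>
  have lt: "\<forall>\<^sub>F e in at_right 0. a < b \<longrightarrow> a + e < b" for a b :: real
    by (cases "a < b") (use eventually_at_right_real[of 0 "b - a"] in \<open>auto elim: eventually_mono\<close>)
  have lt': "\<forall>\<^sub>F e in at_right 0. a < b \<longrightarrow> a < b - e" for a b :: real
    using lt[of a b] by (auto elim: eventually_mono)
  have "\<forall>\<^sub>F e in at_right 0. \<forall>r\<in>insert (bounding_box R) R.
       (x < xmin r \<longrightarrow> x + e < xmin r) \<and> (xmin r < x \<longrightarrow> xmin r < x - e) \<and>
       (x < xmax r \<longrightarrow> x + e < xmax r) \<and> (xmax r < x \<longrightarrow> xmax r < x - e) \<and>
       (y < ymin r \<longrightarrow> y + e < ymin r) \<and> (ymin r < y \<longrightarrow> ymin r < y - e) \<and>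
       (y < ymax r \<longrightarrow> y + e < ymax r) \<and> (ymax r < y \<longrightarrow> ymax r < y - e)"
    by (intro eventually_ball_finite ballI eventually_conj lt lt') (use finite_R in auto)
  moreover have "\<forall>\<^sub>F e in at_right (0::real). e > 0" by (rule eventually_at_right_less)
  ultimately obtain e where "e > 0"
    "\<forall>r\<in>insert (bounding_box R) R.
       (x < xmin r \<longrightarrow> x + e < xmin r) \<and> (xmin r < x \<longrightarrow> xmin r < x - e) \<and>
       (x < xmax r \<longrightarrow> x + e < xmax r) \<and> (xmax r < x \<longrightarrow> xmax r < x - e) \<and>
       (y < ymin r \<longrightarrow> y + e < ymin r) \<and> (ymin r < y \<longrightarrow> ymin r < y - e) \<and>
       (y < ymax r \<longrightarrow> y + e < ymax r) \<and> (ymax r < y \<longrightarrow> ymax r < y - e)"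
    using eventually_happens'[OF trivial_limit_at_right_real eventually_conj] by blast
  then show ?thesis using that[of e] by blast
qed

text \<open>A closed rectangle covering a diagonal displacement of the point also contains the
  point, and strictly extends beyond it towards the displacement. This and its three variants give
  the rectangle that fills a given quadrant near the point.\<close>

lemma north_east:
  assumes "X0 \<le> x" "x < X1" "Y0 \<le> y" "y < Y1"
  obtains r where "r \<in> R" "xmin r \<le> x" "x < xmax r" "ymin r \<le> y" "y < ymax r"
proof -
  obtain e where e: "e > 0" and small: "\<And>r. r \<in> insert (bounding_box R) R \<Longrightarrow>
      (x < xmin r \<longrightarrow> x + e < xmin r) \<and> (x < xmax r \<longrightarrow> x + e < xmax r) \<and>
      (y < ymin r \<longrightarrow> y + e < ymin r) \<and> (y < ymax r \<longrightarrow> y + e < ymax r)"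
    using small_displacement[of x y] by metis
  obtain r where r: "r \<in> R" "xmin r \<le> x + e" "x + e \<le> xmax r" "ymin r \<le> y + e" "y + e \<le> ymax r"
    using covers[of "x + e" "y + e"] assms e small[of "bounding_box R"] by auto
  then show ?thesis using that[of r] small[of r] e by force
qed

lemma north_west:
  assumes "X0 < x" "x \<le> X1" "Y0 \<le> y" "y < Y1"
  obtains r where "r \<in> R" "xmin r < x" "x \<le> xmax r" "ymin r \<le> y" "y < ymax r"
proof -
  obtain e where e: "e > 0" and small: "\<And>r. r \<in> insert (bounding_box R) R \<Longrightarrow>
      (xmin r < x \<longrightarrow> xmin r < x - e) \<and> (xmax r < x \<longrightarrow> xmax r < x - e) \<and>
      (y < ymin r \<longrightarrow> y + e < ymin r) \<and> (y < ymax r \<longrightarrow> y + e < ymax r)"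
    using small_displacement[of x y] by metis
  obtain r where r: "r \<in> R" "xmin r \<le> x - e" "x - e \<le> xmax r" "ymin r \<le> y + e" "y + e \<le> ymax r"
    using covers[of "x - e" "y + e"] assms e small[of "bounding_box R"] by auto
  then show ?thesis using that[of r] small[of r] e by force
qed

lemma south_east:
  assumes "X0 \<le> x" "x < X1" "Y0 < y" "y \<le> Y1"
  obtains r where "r \<in> R" "xmin r \<le> x" "x < xmax r" "ymin r < y" "y \<le> ymax r"
proof -
  obtain e where e: "e > 0" and small: "\<And>r. r \<in> insert (bounding_box R) R \<Longrightarrow>
      (x < xmin r \<longrightarrow> x + e < xmin r) \<and> (x < xmax r \<longrightarrow> x + e < xmax r) \<and>
      (ymin r < y \<longrightarrow> ymin r < y - e) \<and> (ymax r < y \<longrightarrow> ymax r < y - e)"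
    using small_displacement[of x y] by metis
  obtain r where r: "r \<in> R" "xmin r \<le> x + e" "x + e \<le> xmax r" "ymin r \<le> y - e" "y - e \<le> ymax r"
    using covers[of "x + e" "y - e"] assms e small[of "bounding_box R"] by auto
  then show ?thesis using that[of r] small[of r] e by force
qed

lemma south_west:
  assumes "X0 < x" "x \<le> X1" "Y0 < y" "y \<le> Y1"
  obtains r where "r \<in> R" "xmin r < x" "x \<le> xmax r" "ymin r < y" "y \<le> ymax r"
proof -
  obtain e where e: "e > 0" and small: "\<And>r. r \<in> insert (bounding_box R) R \<Longrightarrow>
      (xmin r < x \<longrightarrow> xmin r < x - e) \<and> (xmax r < x \<longrightarrow> xmax r < x - e) \<and>
      (ymin r < y \<longrightarrow> ymin r < y - e) \<and> (ymax r < y \<longrightarrow> ymax r < y - e)"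
    using small_displacement[of x y] by metis
  obtain r where r: "r \<in> R" "xmin r \<le> x - e" "x - e \<le> xmax r" "ymin r \<le> y - e" "y - e \<le> ymax r"
    using covers[of "x - e" "y - e"] assms e small[of "bounding_box R"] by auto
  then show ?thesis using that[of r] small[of r] e by force
qed

lemma corner_inj: "inj_on bottom_left R" "inj_on bottom_right R" "inj_on top_left R" "inj_on top_right R"
proof -
  have "r = s" if "r \<in> R" "s \<in> R" "bottom_left r = bottom_left s \<or> bottom_right r = bottom_right s \<or>
    top_left r = top_left s \<or> top_right r = top_right s" for r s
    using that(3) overlap_eq[OF that(1,2)] proper[OF that(1)] proper[OF that(2)]
    by (auto simp: bottom_left_def bottom_right_def top_left_def top_right_def)
  then show "inj_on bottom_left R" "inj_on bottom_right R" "inj_on top_left R" "inj_on top_right R"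
    by (auto simp: inj_on_def)
qed

text \<open>Two rectangles with the same corner of the same kind overlap, so each kind of corner
  occurs at most once at \<open>p\<close>. Four rectangles at \<open>p\<close> therefore means one
  of each kind.\<close>

lemma generic_iff:
  "generic R \<longleftrightarrow> (\<nexists>p a b c d. a \<in> R \<and> b \<in> R \<and> c \<in> R \<and> d \<in> R \<and>
     bottom_left a = p \<and> bottom_right b = p \<and> top_left c = p \<and> top_right d = p)"
proof
  assume g: "generic R"
  show "\<nexists>p a b c d. a \<in> R \<and> b \<in> R \<and> c \<in> R \<and> d \<in> R \<and>
     bottom_left a = p \<and> bottom_right b = p \<and> top_left c = p \<and> top_right d = p"
  proof (intro notI, elim exE conjE)
    fix p a b c d
    assume R: "a \<in> R" "b \<in> R" "c \<in> R" "d \<in> R"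
      and p: "bottom_left a = p" "bottom_right b = p" "top_left c = p" "top_right d = p"
    then have eq: "bottom_right b = bottom_left a" "top_left c = bottom_left a" "top_right d = bottom_left a"
      by auto
    have distinct: "a \<noteq> b \<and> a \<noteq> c \<and> a \<noteq> d \<and> b \<noteq> c \<and> b \<noteq> d \<and> c \<noteq> d"
      using eq proper[OF R(1)] proper[OF R(2)] proper[OF R(3)] proper[OF R(4)]
      by (auto simp: bottom_left_def bottom_right_def top_left_def top_right_def)
    have "{a, b, c, d} \<subseteq> {r \<in> R. bottom_left a \<in> corners r}"
      using R eq by (auto simp: corners_def)
    then have "card {a, b, c, d} \<le> card {r \<in> R. bottom_left a \<in> corners r}"
      using finite_R by (intro card_mono) auto
    then have "4 \<le> card {r \<in> R. bottom_left a \<in> corners r}" using distinct by simp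
    then show False using g unfolding generic_def by (meson not_less)
  qed
next
  assume no: "\<nexists>p a b c d. a \<in> R \<and> b \<in> R \<and> c \<in> R \<and> d \<in> R \<and>
     bottom_left a = p \<and> bottom_right b = p \<and> top_left c = p \<and> top_right d = p"
  have "card {r \<in> R. p \<in> corners r} < 4" for p
  proof -
    define A where "A f = {r \<in> R. f r = p}" for f :: "rect \<Rightarrow> real \<times> real"
    have one: "card (A f) \<le> 1" if "inj_on f R" for f
      using that unfolding A_def by (auto simp: card_le_Suc0_iff_eq finite_R inj_on_def)
    have "A bottom_left = {} \<or> A bottom_right = {} \<or> A top_left = {} \<or> A top_right = {}"
      using no unfolding A_def by blast
    then have "card (A bottom_left) + card (A bottom_right) + card (A top_left) + card (A top_right) < 4"
      using one[OF corner_inj(1)] one[OF corner_inj(2)] one[OF corner_inj(3)] one[OF corner_inj(4)] by auto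
    moreover have "{r \<in> R. p \<in> corners r} = A bottom_left \<union> A bottom_right \<union> A top_left \<union> A top_right"
      by (auto simp: A_def corners_def)
    moreover have "card (A bottom_left \<union> A bottom_right \<union> A top_left \<union> A top_right)
       \<le> card (A bottom_left) + card (A bottom_right) + card (A top_left) + card (A top_right)"
      by (meson add_le_mono1 card_Un_le le_trans)
    ultimately show ?thesis by (metis le_less_trans)
  qed
  then show "generic R" by (simp add: generic_def)
qed

end

section \<open>Parents in the source and target trees\<close>

locale generic_rectangulation = rectangulated +
  assumes generic: "generic R"
begin

lemmas corner_defs = bottom_left_def bottom_right_def top_left_def top_right_def

lemma no_crossing:
  assumes "a \<in> R" "b \<in> R" "c \<in> R" "d \<in> R"
    "bottom_left a = p" "bottom_right b = p" "top_left c = p" "top_right d = p"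
  shows False
  using generic assms unfolding generic_iff by blast

text \<open>If \<open>r\<close> and \<open>s\<close> met diagonally at a point, the rectangles in
  the other two quadrants would be confined by both and would have corners there too, giving
  four.\<close>

lemma top_right_neq_bottom_left:
  assumes rs: "r \<in> R" "s \<in> R"
  shows "top_right r \<noteq> bottom_left s"
proof
  assume eq: "top_right r = bottom_left s"
  then have xy: "xmax r = xmin s" "ymax r = ymin s" by (auto simp: corner_defs)
  note pb = proper[OF rs(1)] proper[OF rs(2)] bounds[OF rs(1)] bounds[OF rs(2)]
  obtain n where n: "n \<in> R" "xmin n < xmin s" "xmin s \<le> xmax n" "ymin n \<le> ymin s" "ymin s < ymax n"
    using north_west[of "xmin s" "ymin s"] pb xy by (metis less_le_trans le_less_trans less_le)
  obtain e where e: "e \<in> R" "xmin e \<le> xmin s" "xmin s < xmax e" "ymin e < ymin s" "ymin s \<le> ymax e"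
    using south_east[of "xmin s" "ymin s"] pb xy by (metis less_le_trans le_less_trans less_le)
  have "xmax n = xmin s" using overlap_eq[of n s] n rs pb by force
  moreover have "ymin n = ymin s" using overlap_eq[of n r] n rs pb xy by force
  moreover have "ymax e = ymin s" using overlap_eq[of e s] e rs pb by force
  moreover have "xmin e = xmin s" using overlap_eq[of e r] e rs pb xy by force
  ultimately show False
    using no_crossing[OF rs(2) n(1) e(1) rs(1)] eq by (auto simp: corner_defs)
qed

text \<open>A horizontal parent \<open>i\<close> and a vertical parent \<open>k\<close> at the same
  corner leave to the rectangle south-west of it only a quadrant, so that it has its top right
  corner there as the fourth rectangle.\<close>

lemma source_parent_unique:
  assumes R: "i \<in> R" "j \<in> R" "k \<in> R"
    and eq: "bottom_right i = bottom_left j" "top_left k = bottom_left j"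
  shows False
proof -
  have xy: "xmax i = xmin j" "ymin i = ymin j" "xmin k = xmin j" "ymax k = ymin j"
    using eq by (auto simp: corner_defs)
  note pb = proper[OF R(1)] proper[OF R(2)] proper[OF R(3)] bounds[OF R(1)] bounds[OF R(2)] bounds[OF R(3)]
  obtain w where w: "w \<in> R" "xmin w < xmin j" "xmin j \<le> xmax w" "ymin w < ymin j" "ymin j \<le> ymax w"
    using south_west[of "xmin j" "ymin j"] pb xy by (metis less_le_trans le_less_trans less_le)
  have "xmax w = xmin j" using overlap_eq[of w k] w R pb xy by force
  moreover have "ymax w = ymin j" using overlap_eq[of w i] w R pb xy by force
  ultimately show False
    using no_crossing[OF R(2) R(1) R(3) w(1)] eq by (auto simp: corner_defs)
qed

lemma target_parent_unique:
  assumes R: "i \<in> R" "j \<in> R" "k \<in> R"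
    and eq: "top_left i = top_right j" "bottom_right k = top_right j"
  shows False
proof -
  have xy: "xmin i = xmax j" "ymax i = ymax j" "xmax k = xmax j" "ymin k = ymax j"
    using eq by (auto simp: corner_defs)
  note pb = proper[OF R(1)] proper[OF R(2)] proper[OF R(3)] bounds[OF R(1)] bounds[OF R(2)] bounds[OF R(3)]
  obtain w where w: "w \<in> R" "xmin w \<le> xmax j" "xmax j < xmax w" "ymin w \<le> ymax j" "ymax j < ymax w"
    using north_east[of "xmax j" "ymax j"] pb xy by (metis less_le_trans le_less_trans less_le)
  have "xmin w = xmax j" using overlap_eq[of w k] w R pb xy by force
  moreover have "ymin w = ymax j" using overlap_eq[of w i] w R pb xy by force
  ultimately show False
    using no_crossing[OF w(1) R(3) R(1) R(2)] eq by (auto simp: corner_defs)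
qed

text \<open>The rectangle \<open>w\<close> south-west of the corner cannot pass it in both
  directions without overlapping \<open>j\<close>. If its right side is at the corner, the rectangle
  to the south-east has its top left corner there and is a vertical parent; if its top side is, the
  one to the north-west is a horizontal parent. On the left and bottom sides of the square, the
  boundary takes the place of \<open>w\<close>.\<close>

lemma source_parent_exists:
  assumes j: "j \<in> R" and ne: "bottom_left j \<noteq> (X0, Y0)"
  shows "\<exists>i\<in>R. bottom_right i = bottom_left j \<or> top_left i = bottom_left j"
proof -
  let ?x = "xmin j" and ?y = "ymin j"
  note pb = proper[OF j] bounds[OF j]
  have X: "X0 \<le> ?x" "?x \<le> X1" "Y0 \<le> ?y" "?y \<le> Y1" "?x < X1" "?y < Y1" using pb by linarith+
  have west: ?thesis
    if n: "n \<in> R" "xmin n < ?x" "?x \<le> xmax n" "ymin n \<le> ?y" "?y < ymax n" "ymin n = ?y" for n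
  proof -
    have "xmax n = ?x" using overlap_eq[of n j] n j pb by force
    then show ?thesis using n(1,6) by (intro bexI[of _ n]) (auto simp: corner_defs)
  qed
  have south: ?thesis
    if e: "e \<in> R" "xmin e \<le> ?x" "?x < xmax e" "ymin e < ?y" "?y \<le> ymax e" "xmin e = ?x" for e
  proof -
    have "ymax e = ?y" using overlap_eq[of e j] e j pb by force
    then show ?thesis using e(1,6) by (intro bexI[of _ e]) (auto simp: corner_defs)
  qed
  show ?thesis
  proof (cases "?x = X0")
    case True
    then have y: "Y0 < ?y" using ne pb by (auto simp: corner_defs)
    obtain e where e: "e \<in> R" "xmin e \<le> ?x" "?x < xmax e" "ymin e < ?y" "?y \<le> ymax e"
      by (rule south_east[OF X(1,5) y X(4)])
    have "xmin e = ?x" using e(2,3,4,5) bounds(1)[OF e(1)] True by linarith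
    then show ?thesis using south[of e] e by blast
  next
    case False
    then have x: "X0 < ?x" using X by linarith
    show ?thesis
    proof (cases "?y = Y0")
      case True
      obtain n where n: "n \<in> R" "xmin n < ?x" "?x \<le> xmax n" "ymin n \<le> ?y" "?y < ymax n"
        by (rule north_west[OF x X(2,3,6)])
      have "ymin n = ?y" using n(2,3,4,5) bounds(3)[OF n(1)] True by linarith
      then show ?thesis using west[of n] n by blast
    next
      case False
      then have y: "Y0 < ?y" using X by linarith
      obtain n where n: "n \<in> R" "xmin n < ?x" "?x \<le> xmax n" "ymin n \<le> ?y" "?y < ymax n"
        by (rule north_west[OF x X(2,3,6)])
      obtain e where e: "e \<in> R" "xmin e \<le> ?x" "?x < xmax e" "ymin e < ?y" "?y \<le> ymax e"
        by (rule south_east[OF X(1,5) y X(4)])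
      obtain w where w: "w \<in> R" "xmin w < ?x" "?x \<le> xmax w" "ymin w < ?y" "?y \<le> ymax w"
        by (rule south_west[OF x X(2) y X(4)])
      have "\<not> (?x < xmax w \<and> ?y < ymax w)" using overlap_eq[of w j] w j pb by force
      then consider "xmax w = ?x" | "ymax w = ?y" using w by linarith
      then show ?thesis
      proof cases
        case 1
        then have "xmin e = ?x" using overlap_eq[of e w] e w by force
        then show ?thesis using south[of e] e by blast
      next
        case 2
        then have "ymin n = ?y" using overlap_eq[of n w] n w by force
        then show ?thesis using west[of n] n by blast
      qed
    qed
  qed
qed

text \<open>The half-turn of \<open>source_parent_exists\<close>: now the rectangle north-east of
  the corner decides which kind of parent occurs.\<close>

lemma target_parent_exists:
  assumes j: "j \<in> R" and ne: "top_right j \<noteq> (X1, Y1)"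
  shows "\<exists>i\<in>R. top_left i = top_right j \<or> bottom_right i = top_right j"
proof -
  let ?x = "xmax j" and ?y = "ymax j"
  note pb = proper[OF j] bounds[OF j]
  have X: "X0 \<le> ?x" "?x \<le> X1" "Y0 \<le> ?y" "?y \<le> Y1" "X0 < ?x" "Y0 < ?y" using pb by linarith+
  have east: ?thesis
    if e: "e \<in> R" "xmin e \<le> ?x" "?x < xmax e" "ymin e < ?y" "?y \<le> ymax e" "ymax e = ?y" for e
  proof -
    have "xmin e = ?x" using overlap_eq[of e j] e j pb by force
    then show ?thesis using e(1,6) by (intro bexI[of _ e]) (auto simp: corner_defs)
  qed
  have north: ?thesis
    if n: "n \<in> R" "xmin n < ?x" "?x \<le> xmax n" "ymin n \<le> ?y" "?y < ymax n" "xmax n = ?x" for n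
  proof -
    have "ymin n = ?y" using overlap_eq[of n j] n j pb by force
    then show ?thesis using n(1,6) by (intro bexI[of _ n]) (auto simp: corner_defs)
  qed
  show ?thesis
  proof (cases "?x = X1")
    case True
    then have y: "?y < Y1" using ne pb by (auto simp: corner_defs)
    obtain n where n: "n \<in> R" "xmin n < ?x" "?x \<le> xmax n" "ymin n \<le> ?y" "?y < ymax n"
      by (rule north_west[OF X(5,2,3) y])
    have "xmax n = ?x" using n(2,3,4,5) bounds(2)[OF n(1)] True by linarith
    then show ?thesis using north[of n] n by blast
  next
    case False
    then have x: "?x < X1" using X by linarith
    show ?thesis
    proof (cases "?y = Y1")
      case True
      obtain e where e: "e \<in> R" "xmin e \<le> ?x" "?x < xmax e" "ymin e < ?y" "?y \<le> ymax e"
        by (rule south_east[OF X(1) x X(6,4)])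
      have "ymax e = ?y" using e(2,3,4,5) bounds(4)[OF e(1)] True by linarith
      then show ?thesis using east[of e] e by blast
    next
      case False
      then have y: "?y < Y1" using X by linarith
      obtain n where n: "n \<in> R" "xmin n < ?x" "?x \<le> xmax n" "ymin n \<le> ?y" "?y < ymax n"
        by (rule north_west[OF X(5,2,3) y])
      obtain e where e: "e \<in> R" "xmin e \<le> ?x" "?x < xmax e" "ymin e < ?y" "?y \<le> ymax e"
        by (rule south_east[OF X(1) x X(6,4)])
      obtain w where w: "w \<in> R" "xmin w \<le> ?x" "?x < xmax w" "ymin w \<le> ?y" "?y < ymax w"
        by (rule north_east[OF X(1) x X(3) y])
      have "\<not> (xmin w < ?x \<and> ymin w < ?y)" using overlap_eq[of w j] w j pb by force
      then consider "xmin w = ?x" | "ymin w = ?y" using w by linarith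
      then show ?thesis
      proof cases
        case 1
        then have "xmax n = ?x" using overlap_eq[of n w] n w by force
        then show ?thesis using north[of n] n by blast
      next
        case 2
        then have "ymax e = ?y" using overlap_eq[of e w] e w by force
        then show ?thesis using east[of e] e by blast
      qed
    qed
  qed
qed

end

subsection \<open>Translating disjoint convex sets\<close>

text \<open>a blocks the translation of b in direction north-west.\<close>

definition level :: "real \<times> real \<Rightarrow> real" where
  "level p = fst p + snd p"

definition blocks :: "(real \<times> real) set \<Rightarrow> (real \<times> real) set \<Rightarrow> bool" where
  "blocks a b \<longleftrightarrow> a \<noteq> b \<and> (\<exists>p\<in>a. \<exists>q\<in>b. level p = level q \<and> fst p < fst q)"

text \<open>If the order along level lines changed between two lines, some convex combination of the
  two situations would make the horizontal gap zero, and this would be a common point of the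
  disjoint sets.\<close>

lemma blocks_consistent:
  assumes convex: "convex a" "convex b" and disjoint: "a \<inter> b = {}"
    and pq: "p \<in> a" "q \<in> b" "level p = level q" "fst p < fst q"
    and pq': "p' \<in> a" "q' \<in> b" "level p' = level q'"
  shows "fst p' < fst q'"
proof (rule ccontr)
  assume "\<not> fst p' < fst q'"
  define t where "t = fst q - fst p"
  define t' where "t' = fst p' - fst q'"
  have t: "t > 0" "t' \<ge> 0" using pq(4) \<open>\<not> fst p' < fst q'\<close> by (auto simp: t_def t'_def)
  \<comment> \<open>The weights balance the two opposite gaps, \<open>u * t = v * t'\<close>, so the
    combined points of \<open>a\<close> and of \<open>b\<close> coincide.\<close>
  define u where "u = t' / (t + t')"
  define v where "v = t / (t + t')"
  have uv: "u \<ge> 0" "v \<ge> 0" "u + v = 1" "u * t = v * t'"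
    using t by (auto simp: u_def v_def add_divide_distrib[symmetric])
  have in_a: "u *\<^sub>R p + v *\<^sub>R p' \<in> a" using convexD[OF convex(1)] pq pq' uv by blast
  have in_b: "u *\<^sub>R q + v *\<^sub>R q' \<in> b" using convexD[OF convex(2)] pq pq' uv by blast
  have x: "fst q = fst p + t" "fst q' = fst p' - t'" by (simp_all add: t_def t'_def)
  have y: "snd q = snd p - t" "snd q' = snd p' + t'"
    using pq(3) pq'(3) x by (simp_all add: level_def)
  have "u *\<^sub>R q + v *\<^sub>R q' = u *\<^sub>R p + v *\<^sub>R p'"
    using uv(4) by (simp add: prod_eq_iff x y algebra_simps)
  then show False using in_a in_b disjoint by auto
qed

lemma convex_level_image: "convex a \<Longrightarrow> convex (level ` a)"
  by (rule convex_linear_image) (auto simp: linear_iff level_def algebra_simps)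

lemma point_at_level:
  assumes a: "convex a" "bdd_above (level ` a)" "p \<in> a" and c: "level p \<le> c" "c < Sup (level ` a)"
  obtains q where "q \<in> a" "level q = c"
proof -
  obtain q where q: "q \<in> a" "c < level q"
    using less_cSup_iff[of "level ` a" c] a c(2) by blast
  have "c \<in> level ` a"
    using convex_level_image[OF a(1)] q a(3) c(1)
    by (meson image_eqI is_interval_convex_1 mem_is_interval_1_I less_imp_le)
  then show ?thesis using that by blast
qed

text \<open>The sets to come include segments, which are not open in the plane.
  \<open>no_top\<close> keeps the part of openness that matters: no member attains the supremum of
  its levels, so there is always room for a common level line strictly below it.\<close>

locale disjoint_convex_sets =
  fixes F :: "(real \<times> real) set set"
  assumes finite: "finite F"
    and convex: "a \<in> F \<Longrightarrow> convex a"
    and bdd_above: "a \<in> F \<Longrightarrow> bdd_above (level ` a)"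
    and no_top: "a \<in> F \<Longrightarrow> p \<in> a \<Longrightarrow> \<exists>q\<in>a. level p < level q"
    and disjoint: "a \<in> F \<Longrightarrow> b \<in> F \<Longrightarrow> a \<noteq> b \<Longrightarrow> a \<inter> b = {}"
begin

lemma level_less_Sup:
  assumes "a \<in> F" "p \<in> a" shows "level p < Sup (level ` a)"
proof -
  obtain q where "q \<in> a" "level p < level q" using no_top assms by blast
  moreover have "level q \<le> Sup (level ` a)"
    using \<open>q \<in> a\<close> bdd_above[OF assms(1)] by (auto intro: cSup_upper)
  ultimately show ?thesis by linarith
qed

lemma blocks_asym:
  assumes "a \<in> F" "b \<in> F" "blocks a b" shows "\<not> blocks b a"
proof
  assume "blocks b a"
  then obtain p q where "p \<in> b" "q \<in> a" "level p = level q" "fst p < fst q" "a \<noteq> b"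
    by (auto simp: blocks_def)
  moreover obtain p' q' where "p' \<in> a" "q' \<in> b" "level p' = level q'" "fst p' < fst q'"
    using assms(3) by (auto simp: blocks_def)
  ultimately have "fst q < fst p"
    using blocks_consistent[of a b p' q' q p] convex disjoint assms by simp
  then show False using \<open>fst p < fst q\<close> by simp
qed

text \<open>Just below the supremum of the levels of b all three sets meet the same level line.\<close>

lemma blocks_trans:
  assumes F: "a \<in> F" "b \<in> F" "c \<in> F" and ab: "blocks a b" and bc: "blocks b c"
    and Sup: "Sup (level ` b) \<le> Sup (level ` a)" "Sup (level ` b) \<le> Sup (level ` c)"
  shows "blocks a c"
proof -
  have "a \<noteq> c" using blocks_asym F ab bc by blast
  obtain p q where pq: "p \<in> a" "q \<in> b" "level p = level q" "fst p < fst q" and "a \<noteq> b"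
    using ab by (auto simp: blocks_def)
  obtain r s where rs: "r \<in> b" "s \<in> c" "level r = level s" "fst r < fst s" and "b \<noteq> c"
    using bc by (auto simp: blocks_def)
  define m where "m = max (level q) (level r)"
  have "m < Sup (level ` b)" using level_less_Sup[OF F(2) pq(2)] level_less_Sup[OF F(2) rs(1)] by (simp add: m_def)
  then have m: "m < Sup (level ` a)" "m < Sup (level ` b)" "m < Sup (level ` c)" using Sup by auto
  obtain a' where a': "a' \<in> a" "level a' = m"
    using point_at_level[OF convex bdd_above pq(1) _ m(1)] F pq by (auto simp: m_def)
  obtain b' where b': "b' \<in> b" "level b' = m"
    using point_at_level[OF convex bdd_above pq(2) _ m(2)] F by (auto simp: m_def)
  obtain c' where c': "c' \<in> c" "level c' = m"
    using point_at_level[OF convex bdd_above rs(2) _ m(3)] F rs by (auto simp: m_def)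
  have "fst a' < fst b'"
    using blocks_consistent[OF convex[OF F(1)] convex[OF F(2)] disjoint[OF F(1,2) \<open>a \<noteq> b\<close>] pq a'(1) b'(1)] a' b' by simp
  also have "fst b' < fst c'"
    using blocks_consistent[OF convex[OF F(2)] convex[OF F(3)] disjoint[OF F(2,3) \<open>b \<noteq> c\<close>] rs b'(1) c'(1)] b' c' by simp
  finally show ?thesis using \<open>a \<noteq> c\<close> a' c' by (auto simp: blocks_def)
qed

text \<open>Remove the set \<open>b\<close> whose levels end first and take an unblocked
  \<open>m\<close> among the rest. If \<open>b\<close> does not block \<open>m\<close>, then
  \<open>m\<close> is unblocked in \<open>A\<close>. Otherwise \<open>b\<close> is: anything
  blocking \<open>b\<close> would by \<open>blocks_trans\<close>, applicable thanks to the choice of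
  \<open>b\<close>, also block \<open>m\<close>.\<close>

lemma ex_unblocked:
  assumes "A \<subseteq> F" "A \<noteq> {}"
  shows "\<exists>m\<in>A. \<forall>a\<in>A. \<not> blocks a m"
proof -
  have "finite A" using finite assms(1) finite_subset by blast
  then show ?thesis using assms
  proof (induction A rule: finite_psubset_induct)
    case (psubset A)
    have "Min ((\<lambda>a. Sup (level ` a)) ` A) \<in> (\<lambda>a. Sup (level ` a)) ` A"
      using psubset by (intro Min_in) auto
    then obtain b where b: "b \<in> A" "Sup (level ` b) = Min ((\<lambda>a. Sup (level ` a)) ` A)" by auto
    then have least: "Sup (level ` b) \<le> Sup (level ` a)" if "a \<in> A" for a
      using psubset.hyps that by simp
    show ?case
    proof (cases "A = {b}")
      case True
      then show ?thesis by (auto simp: blocks_def)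
    next
      case False
      then have "A - {b} \<subset> A" "A - {b} \<subseteq> F" "A - {b} \<noteq> {}" using b psubset.prems by auto
      from psubset.IH[OF this] obtain m where m: "m \<in> A - {b}" "\<forall>a\<in>A - {b}. \<not> blocks a m" ..
      show ?thesis
      proof (cases "blocks b m")
        case True
        have "\<not> blocks a b" if a: "a \<in> A" for a
        proof
          assume ab: "blocks a b"
          then have "blocks a m"
            using blocks_trans[OF _ _ _ ab True] a b m least psubset.prems by blast
          moreover have "a \<noteq> b" using ab by (simp add: blocks_def)
          ultimately show False using m a by blast
        qed
        then show ?thesis using b by blast
      qed (use m in blast)
    qed
  qed
qed

lemma wf_blocks: "wf {(a, b). a \<in> F \<and> b \<in> F \<and> blocks a b}"
proof (rule wfI_min)
  fix x :: "(real \<times> real) set" and Q assume x: "x \<in> Q"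
  show "\<exists>z\<in>Q. \<forall>y. (y, z) \<in> {(a, b). a \<in> F \<and> b \<in> F \<and> blocks a b} \<longrightarrow> y \<notin> Q"
  proof (cases "Q \<inter> F = {}")
    case False
    then show ?thesis using ex_unblocked[of "Q \<inter> F"] by blast
  qed (use x in blast)
qed

end

lemma closed_segment_horizontal: "a \<le> b \<Longrightarrow> closed_segment (a, y) (b, y) = {a..b} \<times> {y :: real}"
  for a b :: real
proof -
  assume "a \<le> b"
  have "closed_segment (a, y) (b, y) = (\<lambda>x. (x, y)) ` closed_segment a b"
    by (auto simp: in_segment algebra_simps image_iff)
  then show ?thesis using \<open>a \<le> b\<close> by (auto simp: closed_segment_eq_real_ivl)
qed

lemma closed_segment_vertical: "c \<le> d \<Longrightarrow> closed_segment (x, c) (x, d) = {x :: real} \<times> {c..d}"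
  for c d :: real
proof -
  assume "c \<le> d"
  have "closed_segment (x, c) (x, d) = (\<lambda>y. (x, y)) ` closed_segment c d"
    by (auto simp: in_segment algebra_simps image_iff)
  then show ?thesis using \<open>c \<le> d\<close> by (auto simp: closed_segment_eq_real_ivl)
qed

subsection \<open>Segments\<close>

context generic_rectangulation
begin

lemma edge_eq:
  assumes "r \<in> R"
  shows "bottom_edge r = {xmin r..xmax r} \<times> {ymin r}" "top_edge r = {xmin r..xmax r} \<times> {ymax r}"
    "left_edge r = {xmin r} \<times> {ymin r..ymax r}" "right_edge r = {xmax r} \<times> {ymin r..ymax r}"
  using proper[OF assms]
  by (simp_all add: bottom_edge_def top_edge_def left_edge_def right_edge_def corner_defs
      closed_segment_horizontal closed_segment_vertical)

lemma composed_edge: "r \<in> R \<Longrightarrow> e \<in> edges r \<Longrightarrow> composed_of_edges R e"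
  unfolding composed_of_edges_def edges_def bottom_edge_def top_edge_def left_edge_def right_edge_def
  by (intro conjI, blast, intro exI[of _ "{e}"], auto)

lemma composed_Un:
  assumes "composed_of_edges R L" "composed_of_edges R M" "L \<union> M = closed_segment p q"
  shows "composed_of_edges R (L \<union> M)"
proof -
  obtain E E' where "E \<subseteq> (\<Union>r\<in>R. edges r)" "L = \<Union>E" "E' \<subseteq> (\<Union>r\<in>R. edges r)" "M = \<Union>E'"
    using assms by (auto simp: composed_of_edges_def)
  then have "E \<union> E' \<subseteq> (\<Union>r\<in>R. edges r) \<and> L \<union> M = \<Union>(E \<union> E')" by auto
  then show ?thesis using assms(3) unfolding composed_of_edges_def by blast
qed

lemma composed_horizontal_Un:
  assumes "composed_of_edges R ({a..b} \<times> {y})" "composed_of_edges R ({c..d} \<times> {y})"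
    "a \<le> b" "c \<le> d" "a \<le> d" "c \<le> b"
  shows "composed_of_edges R ({min a c..max b d} \<times> {y})"
proof -
  have "{a..b} \<times> {y} \<union> {c..d} \<times> {y} = {min a c..max b d} \<times> {y}" using assms by auto
  moreover have "{min a c..max b d} \<times> {y} = closed_segment (min a c, y) (max b d, y)"
    using assms(3-) by (intro closed_segment_horizontal[symmetric]) auto
  ultimately show ?thesis using composed_Un[OF assms(1,2)] by metis
qed

lemma composed_vertical_Un:
  assumes "composed_of_edges R ({x} \<times> {a..b})" "composed_of_edges R ({x} \<times> {c..d})"
    "a \<le> b" "c \<le> d" "a \<le> d" "c \<le> b"
  shows "composed_of_edges R ({x} \<times> {min a c..max b d})"
proof -
  have "{x} \<times> {a..b} \<union> {x} \<times> {c..d} = {x} \<times> {min a c..max b d}" using assms by auto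
  moreover have "{x} \<times> {min a c..max b d} = closed_segment (x, min a c) (x, max b d)"
    using assms(3-) by (intro closed_segment_vertical[symmetric]) auto
  ultimately show ?thesis using composed_Un[OF assms(1,2)] by metis
qed

lemma finite_edges: "finite (\<Union>r\<in>R. edges r)"
  using finite_R by (auto simp: edges_def)

lemma finite_composed: "finite {L. composed_of_edges R L}"
proof -
  have "{L. composed_of_edges R L} \<subseteq> \<Union> ` Pow (\<Union>r\<in>R. edges r)"
    by (auto simp: composed_of_edges_def)
  then show ?thesis using finite_edges by (meson finite_Pow_iff finite_imageI finite_subset)
qed

lemma composed_extends:
  assumes "composed_of_edges R L"
  obtains M where "composed_of_edges R M" "L \<subseteq> M"
    "\<And>L'. composed_of_edges R L' \<Longrightarrow> M \<subseteq> L' \<Longrightarrow> L' = M"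
proof -
  obtain M where "M \<in> {L. composed_of_edges R L}" "L \<subseteq> M"
    "\<forall>L'\<in>{L. composed_of_edges R L}. M \<subseteq> L' \<longrightarrow> M = L'"
    using finite_has_maximal2[OF finite_composed] assms by blast
  then show ?thesis using that[of M] by blast
qed

lemma edge_subset_box: "r \<in> R \<Longrightarrow> e \<in> edges r \<Longrightarrow> e \<subseteq> region r"
  using proper[of r] by (auto simp: edges_def edge_eq region_eq)

lemma box_edge_cases:
  assumes "L \<in> edges (bounding_box R)"
  shows "L = {X0} \<times> {Y0..Y1} \<or> L = {X1} \<times> {Y0..Y1} \<or> L = {X0..X1} \<times> {Y0} \<or> L = {X0..X1} \<times> {Y1}"
  using assms box_proper
  by (auto simp: edges_def bottom_edge_def top_edge_def left_edge_def right_edge_def corner_defs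
      closed_segment_horizontal closed_segment_vertical)

text \<open>It suffices to find any composed segment containing both edges: it extends to a maximal
  one, which cannot be a side of the square, because it contains a vertical edge with rectangles on
  both sides. \<open>aboveI\<close> is the same for horizontal edges.\<close>

lemma left_ofI:
  assumes rs: "r \<in> R" "s \<in> R" and L: "composed_of_edges R L" "right_edge r \<subseteq> L" "left_edge s \<subseteq> L"
    and x: "xmax r = xmin s"
  shows "left_of R r s"
proof -
  obtain M where M: "composed_of_edges R M" "L \<subseteq> M"
    "\<And>L'. composed_of_edges R L' \<Longrightarrow> M \<subseteq> L' \<Longrightarrow> L' = M"
    using composed_extends[OF L(1)] by blast
  note pb = proper[OF rs(1)] proper[OF rs(2)] bounds[OF rs(1)] bounds[OF rs(2)]
  have in_M: "(xmax r, ymin r) \<in> M" "(xmax r, ymax r) \<in> M"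
    by (rule subsetD[OF subset_trans[OF L(2) M(2)]]; use pb(1,2) in \<open>simp add: edge_eq rs\<close>)+
  have "M \<notin> edges (bounding_box R)"
  proof
    assume "M \<in> edges (bounding_box R)"
    then consider "M = {X0} \<times> {Y0..Y1}" | "M = {X1} \<times> {Y0..Y1}" | "M = {X0..X1} \<times> {Y0}" | "M = {X0..X1} \<times> {Y1}"
      using box_edge_cases by blast
    then show False using in_M pb x by cases auto
  qed
  then have "M \<in> segments R" using M by (auto simp: segments_def)
  then show ?thesis unfolding left_of_def using rs L M(2) by (intro tranclp.r_into_trancl) blast
qed

lemma aboveI:
  assumes rs: "r \<in> R" "s \<in> R" and L: "composed_of_edges R L" "bottom_edge r \<subseteq> L" "top_edge s \<subseteq> L"
    and y: "ymin r = ymax s"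
  shows "above R r s"
proof -
  obtain M where M: "composed_of_edges R M" "L \<subseteq> M"
    "\<And>L'. composed_of_edges R L' \<Longrightarrow> M \<subseteq> L' \<Longrightarrow> L' = M"
    using composed_extends[OF L(1)] by blast
  note pb = proper[OF rs(1)] proper[OF rs(2)] bounds[OF rs(1)] bounds[OF rs(2)]
  have in_M: "(xmin r, ymin r) \<in> M" "(xmax r, ymin r) \<in> M"
    by (rule subsetD[OF subset_trans[OF L(2) M(2)]]; use pb(1,2) in \<open>simp add: edge_eq rs\<close>)+
  have "M \<notin> edges (bounding_box R)"
  proof
    assume "M \<in> edges (bounding_box R)"
    then consider "M = {X0} \<times> {Y0..Y1}" | "M = {X1} \<times> {Y0..Y1}" | "M = {X0..X1} \<times> {Y0}" | "M = {X0..X1} \<times> {Y1}"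
      using box_edge_cases by blast
    then show False using in_M pb y by cases auto
  qed
  then have "M \<in> segments R" using M by (auto simp: segments_def)
  then show ?thesis unfolding above_def using rs L M(2) by (intro tranclp.r_into_trancl) blast
qed

lemma composed_subset: "composed_of_edges R L \<Longrightarrow> p \<in> L \<Longrightarrow> \<exists>r\<in>R. \<exists>e\<in>edges r. p \<in> e"
  by (fastforce simp: composed_of_edges_def)

text \<open>A composed segment contains a whole edge of some rectangle, and two distinct points of
  that edge already fix its direction.\<close>

lemma segment_cases:
  assumes "composed_of_edges R L"
  obtains a b y where "a < b" "L = {a..b} \<times> {y}" | x c d where "c < d" "L = {x} \<times> {c..d}"
proof -
  obtain p q where L: "L = closed_segment p q" using assms by (auto simp: composed_of_edges_def)
  obtain E where E: "E \<subseteq> (\<Union>r\<in>R. edges r)" "L = \<Union>E" using assms by (auto simp: composed_of_edges_def)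
  have "p \<in> L" using L by simp
  then obtain e r where e: "e \<in> E" "r \<in> R" "e \<in> edges r" using E by blast
  then have "e \<subseteq> L" using E by blast
  obtain u v where uv: "u \<in> L" "v \<in> L" "u \<noteq> v" "fst u = fst v \<or> snd u = snd v"
  proof -
    have "\<exists>u v. u \<in> e \<and> v \<in> e \<and> u \<noteq> v \<and> (fst u = fst v \<or> snd u = snd v)"
    proof -
      have "e = {xmin r..xmax r} \<times> {ymin r} \<or> e = {xmin r..xmax r} \<times> {ymax r} \<or>
        e = {xmin r} \<times> {ymin r..ymax r} \<or> e = {xmax r} \<times> {ymin r..ymax r}"
        using e by (auto simp: edges_def edge_eq)
      then have "(xmin r, ymin r) \<in> e \<and> (xmax r, ymin r) \<in> e \<or> (xmin r, ymax r) \<in> e \<and> (xmax r, ymax r) \<in> e \<or>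
        (xmin r, ymin r) \<in> e \<and> (xmin r, ymax r) \<in> e \<or> (xmax r, ymin r) \<in> e \<and> (xmax r, ymax r) \<in> e"
        using proper[OF e(2)] by auto
      moreover have ex: ?thesis if "u \<in> e" "v \<in> e" "u \<noteq> v" "fst u = fst v \<or> snd u = snd v" for u v
        using that by blast
      ultimately show ?thesis
        using proper[OF e(2)] ex[of "(xmin r, ymin r)" "(xmax r, ymin r)"] ex[of "(xmin r, ymax r)" "(xmax r, ymax r)"]
          ex[of "(xmin r, ymin r)" "(xmin r, ymax r)"] ex[of "(xmax r, ymin r)" "(xmax r, ymax r)"] by auto
    qed
    then show ?thesis using \<open>e \<subseteq> L\<close> that by blast
  qed
  obtain s where s: "u = (1 - s) *\<^sub>R p + s *\<^sub>R q" using uv(1) L by (auto simp: in_segment)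
  obtain t where t: "v = (1 - t) *\<^sub>R p + t *\<^sub>R q" using uv(2) L by (auto simp: in_segment)
  have diff: "v - u = (t - s) *\<^sub>R (q - p)" by (simp add: s t algebra_simps)
  have "t \<noteq> s" using uv(3) s t by auto
  have "p \<noteq> q"
  proof
    assume "p = q"
    then have "v - u = 0" using diff by simp
    then show False using uv(3) by simp
  qed
  have "fst v - fst u = (t - s) * (fst q - fst p)" "snd v - snd u = (t - s) * (snd q - snd p)"
    using arg_cong[OF diff, of fst] arg_cong[OF diff, of snd] by simp_all
  then have par: "fst p = fst q \<or> snd p = snd q" using uv(4) \<open>t \<noteq> s\<close> by auto
  obtain p1 p2 q1 q2 where pq: "p = (p1, p2)" "q = (q1, q2)" by (cases p; cases q) auto
  from par show ?thesis
  proof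
    assume "fst p = fst q"
    then have "p1 = q1" "p2 \<noteq> q2" using pq \<open>p \<noteq> q\<close> by auto
    then show ?thesis
      using that(2)[of p2 q2 p1] that(2)[of q2 p2 p1] L pq closed_segment_vertical[of p2 q2 p1]
        closed_segment_vertical[of q2 p2 p1] closed_segment_commute[of p q] by (cases p2 q2 rule: linorder_cases) auto
  next
    assume "snd p = snd q"
    then have "p2 = q2" "p1 \<noteq> q1" using pq \<open>p \<noteq> q\<close> by auto
    then show ?thesis
      using that(1)[of p1 q1 p2] that(1)[of q1 p1 p2] L pq closed_segment_horizontal[of p1 q1 p2]
        closed_segment_horizontal[of q1 p1 p2] closed_segment_commute[of p q] by (cases p1 q1 rule: linorder_cases) auto
  qed
qed

lemma composed_not_interior:
  assumes L: "composed_of_edges R L" "p \<in> L" and r: "r \<in> R"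
  shows "p \<notin> interior (region r)"
proof
  assume p: "p \<in> interior (region r)"
  obtain s e where s: "s \<in> R" "e \<in> edges s" "p \<in> e" using composed_subset[OF L] by blast
  note pr = proper[OF s(1)] proper[OF r]
  obtain x y where xy: "p = (x, y)" by (cases p)
  have in_r: "xmin r < x" "x < xmax r" "ymin r < y" "y < ymax r"
    using p xy by (auto simp: interior_region)
  have "xmin s \<le> x" "x \<le> xmax s" "ymin s \<le> y" "y \<le> ymax s"
    using edge_subset_box[OF s(1,2)] s(3) xy by (auto simp: region_eq)
  then have "s = r" using overlap_eq[OF s(1) r] in_r by linarith
  then show False using s(2,3) xy in_r r by (auto simp: edges_def edge_eq)
qed

lemma composed_in_box:
  assumes L: "composed_of_edges R L" "(x, y) \<in> L"
  shows "X0 \<le> x" "x \<le> X1" "Y0 \<le> y" "y \<le> Y1"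
proof -
  obtain s e where s: "s \<in> R" "e \<in> edges s" "(x, y) \<in> e" using composed_subset[OF L] by blast
  have "xmin s \<le> x" "x \<le> xmax s" "ymin s \<le> y" "y \<le> ymax s"
    using edge_subset_box[OF s(1,2)] s(3) by (auto simp: region_eq)
  then show "X0 \<le> x" "x \<le> X1" "Y0 \<le> y" "y \<le> Y1" using bounds[OF s(1)] by linarith+
qed

text \<open>Neither segment enters the interior of a rectangle, so the rectangle filling each of the
  four quadrants at the crossing is stopped by both lines and has a corner there. This contradicts
  genericity.\<close>

lemma segments_do_not_cross:
  assumes H: "composed_of_edges R ({a..b} \<times> {y})" and V: "composed_of_edges R ({x} \<times> {c..d})"
    and x: "a < x" "x < b" and y: "c < y" "y < d"
  shows False
proof -
  have box: "X0 < x" "x < X1" "Y0 < y" "y < Y1"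
    using composed_in_box[OF H, of a y] composed_in_box[OF H, of b y]
      composed_in_box[OF V, of x c] composed_in_box[OF V, of x d] x y by auto
  have h: "\<not> (xmin r < u \<and> u < xmax r \<and> ymin r < y \<and> y < ymax r)" if "r \<in> R" "a \<le> u" "u \<le> b" for r u
    using composed_not_interior[OF H, of "(u, y)" r] that by (auto simp: interior_region)
  have v: "\<not> (xmin r < x \<and> x < xmax r \<and> ymin r < u \<and> u < ymax r)" if "r \<in> R" "c \<le> u" "u \<le> d" for r u
    using composed_not_interior[OF V, of "(x, u)" r] that by (auto simp: interior_region)
  \<comment> \<open>The crossing point may lie on the side of a quadrant rectangle, so the
    contradiction is found at a nearby point of the segment, strictly within the width or height of
    the rectangle. There is one such choice for each of the four arms.\<close>
  have east: "\<exists>u. x < u \<and> u < e' \<and> u \<le> b" if "x < e'" for e'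
    using dense[of x "min e' b"] that x by auto
  have west: "\<exists>u. w' < u \<and> u < x \<and> a \<le> u" if "w' < x" for w'
    using dense[of "max w' a" x] that x by auto
  have north: "\<exists>u. y < u \<and> u < n' \<and> u \<le> d" if "y < n'" for n'
    using dense[of y "min n' d"] that y by auto
  have south: "\<exists>u. s' < u \<and> u < y \<and> c \<le> u" if "s' < y" for s'
    using dense[of "max s' c" y] that y by auto
  obtain A where A: "A \<in> R" "xmin A \<le> x" "x < xmax A" "ymin A \<le> y" "y < ymax A"
    using north_east[of x y] box by auto
  have "ymin A = y"
  proof (rule ccontr)
    assume "ymin A \<noteq> y"
    obtain u where "x < u" "u < xmax A" "u \<le> b" using east[OF A(3)] by blast
    then show False using h[OF A(1), of u] A x \<open>ymin A \<noteq> y\<close> by linarith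
  qed
  moreover have "xmin A = x"
  proof (rule ccontr)
    assume "xmin A \<noteq> x"
    obtain u where "y < u" "u < ymax A" "u \<le> d" using north[OF A(5)] by blast
    then show False using v[OF A(1), of u] A y \<open>xmin A \<noteq> x\<close> by linarith
  qed
  ultimately have bl: "bottom_left A = (x, y)" by (simp add: corner_defs)
  obtain B where B: "B \<in> R" "xmin B < x" "x \<le> xmax B" "ymin B \<le> y" "y < ymax B"
    using north_west[of x y] box by auto
  have "ymin B = y"
  proof (rule ccontr)
    assume "ymin B \<noteq> y"
    obtain u where "xmin B < u" "u < x" "a \<le> u" using west[OF B(2)] by blast
    then show False using h[OF B(1), of u] B x \<open>ymin B \<noteq> y\<close> by linarith
  qed
  moreover have "xmax B = x"
  proof (rule ccontr)
    assume "xmax B \<noteq> x"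
    obtain u where "y < u" "u < ymax B" "u \<le> d" using north[OF B(5)] by blast
    then show False using v[OF B(1), of u] B y \<open>xmax B \<noteq> x\<close> by linarith
  qed
  ultimately have br: "bottom_right B = (x, y)" by (simp add: corner_defs)
  obtain C where C: "C \<in> R" "xmin C \<le> x" "x < xmax C" "ymin C < y" "y \<le> ymax C"
    using south_east[of x y] box by auto
  have "ymax C = y"
  proof (rule ccontr)
    assume "ymax C \<noteq> y"
    obtain u where "x < u" "u < xmax C" "u \<le> b" using east[OF C(3)] by blast
    then show False using h[OF C(1), of u] C x \<open>ymax C \<noteq> y\<close> by linarith
  qed
  moreover have "xmin C = x"
  proof (rule ccontr)
    assume "xmin C \<noteq> x"
    obtain u where "ymin C < u" "u < y" "c \<le> u" using south[OF C(4)] by blast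
    then show False using v[OF C(1), of u] C y \<open>xmin C \<noteq> x\<close> by linarith
  qed
  ultimately have tl: "top_left C = (x, y)" by (simp add: corner_defs)
  obtain D where D: "D \<in> R" "xmin D < x" "x \<le> xmax D" "ymin D < y" "y \<le> ymax D"
    using south_west[of x y] box by auto
  have "ymax D = y"
  proof (rule ccontr)
    assume "ymax D \<noteq> y"
    obtain u where "xmin D < u" "u < x" "a \<le> u" using west[OF D(2)] by blast
    then show False using h[OF D(1), of u] D x \<open>ymax D \<noteq> y\<close> by linarith
  qed
  moreover have "xmax D = x"
  proof (rule ccontr)
    assume "xmax D \<noteq> x"
    obtain u where "ymin D < u" "u < y" "c \<le> u" using south[OF D(4)] by blast
    then show False using v[OF D(1), of u] D y \<open>xmax D \<noteq> x\<close> by linarith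
  qed
  ultimately have tr: "top_right D = (x, y)" by (simp add: corner_defs)
  show False using no_crossing[OF A(1) B(1) C(1) D(1) bl br tl tr] .
qed

end

subsection \<open>Acyclicity of the inorder\<close>

text \<open>Parents have strictly smaller \<open>f\<close>. Values of \<open>f\<close> are real, so
  the induction uses instead the number of elements with a smaller value, which is finite.\<close>

lemma reaches_all:
  fixes f :: "'a::finite \<Rightarrow> real"
  assumes "\<And>j. j \<noteq> r \<Longrightarrow> \<exists>i. E i j \<and> f i < f j"
  shows "E\<^sup>*\<^sup>* r j"
proof (induction "card {k. f k < f j}" arbitrary: j rule: less_induct)
  case less
  show ?case
  proof (cases "j = r")
    case False
    then obtain i where i: "E i j" "f i < f j" using assms by blast
    then have "{k. f k < f i} \<subset> {k. f k < f j}" by auto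
    then have "card {k. f k < f i} < card {k. f k < f j}" by (simp add: psubset_card_mono)
    then show ?thesis using less i(1) by (meson rtranclp.rtrancl_into_rtrancl)
  qed simp
qed

section \<open>Open rectangles and open segments as disjoint convex sets\<close>

context generic_rectangulation
begin

text \<open>Rectangles on opposite sides of a segment need not face each other, so neither has to
  block the other directly; the segment has to be an intermediate obstacle. End points are removed
  because a segment may end in the interior of another.\<close>

definition pieces :: "(real \<times> real) set set" where
  "pieces = (\<lambda>r. interior (region r)) ` R
     \<union> (\<lambda>(a, b, y). {a<..<b} \<times> {y}) ` {(a, b, y). a < b \<and> {a..b} \<times> {y} \<in> segments R}
     \<union> (\<lambda>(x, c, d). {x} \<times> {c<..<d}) ` {(x, c, d). c < d \<and> {x} \<times> {c..d} \<in> segments R}"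

lemma segments_composed: "L \<in> segments R \<Longrightarrow> composed_of_edges R L"
  by (simp add: segments_def)

lemma segments_maximal: "L \<in> segments R \<Longrightarrow> composed_of_edges R L' \<Longrightarrow> L \<subseteq> L' \<Longrightarrow> L' = L"
  by (simp add: segments_def)

lemma pieces_cases:
  assumes "P \<in> pieces"
  obtains r where "r \<in> R" "P = {xmin r<..<xmax r} \<times> {ymin r<..<ymax r}" "P = interior (region r)"
  | a b y where "a < b" "{a..b} \<times> {y} \<in> segments R" "P = {a<..<b} \<times> {y}"
  | x c d where "c < d" "{x} \<times> {c..d} \<in> segments R" "P = {x} \<times> {c<..<d}"
  using assms unfolding pieces_def by (auto simp: interior_region)

lemma finite_pieces: "finite pieces"
proof -
  have "finite (segments R)"
    using finite_composed by (rule finite_subset[rotated]) (auto simp: segments_def)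
  then have "finite ((\<lambda>(a, b, y). {a..b} \<times> {y}) -` segments R \<inter> {(a, b, y). a < b})"
    "finite ((\<lambda>(x, c, d). {x} \<times> {c..d}) -` segments R \<inter> {(x, c, d). c < d})"
    by (intro finite_vimage_IntI inj_onI; auto simp: times_eq_iff Icc_eq_Icc)+
  moreover have "{(a, b, y). a < b \<and> {a..b} \<times> {y} \<in> segments R}
      = (\<lambda>(a, b, y). {a..b} \<times> {y}) -` segments R \<inter> {(a, b, y). a < b}"
    "{(x, c, d). c < d \<and> {x} \<times> {c..d} \<in> segments R}
      = (\<lambda>(x, c, d). {x} \<times> {c..d}) -` segments R \<inter> {(x, c, d). c < d}" by auto
  ultimately show ?thesis unfolding pieces_def using finite_R by simp
qed

text \<open>The union of two overlapping collinear segments is again composed of edges, so by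
  maximality both are equal to it.\<close>

lemma horizontal_segments_disjoint:
  assumes H: "{a..b} \<times> {y} \<in> segments R" "{a'..b'} \<times> {y} \<in> segments R"
    and lt: "a < x" "x < b" "a' < x" "x < b'"
  shows "a = a' \<and> b = b'"
proof -
  have comp: "composed_of_edges R ({min a a'..max b b'} \<times> {y})"
    using composed_horizontal_Un[OF segments_composed[OF H(1)] segments_composed[OF H(2)]] lt by auto
  have "{min a a'..max b b'} \<times> {y} = {a..b} \<times> {y}" by (rule segments_maximal[OF H(1) comp]) auto
  moreover have "{min a a'..max b b'} \<times> {y} = {a'..b'} \<times> {y}" by (rule segments_maximal[OF H(2) comp]) auto
  ultimately have "{a..b} \<times> {y} = {a'..b'} \<times> {y}" by simp
  then show ?thesis using lt by (auto simp: times_eq_iff Icc_eq_Icc)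
qed

lemma vertical_segments_disjoint:
  assumes V: "{x} \<times> {c..d} \<in> segments R" "{x} \<times> {c'..d'} \<in> segments R"
    and lt: "c < y" "y < d" "c' < y" "y < d'"
  shows "c = c' \<and> d = d'"
proof -
  have comp: "composed_of_edges R ({x} \<times> {min c c'..max d d'})"
    using composed_vertical_Un[OF segments_composed[OF V(1)] segments_composed[OF V(2)]] lt by auto
  have "{x} \<times> {min c c'..max d d'} = {x} \<times> {c..d}" by (rule segments_maximal[OF V(1) comp]) auto
  moreover have "{x} \<times> {min c c'..max d d'} = {x} \<times> {c'..d'}" by (rule segments_maximal[OF V(2) comp]) auto
  ultimately have "{x} \<times> {c..d} = {x} \<times> {c'..d'}" by simp
  then show ?thesis using lt by (auto simp: times_eq_iff Icc_eq_Icc)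
qed

lemma rect_segment_disjoint:
  assumes "r \<in> R" "L \<in> segments R" shows "interior (region r) \<inter> L = {}"
  using composed_not_interior[OF segments_composed] assms by blast

lemma pieces_disjoint:
  assumes P: "P \<in> pieces" "Q \<in> pieces" and z: "z \<in> P" "z \<in> Q"
  shows "P = Q"
proof -
  obtain u v where uv: "z = (u, v)" by (cases z)
  from P(1) show ?thesis
  proof (cases rule: pieces_cases)
    case r: (1 r)
    from P(2) show ?thesis
    proof (cases rule: pieces_cases)
      case s: (1 s)
      have "r = s" using overlap_eq[OF r(1) s(1)] z uv r(2) s(2) by auto
      then show ?thesis using r s by simp
    next
      case (2 a b y)
      then have "z \<in> {a..b} \<times> {y}" using z by auto
      then show ?thesis using rect_segment_disjoint[OF r(1) 2(2)] r(3) z by blast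
    next
      case (3 x c d)
      then have "z \<in> {x} \<times> {c..d}" using z by auto
      then show ?thesis using rect_segment_disjoint[OF r(1) 3(2)] r(3) z by blast
    qed
  next
    case h: (2 a b y)
    from P(2) show ?thesis
    proof (cases rule: pieces_cases)
      case r: (1 r)
      have "z \<in> {a..b} \<times> {y}" using z h by auto
      then show ?thesis using rect_segment_disjoint[OF r(1) h(2)] r(3) z by blast
    next
      case h': (2 a' b' y')
      then have "y' = y" "a < u" "u < b" "a' < u" "u < b'" using z uv h by auto
      then show ?thesis using horizontal_segments_disjoint h h' by blast
    next
      case v: (3 x c d)
      then have "u = x" "v = y" "a < x" "x < b" "c < y" "y < d" using z uv h by auto
      then show ?thesis using segments_do_not_cross segments_composed h(2) v(2) by blast
    qed
  next
    case v: (3 x c d)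
    from P(2) show ?thesis
    proof (cases rule: pieces_cases)
      case r: (1 r)
      have "z \<in> {x} \<times> {c..d}" using z v by auto
      then show ?thesis using rect_segment_disjoint[OF r(1) v(2)] r(3) z by blast
    next
      case h: (2 a b y)
      then have "u = x" "v = y" "a < x" "x < b" "c < y" "y < d" using z uv v by auto
      then show ?thesis using segments_do_not_cross segments_composed h(2) v(2) by blast
    next
      case v': (3 x' c' d')
      then have "x' = x" "c < v" "v < d" "c' < v" "v < d'" using z uv v by auto
      then show ?thesis using vertical_segments_disjoint v v' by blast
    qed
  qed
qed

lemma level_gt:
  assumes P: "P \<in> pieces" "p \<in> P" shows "\<exists>q\<in>P. level p < level q"
proof -
  obtain u v where uv: "p = (u, v)" by (cases p)
  from P(1) show ?thesis
  proof (cases rule: pieces_cases)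
    case (1 r)
    obtain w where "u < w" "w < xmax r" using dense[of u "xmax r"] 1 P uv by auto
    then show ?thesis using 1 P uv by (intro bexI[of _ "(w, v)"]) (auto simp: level_def)
  next
    case (2 a b y)
    obtain w where "u < w" "w < b" using dense[of u b] 2 P uv by auto
    then show ?thesis using 2 P uv by (intro bexI[of _ "(w, v)"]) (auto simp: level_def)
  next
    case (3 x c d)
    obtain w where "v < w" "w < d" using dense[of v d] 3 P uv by auto
    then show ?thesis using 3 P uv by (intro bexI[of _ "(u, w)"]) (auto simp: level_def)
  qed
qed

sublocale pieces: disjoint_convex_sets pieces
proof
  show "finite pieces" by (rule finite_pieces)
  fix P assume P: "P \<in> pieces"
  show "convex P"
    using P by (cases rule: pieces_cases) (auto intro!: convex_Times)
  show "bdd_above (level ` P)"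
    using P
  proof (cases rule: pieces_cases)
    case (1 r) then show ?thesis by (intro bdd_aboveI[of _ "xmax r + ymax r"]) (auto simp: level_def)
  next
    case (2 a b y) then show ?thesis by (intro bdd_aboveI[of _ "b + y"]) (auto simp: level_def)
  next
    case (3 x c d) then show ?thesis by (intro bdd_aboveI[of _ "x + d"]) (auto simp: level_def)
  qed
  show "\<exists>q\<in>P. level p < level q" if "p \<in> P" for p using level_gt P that .
  show "P \<inter> Q = {}" if "Q \<in> pieces" "P \<noteq> Q" for Q
    using pieces_disjoint[OF P that(1)] that(2) by blast
qed

definition block_order :: "((real \<times> real) set \<times> (real \<times> real) set) set" where
  "block_order = {(a, b). a \<in> pieces \<and> b \<in> pieces \<and> blocks a b}"

lemma vertical_segment:
  assumes "composed_of_edges R L" "(x, c) \<in> L" "(x, d) \<in> L" "c < d"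
  obtains c' d' where "L = {x} \<times> {c'..d'}" "c' < d'"
  by (rule segment_cases[OF assms(1)]) (use assms that in auto)

lemma horizontal_segment:
  assumes "composed_of_edges R L" "(a, y) \<in> L" "(b, y) \<in> L" "a < b"
  obtains a' b' where "L = {a'..b'} \<times> {y}" "a' < b'"
  by (rule segment_cases[OF assms(1)]) (use assms that in auto)

lemma blocksI: "a \<noteq> b \<Longrightarrow> p \<in> a \<Longrightarrow> q \<in> b \<Longrightarrow> level p = level q \<Longrightarrow> fst p < fst q \<Longrightarrow> blocks a b"
  unfolding blocks_def by blast

text \<open>From a segment, north-west leads into rectangles on its left or above it, south-east
  into those on its right or below. Thus one blocking direction serves for both
  \<open>left_of\<close> and \<open>above\<close>.\<close>

lemma left_step_blocks:
  assumes rs: "r \<in> R" "s \<in> R" and L: "L \<in> segments R" "right_edge r \<subseteq> L" "left_edge s \<subseteq> L"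
  shows "(interior (region r), interior (region s)) \<in> block_order\<^sup>+"
proof -
  note pr = proper[OF rs(1)] proper[OF rs(2)]
  have "(xmax r, ymin r) \<in> right_edge r" "(xmax r, ymax r) \<in> right_edge r"
    "(xmin s, ymin s) \<in> left_edge s" "(xmin s, ymax s) \<in> left_edge s"
    using pr by (simp_all add: edge_eq rs)
  then have ends: "(xmax r, ymin r) \<in> L" "(xmax r, ymax r) \<in> L" "(xmin s, ymin s) \<in> L" "(xmin s, ymax s) \<in> L"
    using L by blast+
  define x where "x = xmax r"
  obtain c d where L': "L = {x} \<times> {c..d}" and "c < d"
    using vertical_segment[OF segments_composed[OF L(1)] ends(1,2)] pr(2) unfolding x_def by blast
  let ?M = "{x} \<times> {c<..<d}"
  have e: "xmax r = x" "xmin s = x" "c \<le> ymin r" "ymax r \<le> d" "c \<le> ymin s" "ymax s \<le> d"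
    using ends L' by (simp_all add: mem_Times_iff)
  have M: "?M \<in> pieces" using L' L(1) \<open>c < d\<close> unfolding pieces_def by fast
  have I: "interior (region r) \<in> pieces" "interior (region s) \<in> pieces" using rs by (auto simp: pieces_def)
  have "blocks (interior (region r)) ?M"
  proof -
    define m where "m = (ymin r + ymax r) / 2"
    have m: "2 * m = ymin r + ymax r" by (simp add: m_def)
    \<comment> \<open>A quarter of the shorter side: the diagonal step by \<open>t\<close> from the
      midpoint of the edge stays inside the rectangle, and a diagonal step does not change
      \<open>level\<close>.\<close>
    define t where "t = min (xmax r - xmin r) (ymax r - ymin r) / 4"
    have t_le: "t > 0" "4 * t \<le> xmax r - xmin r" "4 * t \<le> ymax r - ymin r"
      using pr by (simp_all add: t_def)
    have t: "t > 0" "xmin r < x - t" "m + t < ymax r"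
      using t_le m e by linarith+
    have p: "(x - t, m + t) \<in> interior (region r)"
      using t m pr e by (auto simp: interior_region)
    have q: "(x, m) \<in> ?M" using m pr e by auto
    have "(x, m) \<notin> interior (region r)" using e by (auto simp: interior_region)
    then have "interior (region r) \<noteq> ?M" using q by metis
    then show ?thesis by (rule blocksI[OF _ p q]) (use t in \<open>simp_all add: level_def\<close>)
  qed
  moreover have "blocks ?M (interior (region s))"
  proof -
    define m where "m = (ymin s + ymax s) / 2"
    have m: "2 * m = ymin s + ymax s" by (simp add: m_def)
    define t where "t = min (xmax s - xmin s) (ymax s - ymin s) / 4"
    have t_le: "t > 0" "4 * t \<le> xmax s - xmin s" "4 * t \<le> ymax s - ymin s"
      using pr by (simp_all add: t_def)
    have t: "t > 0" "x + t < xmax s" "ymin s < m - t"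
      using t_le m e by linarith+
    have p: "(x + t, m - t) \<in> interior (region s)"
      using t m pr e by (auto simp: interior_region)
    have q: "(x, m) \<in> ?M" using m pr e by auto
    have "(x, m) \<notin> interior (region s)" using e by (auto simp: interior_region)
    then have "?M \<noteq> interior (region s)" using q by metis
    then show ?thesis by (rule blocksI[OF _ q p]) (use t in \<open>simp_all add: level_def\<close>)
  qed
  ultimately have "(interior (region r), ?M) \<in> block_order" "(?M, interior (region s)) \<in> block_order"
    using M I by (auto simp: block_order_def)
  then show ?thesis by (rule trancl_into_trancl[OF r_into_trancl])
qed

lemma above_step_blocks:
  assumes rs: "r \<in> R" "s \<in> R" and L: "L \<in> segments R" "bottom_edge r \<subseteq> L" "top_edge s \<subseteq> L"
  shows "(interior (region r), interior (region s)) \<in> block_order\<^sup>+"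
proof -
  note pr = proper[OF rs(1)] proper[OF rs(2)]
  have "(xmin r, ymin r) \<in> bottom_edge r" "(xmax r, ymin r) \<in> bottom_edge r"
    "(xmin s, ymax s) \<in> top_edge s" "(xmax s, ymax s) \<in> top_edge s"
    using pr by (simp_all add: edge_eq rs)
  then have ends: "(xmin r, ymin r) \<in> L" "(xmax r, ymin r) \<in> L" "(xmin s, ymax s) \<in> L" "(xmax s, ymax s) \<in> L"
    using L by blast+
  define y where "y = ymin r"
  obtain a b where L': "L = {a..b} \<times> {y}" and "a < b"
    using horizontal_segment[OF segments_composed[OF L(1)] ends(1,2)] pr(1) unfolding y_def by blast
  let ?M = "{a<..<b} \<times> {y}"
  have e: "ymin r = y" "ymax s = y" "a \<le> xmin r" "xmax r \<le> b" "a \<le> xmin s" "xmax s \<le> b"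
    using ends L' by (simp_all add: mem_Times_iff)
  have M: "?M \<in> pieces" using L' L(1) \<open>a < b\<close> unfolding pieces_def by fast
  have I: "interior (region r) \<in> pieces" "interior (region s) \<in> pieces" using rs by (auto simp: pieces_def)
  have "blocks (interior (region r)) ?M"
  proof -
    define m where "m = (xmin r + xmax r) / 2"
    have m: "2 * m = xmin r + xmax r" by (simp add: m_def)
    define t where "t = min (xmax r - xmin r) (ymax r - ymin r) / 4"
    have t_le: "t > 0" "4 * t \<le> xmax r - xmin r" "4 * t \<le> ymax r - ymin r"
      using pr by (simp_all add: t_def)
    have t: "t > 0" "xmin r < m - t" "y + t < ymax r"
      using t_le m e by linarith+
    have p: "(m - t, y + t) \<in> interior (region r)"
      using t m pr e by (auto simp: interior_region)
    have q: "(m, y) \<in> ?M" using m pr e by auto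
    have "(m, y) \<notin> interior (region r)" using e by (auto simp: interior_region)
    then have "interior (region r) \<noteq> ?M" using q by metis
    then show ?thesis by (rule blocksI[OF _ p q]) (use t in \<open>simp_all add: level_def\<close>)
  qed
  moreover have "blocks ?M (interior (region s))"
  proof -
    define m where "m = (xmin s + xmax s) / 2"
    have m: "2 * m = xmin s + xmax s" by (simp add: m_def)
    define t where "t = min (xmax s - xmin s) (ymax s - ymin s) / 4"
    have t_le: "t > 0" "4 * t \<le> xmax s - xmin s" "4 * t \<le> ymax s - ymin s"
      using pr by (simp_all add: t_def)
    have t: "t > 0" "m + t < xmax s" "ymin s < y - t"
      using t_le m e by linarith+
    have p: "(m + t, y - t) \<in> interior (region s)"
      using t m pr e by (auto simp: interior_region)
    have q: "(m, y) \<in> ?M" using m pr e by auto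
    have "(m, y) \<notin> interior (region s)" using e by (auto simp: interior_region)
    then have "?M \<noteq> interior (region s)" using q by metis
    then show ?thesis by (rule blocksI[OF _ q p]) (use t in \<open>simp_all add: level_def\<close>)
  qed
  ultimately have "(interior (region r), ?M) \<in> block_order" "(?M, interior (region s)) \<in> block_order"
    using M I by (auto simp: block_order_def)
  then show ?thesis by (rule trancl_into_trancl[OF r_into_trancl])
qed

definition precedes :: "rect \<Rightarrow> rect \<Rightarrow> bool" where
  "precedes = (\<lambda>r s. above R r s \<or> left_of R r s)\<^sup>+\<^sup>+"

lemma precedes_above: "above R r s \<Longrightarrow> precedes r s"
  by (simp add: precedes_def tranclp.r_into_trancl)

lemma precedes_left: "left_of R r s \<Longrightarrow> precedes r s"
  by (simp add: precedes_def tranclp.r_into_trancl)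

lemma precedes_trans: "precedes r s \<Longrightarrow> precedes s t \<Longrightarrow> precedes r t"
  unfolding precedes_def by (rule tranclp_trans)

lemma precedes_blocks:
  assumes "precedes r s" shows "(interior (region r), interior (region s)) \<in> block_order\<^sup>+"
proof -
  let ?B = "\<lambda>r s. (interior (region r), interior (region s)) \<in> block_order\<^sup>+"
  \<comment> \<open>\<open>precedes\<close> is a transitive closure built from two others; this
    lifts a one-step claim through each of the three.\<close>
  have trans: "?B r s" if step: "\<And>r s. P r s \<Longrightarrow> ?B r s" and rs: "P\<^sup>+\<^sup>+ r s" for P r s
    using rs
  proof induction
    case (base y)
    then show ?case by (rule step)
  next
    case (step y z)
    then show ?case using that(1)[of y z] by (meson trancl_trans)
  qed
  have above: "?B r s" if "above R r s" for r s
    by (rule trans[OF _ that[unfolded above_def]]) (elim conjE bexE, rule above_step_blocks)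
  have left: "?B r s" if "left_of R r s" for r s
    by (rule trans[OF _ that[unfolded left_of_def]]) (elim conjE bexE, rule left_step_blocks)
  show ?thesis
    by (rule trans[OF _ assms[unfolded precedes_def]]) (elim disjE above left)
qed

lemma precedes_irrefl: "\<not> precedes r r"
proof
  assume "precedes r r"
  then have "(interior (region r), interior (region r)) \<in> block_order\<^sup>+" by (rule precedes_blocks)
  moreover have "wf (block_order\<^sup>+)" unfolding block_order_def by (rule wf_trancl[OF pieces.wf_blocks])
  ultimately show False by (rule wf_not_refl[THEN notE, rotated])
qed

text \<open>Tree edges expressed through corners only, so that the trees can be studied before the
  labels are available.\<close>

definition source_child :: "direction \<Rightarrow> rect \<Rightarrow> rect \<Rightarrow> bool" where
  "source_child d r s \<longleftrightarrow> bottom_left s = (case d of Hor \<Rightarrow> bottom_right r | Ver \<Rightarrow> top_left r)"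

text \<open>The arguments are parent and child; the child lies to the left of its parent or below
  it, so this runs against the edges of D(R).\<close>

definition target_child :: "direction \<Rightarrow> rect \<Rightarrow> rect \<Rightarrow> bool" where
  "target_child d r s \<longleftrightarrow> top_right s = (case d of Hor \<Rightarrow> top_left r | Ver \<Rightarrow> bottom_right r)"

end

subsection \<open>Source and target trees\<close>

context generic_rectangulation
begin

text \<open>The rectangles reached from the horizontal child of \<open>i\<close> by vertical steps
  are stacked along the right side of \<open>i\<close>: their left edges and the right edge of
  \<open>i\<close> belong to one segment, so \<open>i\<close> is left of all of them. In the same
  way the horizontal chain from a vertical child sits above \<open>i\<close> along its top
  side.\<close>

lemma source_search_tree:
  fixes l :: "'n::finite \<Rightarrow> rect"
  assumes l: "bij_betw l UNIV R"
  shows "search_tree (\<lambda>d i j. source_child d (l i) (l j)) Ver Hor (\<lambda>i j. precedes (l i) (l j))"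
    (is "search_tree ?U _ _ _")
proof
  have lR: "l i \<in> R" for i using l by (auto simp: bij_betw_def)
  have l_inj: "i = j" if "l i = l j" for i j using l that by (auto simp: bij_betw_def inj_on_def)
  note inj = inj_onD[OF corner_inj(1)] inj_onD[OF corner_inj(2)] inj_onD[OF corner_inj(3)]
  show "Ver \<noteq> Hor" by simp
  have hor: "source_child Hor r s \<longleftrightarrow> bottom_right r = bottom_left s" for r s
    by (auto simp: source_child_def)
  have ver: "source_child Ver r s \<longleftrightarrow> top_left r = bottom_left s" for r s
    by (auto simp: source_child_def)
  show "j = k" if "?U d i j" "?U d i k" for d i j k
  proof -
    have "bottom_left (l j) = bottom_left (l k)" using that by (simp add: source_child_def)
    then show ?thesis by (rule l_inj[OF inj(1)[OF _ lR lR]])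
  qed
  show "i = j \<and> d = e" if "?U d i k" "?U e j k" for d e i j k
  proof -
    consider "d = e" | "d = Hor" "e = Ver" | "d = Ver" "e = Hor" by (cases d; cases e) auto
    then show ?thesis
    proof cases
      case 1
      have "l i = l j"
      proof (cases d)
        case Hor
        then have "bottom_right (l i) = bottom_right (l j)" using 1 that hor by metis
        then show ?thesis by (rule inj(2)[OF _ lR lR])
      next
        case Ver
        then have "top_left (l i) = top_left (l j)" using 1 that ver by metis
        then show ?thesis by (rule inj(3)[OF _ lR lR])
      qed
      then show ?thesis using l_inj 1 by blast
    next
      case 2
      then show ?thesis using that source_parent_unique[OF lR lR lR, of i k j] by (auto simp: hor ver)
    next
      case 3
      then show ?thesis using that source_parent_unique[OF lR lR lR, of j k i] by (auto simp: hor ver)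
    qed
  qed
  show "\<exists>r. \<forall>j. (\<lambda>i j. \<exists>d. ?U d i j)\<^sup>*\<^sup>* r j"
  proof -
    obtain r where r: "r \<in> R" "xmin r \<le> X0" "X0 < xmax r" "ymin r \<le> Y0" "Y0 < ymax r"
      by (rule north_east[OF order_refl box_proper(1) order_refl box_proper(2)])
    have "xmin r = X0" "ymin r = Y0" using bounds[OF r(1)] r by linarith+
    then have "bottom_left r = (X0, Y0)" by (simp add: corner_defs)
    moreover obtain i0 where "r = l i0" using l r(1) by (auto simp: bij_betw_def)
    ultimately have i0: "bottom_left (l i0) = (X0, Y0)" by simp
    have "(\<lambda>i j. \<exists>d. ?U d i j)\<^sup>*\<^sup>* i0 j" for j
    \<comment> \<open>The coordinate sum of the bottom left corner strictly decreases from a node to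
      its parent.\<close>
    proof (rule reaches_all[where f = "\<lambda>i. xmin (l i) + ymin (l i)"])
      fix j assume "j \<noteq> i0"
      then have "bottom_left (l j) \<noteq> bottom_left (l i0)" using l_inj inj(1)[OF _ lR lR] by blast
      then obtain s where s: "s \<in> R" "bottom_right s = bottom_left (l j) \<or> top_left s = bottom_left (l j)"
        using source_parent_exists[OF lR, of j] i0 by auto
      obtain i where i: "s = l i" using l s(1) by (auto simp: bij_betw_def)
      have "source_child Hor (l i) (l j) \<or> source_child Ver (l i) (l j)"
        using s i by (auto simp: source_child_def)
      moreover have "xmin (l i) + ymin (l i) < xmin (l j) + ymin (l j)"
        using s(2) i proper[OF lR[of i]] by (auto simp: corner_defs)
      ultimately show "\<exists>i. (\<exists>d. ?U d i j) \<and> xmin (l i) + ymin (l i) < xmin (l j) + ymin (l j)" by blast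
    qed
    then show ?thesis by blast
  qed
  show "precedes (l i) (l k)" if "precedes (l i) (l j)" "precedes (l j) (l k)" for i j k
    using that by (rule precedes_trans)
  show "\<not> precedes (l i) (l i)" for i by (rule precedes_irrefl)
  show "precedes (l i) (l w)" if c: "?U Hor i c" and w: "(?U Ver)\<^sup>*\<^sup>* c w" for i c w
  proof -
    \<comment> \<open>Invariant along the stack: the left edges from \<open>c\<close> up to
      \<open>w\<close> join without gaps into one composed segment.\<close>
    have "xmin (l w) = xmin (l c) \<and> ymin (l c) \<le> ymin (l w) \<and>
        composed_of_edges R ({xmin (l c)} \<times> {ymin (l c)..ymax (l w)})"
      using w
    proof induction
      case base
      show ?case using composed_edge[OF lR[of c], of "left_edge (l c)"] by (simp add: edges_def edge_eq lR)
    next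
      case (step v w)
      have e: "xmin (l w) = xmin (l v)" "ymin (l w) = ymax (l v)"
        using step.hyps(2) by (auto simp: source_child_def corner_defs)
      have "composed_of_edges R ({xmin (l w)} \<times> {ymin (l w)..ymax (l w)})"
        using composed_edge[OF lR[of w], of "left_edge (l w)"] by (simp add: edges_def edge_eq lR)
      then show ?case
        using composed_vertical_Un[of "xmin (l c)" "ymin (l c)" "ymax (l v)" "ymin (l w)" "ymax (l w)"]
          step.IH e proper[OF lR[of v]] proper[OF lR[of w]] by (simp add: min_def max_def)
    qed
    note w = this
    have e: "xmin (l c) = xmax (l i)" "ymin (l c) = ymin (l i)"
      using c by (auto simp: source_child_def corner_defs)
    have "composed_of_edges R ({xmax (l i)} \<times> {ymin (l i)..ymax (l i)})"
      using composed_edge[OF lR[of i], of "right_edge (l i)"] by (simp add: edges_def edge_eq lR)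
    then have "composed_of_edges R ({xmax (l i)} \<times> {min (ymin (l i)) (ymin (l i))..max (ymax (l i)) (ymax (l w))})"
      using w e proper[OF lR[of i]] proper[OF lR[of w]] by (intro composed_vertical_Un) auto
    then have "left_of R (l i) (l w)"
      by (rule left_ofI[OF lR lR]) (use w e in \<open>auto simp: edge_eq lR\<close>)
    then show ?thesis by (rule precedes_left)
  qed
  show "precedes (l w) (l i)" if c: "?U Ver i c" and w: "(?U Hor)\<^sup>*\<^sup>* c w" for i c w
  proof -
    have "ymin (l w) = ymin (l c) \<and> xmin (l c) \<le> xmin (l w) \<and>
        composed_of_edges R ({xmin (l c)..xmax (l w)} \<times> {ymin (l c)})"
      using w
    proof induction
      case base
      show ?case using composed_edge[OF lR[of c], of "bottom_edge (l c)"] by (simp add: edges_def edge_eq lR)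
    next
      case (step v w)
      have e: "ymin (l w) = ymin (l v)" "xmin (l w) = xmax (l v)"
        using step.hyps(2) by (auto simp: source_child_def corner_defs)
      have "composed_of_edges R ({xmin (l w)..xmax (l w)} \<times> {ymin (l w)})"
        using composed_edge[OF lR[of w], of "bottom_edge (l w)"] by (simp add: edges_def edge_eq lR)
      then show ?case
        using composed_horizontal_Un[of "xmin (l c)" "xmax (l v)" "ymin (l c)" "xmin (l w)" "xmax (l w)"]
          step.IH e proper[OF lR[of v]] proper[OF lR[of w]] by (simp add: min_def max_def)
    qed
    note w = this
    have e: "ymin (l c) = ymax (l i)" "xmin (l c) = xmin (l i)"
      using c by (auto simp: source_child_def corner_defs)
    have "composed_of_edges R ({xmin (l i)..xmax (l i)} \<times> {ymax (l i)})"
      using composed_edge[OF lR[of i], of "top_edge (l i)"] by (simp add: edges_def edge_eq lR)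
    then have "composed_of_edges R ({min (xmin (l i)) (xmin (l i))..max (xmax (l i)) (xmax (l w))} \<times> {ymax (l i)})"
      using w e proper[OF lR[of i]] proper[OF lR[of w]] by (intro composed_horizontal_Un) auto
    then have "above R (l w) (l i)"
      by (rule aboveI[OF lR lR]) (use w e in \<open>auto simp: edge_eq lR\<close>)
    then show ?thesis by (rule precedes_above)
  qed
qed

text \<open>The half-turn of \<open>source_search_tree\<close>. A horizontal child is now on the
  left of its parent and a vertical child below it, so \<open>Hor\<close> takes the role of the left
  direction.\<close>

lemma target_search_tree:
  fixes l :: "'n::finite \<Rightarrow> rect"
  assumes l: "bij_betw l UNIV R"
  shows "search_tree (\<lambda>d i j. target_child d (l i) (l j)) Hor Ver (\<lambda>i j. precedes (l i) (l j))"
    (is "search_tree ?U _ _ _")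
proof
  have lR: "l i \<in> R" for i using l by (auto simp: bij_betw_def)
  have l_inj: "i = j" if "l i = l j" for i j using l that by (auto simp: bij_betw_def inj_on_def)
  note inj = inj_onD[OF corner_inj(4)] inj_onD[OF corner_inj(2)] inj_onD[OF corner_inj(3)]
  show "Hor \<noteq> Ver" by simp
  have hor: "target_child Hor r s \<longleftrightarrow> top_left r = top_right s" for r s
    by (auto simp: target_child_def)
  have ver: "target_child Ver r s \<longleftrightarrow> bottom_right r = top_right s" for r s
    by (auto simp: target_child_def)
  show "j = k" if "?U d i j" "?U d i k" for d i j k
  proof -
    have "top_right (l j) = top_right (l k)" using that by (simp add: target_child_def)
    then show ?thesis by (rule l_inj[OF inj(1)[OF _ lR lR]])
  qed
  show "i = j \<and> d = e" if "?U d i k" "?U e j k" for d e i j k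
  proof -
    consider "d = e" | "d = Hor" "e = Ver" | "d = Ver" "e = Hor" by (cases d; cases e) auto
    then show ?thesis
    proof cases
      case 1
      have "l i = l j"
      proof (cases d)
        case Hor
        then have "top_left (l i) = top_left (l j)" using 1 that hor by metis
        then show ?thesis by (rule inj(3)[OF _ lR lR])
      next
        case Ver
        then have "bottom_right (l i) = bottom_right (l j)" using 1 that ver by metis
        then show ?thesis by (rule inj(2)[OF _ lR lR])
      qed
      then show ?thesis using l_inj 1 by blast
    next
      case 2
      then show ?thesis using that target_parent_unique[OF lR lR lR, of i k j] by (auto simp: hor ver)
    next
      case 3
      then show ?thesis using that target_parent_unique[OF lR lR lR, of j k i] by (auto simp: hor ver)
    qed
  qed
  show "\<exists>r. \<forall>j. (\<lambda>i j. \<exists>d. ?U d i j)\<^sup>*\<^sup>* r j"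
  proof -
    obtain r where r: "r \<in> R" "xmin r < X1" "X1 \<le> xmax r" "ymin r < Y1" "Y1 \<le> ymax r"
      by (rule south_west[OF box_proper(1) order_refl box_proper(2) order_refl])
    have "xmax r = X1" "ymax r = Y1" using bounds[OF r(1)] r by linarith+
    then have "top_right r = (X1, Y1)" by (simp add: corner_defs)
    moreover obtain i0 where "r = l i0" using l r(1) by (auto simp: bij_betw_def)
    ultimately have i0: "top_right (l i0) = (X1, Y1)" by simp
    have "(\<lambda>i j. \<exists>d. ?U d i j)\<^sup>*\<^sup>* i0 j" for j
    proof (rule reaches_all[where f = "\<lambda>i. - (xmax (l i) + ymax (l i))"])
      fix j assume "j \<noteq> i0"
      then have "top_right (l j) \<noteq> top_right (l i0)" using l_inj inj(1)[OF _ lR lR] by blast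
      then obtain s where s: "s \<in> R" "top_left s = top_right (l j) \<or> bottom_right s = top_right (l j)"
        using target_parent_exists[OF lR, of j] i0 by auto
      obtain i where i: "s = l i" using l s(1) by (auto simp: bij_betw_def)
      have "target_child Hor (l i) (l j) \<or> target_child Ver (l i) (l j)"
        using s i by (auto simp: target_child_def)
      moreover have "- (xmax (l i) + ymax (l i)) < - (xmax (l j) + ymax (l j))"
        using s(2) i proper[OF lR[of i]] by (auto simp: corner_defs)
      ultimately show "\<exists>i. (\<exists>d. ?U d i j) \<and> - (xmax (l i) + ymax (l i)) < - (xmax (l j) + ymax (l j))" by blast
    qed
    then show ?thesis by blast
  qed
  show "precedes (l i) (l k)" if "precedes (l i) (l j)" "precedes (l j) (l k)" for i j k
    using that by (rule precedes_trans)
  show "\<not> precedes (l i) (l i)" for i by (rule precedes_irrefl)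
  show "precedes (l i) (l w)" if c: "?U Ver i c" and w: "(?U Hor)\<^sup>*\<^sup>* c w" for i c w
  proof -
    have "ymax (l w) = ymax (l c) \<and> xmax (l w) \<le> xmax (l c) \<and>
        composed_of_edges R ({xmin (l w)..xmax (l c)} \<times> {ymax (l c)})"
      using w
    proof induction
      case base
      show ?case using composed_edge[OF lR[of c], of "top_edge (l c)"] by (simp add: edges_def edge_eq lR)
    next
      case (step v w)
      have e: "ymax (l w) = ymax (l v)" "xmax (l w) = xmin (l v)"
        using step.hyps(2) by (auto simp: target_child_def corner_defs)
      have "composed_of_edges R ({xmin (l w)..xmax (l w)} \<times> {ymax (l w)})"
        using composed_edge[OF lR[of w], of "top_edge (l w)"] by (simp add: edges_def edge_eq lR)
      then show ?case
        using composed_horizontal_Un[of "xmin (l v)" "xmax (l c)" "ymax (l c)" "xmin (l w)" "xmax (l w)"]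
          step.IH e proper[OF lR[of v]] proper[OF lR[of w]] by (simp add: min_def max_def)
    qed
    note w = this
    have e: "ymax (l c) = ymin (l i)" "xmax (l c) = xmax (l i)"
      using c by (auto simp: target_child_def corner_defs)
    have "composed_of_edges R ({xmin (l i)..xmax (l i)} \<times> {ymin (l i)})"
      using composed_edge[OF lR[of i], of "bottom_edge (l i)"] by (simp add: edges_def edge_eq lR)
    then have "composed_of_edges R ({min (xmin (l i)) (xmin (l w))..max (xmax (l i)) (xmax (l i))} \<times> {ymin (l i)})"
      using w e proper[OF lR[of i]] proper[OF lR[of w]] by (intro composed_horizontal_Un) auto
    then have "above R (l i) (l w)"
      by (rule aboveI[OF lR lR]) (use w e in \<open>auto simp: edge_eq lR\<close>)
    then show ?thesis by (rule precedes_above)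
  qed
  show "precedes (l w) (l i)" if c: "?U Hor i c" and w: "(?U Ver)\<^sup>*\<^sup>* c w" for i c w
  proof -
    have "xmax (l w) = xmax (l c) \<and> ymax (l w) \<le> ymax (l c) \<and>
        composed_of_edges R ({xmax (l c)} \<times> {ymin (l w)..ymax (l c)})"
      using w
    proof induction
      case base
      show ?case using composed_edge[OF lR[of c], of "right_edge (l c)"] by (simp add: edges_def edge_eq lR)
    next
      case (step v w)
      have e: "xmax (l w) = xmax (l v)" "ymax (l w) = ymin (l v)"
        using step.hyps(2) by (auto simp: target_child_def corner_defs)
      have "composed_of_edges R ({xmax (l w)} \<times> {ymin (l w)..ymax (l w)})"
        using composed_edge[OF lR[of w], of "right_edge (l w)"] by (simp add: edges_def edge_eq lR)
      then show ?case
        using composed_vertical_Un[of "xmax (l c)" "ymin (l v)" "ymax (l c)" "ymin (l w)" "ymax (l w)"]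
          step.IH e proper[OF lR[of v]] proper[OF lR[of w]] by (simp add: min_def max_def)
    qed
    note w = this
    have e: "xmax (l c) = xmin (l i)" "ymax (l c) = ymax (l i)"
      using c by (auto simp: target_child_def corner_defs)
    have "composed_of_edges R ({xmin (l i)} \<times> {ymin (l i)..ymax (l i)})"
      using composed_edge[OF lR[of i], of "left_edge (l i)"] by (simp add: edges_def edge_eq lR)
    then have "composed_of_edges R ({xmin (l i)} \<times> {min (ymin (l i)) (ymin (l w))..max (ymax (l i)) (ymax (l i))})"
      using w e proper[OF lR[of i]] proper[OF lR[of w]] by (intro composed_vertical_Un) auto
    then have "left_of R (l w) (l i)"
      by (rule left_ofI[OF lR lR]) (use w e in \<open>auto simp: edge_eq lR\<close>)
    then show ?thesis by (rule precedes_left)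
  qed
qed

end

subsection \<open>Inorder labels\<close>

lemma rank_strict_order:
  assumes A: "finite A" and irrefl: "\<And>a. \<not> lt a a"
    and trans: "\<And>a b c. lt a b \<Longrightarrow> lt b c \<Longrightarrow> lt a c"
    and total: "\<And>a b. a \<in> A \<Longrightarrow> b \<in> A \<Longrightarrow> a = b \<or> lt a b \<or> lt b a"
  defines "rk \<equiv> \<lambda>a. card {b \<in> A. lt b a}"
  shows "bij_betw rk A {..<card A}"
    and "\<And>a b. a \<in> A \<Longrightarrow> b \<in> A \<Longrightarrow> lt a b \<longleftrightarrow> rk a < rk b"
proof -
  have mono: "rk a < rk b" if "a \<in> A" "lt a b" for a b
  proof -
    have "{c \<in> A. lt c a} \<subset> {c \<in> A. lt c b}" using that irrefl trans by blast
    then show ?thesis unfolding rk_def using A by (intro psubset_card_mono) auto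
  qed
  show iff: "lt a b \<longleftrightarrow> rk a < rk b" if "a \<in> A" "b \<in> A" for a b
    using mono[of a b] mono[of b a] total[of a b] that by (metis less_asym less_irrefl)
  have inj: "inj_on rk A"
    by (rule inj_onI) (metis total iff less_irrefl)
  have "rk a < card A" if "a \<in> A" for a
  proof -
    have "{b \<in> A. lt b a} \<subset> A" using that irrefl by blast
    then show ?thesis unfolding rk_def using A by (rule psubset_card_mono[rotated])
  qed
  then have "rk ` A \<subseteq> {..<card A}" by auto
  then have "rk ` A = {..<card A}"
    using card_image[OF inj] by (intro card_subset_eq) auto
  then show "bij_betw rk A {..<card A}" using inj by (simp add: bij_betw_def)
qed

lemma rank_linorder:
  "bij_betw (\<lambda>i. card {j. j < i}) (UNIV :: 'n::{finite,linorder} set) {..<CARD('n)}"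
  using rank_strict_order(1)[of "UNIV :: 'n set" "(<)"] by force

context generic_rectangulation
begin

lemma inorder_labeling_iff:
  "inorder_labeling R l \<longleftrightarrow> bij_betw l UNIV R \<and> (\<forall>i j. i < j \<longleftrightarrow> precedes (l i) (l j))"
  by (simp add: inorder_labeling_def precedes_def)

text \<open>Any numbering serves as provisional node names for the source tree, whose search tree
  structure compares all pairs.\<close>

lemma precedes_total:
  fixes l :: "'n::finite \<Rightarrow> rect"
  assumes "bij_betw l UNIV R" "r \<in> R" "s \<in> R"
  shows "r = s \<or> precedes r s \<or> precedes s r"
proof -
  interpret search_tree "\<lambda>d i j. source_child d (l i) (l j)" Ver Hor "\<lambda>i j. precedes (l i) (l j)"
    using assms(1) by (rule source_search_tree)
  obtain i j where "r = l i" "s = l j" using assms by (auto simp: bij_betw_def)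
  then show ?thesis using lt_total[of i j] by blast
qed

lemma rank_precedes:
  fixes l :: "'n::finite \<Rightarrow> rect"
  assumes l: "bij_betw l UNIV R"
  shows "bij_betw (\<lambda>r. card {s \<in> R. precedes s r}) R {..<card R}"
    and "r \<in> R \<Longrightarrow> s \<in> R \<Longrightarrow>
      precedes r s \<longleftrightarrow> card {t \<in> R. precedes t r} < card {t \<in> R. precedes t s}"
proof -
  show "bij_betw (\<lambda>r. card {s \<in> R. precedes s r}) R {..<card R}"
    by (rule rank_strict_order(1)[OF finite_R precedes_irrefl])
      (fact precedes_trans precedes_total[OF l])+
  show "precedes r s \<longleftrightarrow> card {t \<in> R. precedes t r} < card {t \<in> R. precedes t s}"
    if "r \<in> R" "s \<in> R"
    by (rule rank_strict_order(2)[OF finite_R precedes_irrefl _ _ that])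
      (fact precedes_trans precedes_total[OF l])+
qed

text \<open>The label of a rectangle is forced by its rank, which makes the definite description in
  \<open>rect_of\<close> meaningful.\<close>

lemma rank_of_inorder_labeling:
  fixes l :: "'n::{finite,linorder} \<Rightarrow> rect"
  assumes "inorder_labeling R l"
  shows "card {s \<in> R. precedes s (l i)} = card {j. j < i}"
proof -
  have l: "inj l" "range l = R" using assms by (auto simp: inorder_labeling_iff bij_betw_def)
  have "{s \<in> R. precedes s (l i)} = l ` {j. j < i}"
    using assms l(2) by (auto simp: inorder_labeling_iff)
  then show ?thesis using l(1) by (simp add: card_image inj_on_subset)
qed

lemma ex_inorder_labeling:
  assumes "card R = CARD('n::{finite,linorder})"
  shows "\<exists>l :: 'n \<Rightarrow> rect. inorder_labeling R l"
proof -
  obtain l0 :: "'n \<Rightarrow> rect" where l0: "bij_betw l0 UNIV R"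
    using finite_same_card_bij[of "UNIV :: 'n set" R] finite_R assms by auto
  note rank = rank_precedes[OF l0]
  let ?f = "\<lambda>r. card {s \<in> R. precedes s r}" and ?g = "\<lambda>i::'n. card {j. j < i}"
  have f: "bij_betw ?f R {..<CARD('n)}" using rank(1) assms by simp
  \<comment> \<open>Each label is sent to the rectangle of the same rank.\<close>
  define l where "l = inv_into R ?f \<circ> ?g"
  have l: "bij_betw l UNIV R"
    unfolding l_def using rank_linorder bij_betw_inv_into[OF f] by (rule bij_betw_trans)
  have "?f (l i) = ?g i" for i
    using bij_betw_inv_into_right[OF f bij_betw_apply[OF rank_linorder UNIV_I], of i] by (simp add: l_def)
  moreover have "?g i < ?g j \<longleftrightarrow> i < j" for i j
    using rank_strict_order(2)[of "UNIV :: 'n set" "(<)" i j] by force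
  moreover have lR: "l i \<in> R" for i using l by (auto simp: bij_betw_def)
  ultimately have "i < j \<longleftrightarrow> precedes (l i) (l j)" for i j using rank(2)[OF lR lR, of i j] by simp
  then show ?thesis using l by (auto simp: inorder_labeling_iff)
qed

lemma inorder_labeling_unique:
  fixes l l' :: "'n::{finite,linorder} \<Rightarrow> rect"
  assumes l: "inorder_labeling R l" and l': "inorder_labeling R l'"
  shows "l = l'"
proof
  fix i
  have bij: "bij_betw l UNIV R" using l by (simp add: inorder_labeling_iff)
  have "l i \<in> R" "l' i \<in> R" using l l' by (auto simp: inorder_labeling_iff bij_betw_def)
  moreover have inj: "inj_on (\<lambda>r. card {s \<in> R. precedes s r}) R"
    using rank_precedes(1)[OF bij] by (simp add: bij_betw_def)
  ultimately show "l i = l' i"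
    using rank_of_inorder_labeling[OF l, of i] rank_of_inorder_labeling[OF l', of i]
    by (intro inj_onD[OF inj]) simp_all
qed

lemma rect_of_eq: "inorder_labeling R l \<Longrightarrow> rect_of R = l"
  unfolding rect_of_def using inorder_labeling_unique by blast

text \<open>D(R) also contains the top and right edges of rectangles, but these end in a top right
  corner, which is never a source. For the remaining edges the starting corner determines the
  rectangle.\<close>

lemma source_edge_iff:
  fixes l :: "'n::{finite,linorder} \<Rightarrow> rect"
  assumes l: "inorder_labeling R l"
  shows "source_edge R d i j \<longleftrightarrow> source_child d (l i) (l j)"
proof -
  have lR: "l i \<in> R" for i using l by (auto simp: inorder_labeling_iff bij_betw_def)
  have bl: "r = l i" if "r \<in> R" "bottom_left (l i) = bottom_left r" for r i
    using inj_onD[OF corner_inj(1) that(2) lR that(1)] by simp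
  have no: "top_right r \<noteq> bottom_left (l i)" if "r \<in> R" for r i
    by (rule top_right_neq_bottom_left[OF that lR])
  show ?thesis
  proof (cases d)
    case Hor
    show ?thesis
    proof
      assume "source_edge R d i j"
      then obtain r where "r \<in> R" "bottom_left (l i) = bottom_left r" "bottom_left (l j) = bottom_right r"
        using no[of _ j] unfolding Hor source_edge_def rect_of_eq[OF l] induced_def by fastforce
      then show "source_child d (l i) (l j)" using bl[of r i] by (simp add: source_child_def Hor)
    next
      assume "source_child d (l i) (l j)"
      then have "bottom_right (l i) = bottom_left (l j)" by (simp add: source_child_def Hor)
      then have "(bottom_left (l i), bottom_left (l j)) \<in> D_edges R Hor" using lR[of i] by force
      then show "source_edge R d i j"
        using lR by (simp add: Hor source_edge_def rect_of_eq[OF l] induced_def)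
    qed
  next
    case Ver
    show ?thesis
    proof
      assume "source_edge R d i j"
      then obtain r where "r \<in> R" "bottom_left (l i) = bottom_left r" "bottom_left (l j) = top_left r"
        using no[of _ j] unfolding Ver source_edge_def rect_of_eq[OF l] induced_def by fastforce
      then show "source_child d (l i) (l j)" using bl[of r i] by (simp add: source_child_def Ver)
    next
      assume "source_child d (l i) (l j)"
      then have "top_left (l i) = bottom_left (l j)" by (simp add: source_child_def Ver)
      then have "(bottom_left (l i), bottom_left (l j)) \<in> D_edges R Ver" using lR[of i] by force
      then show "source_edge R d i j"
        using lR by (simp add: Ver source_edge_def rect_of_eq[OF l] induced_def)
    qed
  qed
qed

text \<open>Dually, bottom and left edges start in a bottom left corner, which is never a target.
  The order of \<open>i\<close> and \<open>j\<close> is reversed because target edges point to the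
  parent.\<close>

lemma target_edge_iff:
  fixes l :: "'n::{finite,linorder} \<Rightarrow> rect"
  assumes l: "inorder_labeling R l"
  shows "target_edge R d i j \<longleftrightarrow> target_child d (l j) (l i)"
proof -
  have lR: "l i \<in> R" for i using l by (auto simp: inorder_labeling_iff bij_betw_def)
  have tr: "r = l i" if "r \<in> R" "top_right (l i) = top_right r" for r i
    using inj_onD[OF corner_inj(4) that(2) lR that(1)] by simp
  have no: "top_right (l i) \<noteq> bottom_left r" if "r \<in> R" for r i
    by (rule top_right_neq_bottom_left[OF lR that])
  show ?thesis
  proof (cases d)
    case Hor
    show ?thesis
    proof
      assume "target_edge R d i j"
      then obtain r where "r \<in> R" "top_right (l i) = top_left r" "top_right (l j) = top_right r"
        using no[of _ i] unfolding Hor target_edge_def rect_of_eq[OF l] induced_def by fastforce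
      then show "target_child d (l j) (l i)" using tr[of r j] by (simp add: target_child_def Hor)
    next
      assume "target_child d (l j) (l i)"
      then have "top_left (l j) = top_right (l i)" by (simp add: target_child_def Hor)
      then have "(top_right (l i), top_right (l j)) \<in> D_edges R Hor" using lR[of j] by force
      then show "target_edge R d i j"
        using lR by (simp add: Hor target_edge_def rect_of_eq[OF l] induced_def)
    qed
  next
    case Ver
    show ?thesis
    proof
      assume "target_edge R d i j"
      then obtain r where "r \<in> R" "top_right (l i) = bottom_right r" "top_right (l j) = top_right r"
        using no[of _ i] unfolding Ver target_edge_def rect_of_eq[OF l] induced_def by fastforce
      then show "target_child d (l j) (l i)" using tr[of r j] by (simp add: target_child_def Ver)
    next
      assume "target_child d (l j) (l i)"
      then have "bottom_right (l j) = top_right (l i)" by (simp add: target_child_def Ver)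
      then have "(top_right (l i), top_right (l j)) \<in> D_edges R Ver" using lR[of j] by force
      then show "target_edge R d i j"
        using lR by (simp add: Ver target_edge_def rect_of_eq[OF l] induced_def)
    qed
  qed
qed

lemma binary_search_trees:
  assumes "card R = CARD('n::{finite,linorder})"
  shows "binary_search_tree (source_tree R :: direction \<Rightarrow> 'n \<Rightarrow> 'n \<Rightarrow> bool) Ver Hor"
    and "binary_search_tree (target_tree R :: direction \<Rightarrow> 'n \<Rightarrow> 'n \<Rightarrow> bool) Hor Ver"
proof -
  obtain l :: "'n \<Rightarrow> rect" where l: "inorder_labeling R l" using ex_inorder_labeling[OF assms] by blast
  have lt: "(\<lambda>i j. precedes (l i) (l j)) = (<)" and bij: "bij_betw l UNIV R"
    using l by (auto simp: inorder_labeling_iff fun_eq_iff)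
  have source: "source_tree R = (\<lambda>d i j. source_child d (l i) (l j))"
    by (intro ext) (simp add: source_tree_def source_edge_iff[OF l])
  have target: "target_tree R = (\<lambda>d i j. target_child d (l i) (l j))"
    by (intro ext) (simp add: target_tree_def target_edge_iff[OF l])
  show "binary_search_tree (source_tree R :: direction \<Rightarrow> 'n \<Rightarrow> 'n \<Rightarrow> bool) Ver Hor"
    unfolding binary_search_tree_def source lt[symmetric] by (rule source_search_tree[OF bij])
  show "binary_search_tree (target_tree R :: direction \<Rightarrow> 'n \<Rightarrow> 'n \<Rightarrow> bool) Hor Ver"
    unfolding binary_search_tree_def target lt[symmetric] by (rule target_search_tree[OF bij])
qed

end

section \<open>Vertices and cones in terms of interval roots\<close>

lemma weak_cone_iff:
  "v \<in> weak_cone R \<longleftrightarrow> (\<forall>d i j. source_edge R d i j \<or> target_edge R d i j \<longrightarrow> v $ i \<le> v $ j)"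
proof
  assume v: "v \<in> weak_cone R"
  have "weak_poset R i j" if "source_edge R d i j \<or> target_edge R d i j" for d i j
    unfolding weak_poset_def using that by (intro tranclp.r_into_trancl) (metis tranclp.r_into_trancl)
  then show "\<forall>d i j. source_edge R d i j \<or> target_edge R d i j \<longrightarrow> v $ i \<le> v $ j"
    using v unfolding weak_cone_def by blast
next
  assume v: "\<forall>d i j. source_edge R d i j \<or> target_edge R d i j \<longrightarrow> v $ i \<le> v $ j"
  have mono: "v $ i \<le> v $ j" if step: "\<And>i j. P i j \<Longrightarrow> v $ i \<le> v $ j" and ij: "P\<^sup>+\<^sup>+ i j" for P i j
    using ij
  proof induction
    case (base j)
    then show ?case by (rule step)
  next
    case (step j k)
    then show ?case using that(1)[of j k] by linarith
  qed
  have source: "v $ i \<le> v $ j" if "(\<lambda>i j. \<exists>d. source_edge R d i j)\<^sup>+\<^sup>+ i j" for i j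
    by (rule mono[OF _ that]) (use v in blast)
  have target: "v $ i \<le> v $ j" if "(\<lambda>i j. \<exists>d. target_edge R d i j)\<^sup>+\<^sup>+ i j" for i j
    by (rule mono[OF _ that]) (use v in blast)
  have "v $ i \<le> v $ j" if "weak_poset R i j" for i j
    by (rule mono[OF _ that[unfolded weak_poset_def]]) (elim disjE source target)
  then show "v \<in> weak_cone R" by (simp add: weak_cone_def)
qed

lemma (in binary_search_tree) root_le:
  fixes v :: "real ^ ('n::{finite,linorder})"
  assumes mono: "\<And>d i j. U d i j \<Longrightarrow> v $ i \<le> v $ j" and I: "I \<in> intervals" "j \<in> I"
  shows "v $ (root I) \<le> v $ j"
proof -
  have "child\<^sup>*\<^sup>* (root I) j" using sub_root[OF I] by (simp add: sub_def)
  then show ?thesis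
  proof induction
    case (step j k)
    then obtain d where "U d j k" by blast
    then show ?case using mono[of d j k] step.IH by linarith
  qed simp
qed

text \<open>\<open>f\<close> and \<open>g\<close> are the source and target roots. Passing to
  arbitrary choice functions on intervals separates the polyhedral argument from the trees, and
  later yields finiteness of the vertex set.\<close>

lemma (in generic_rectangulation) weak_vertex_roots:
  assumes "card R = CARD('n::{finite,linorder})"
  obtains f g :: "'n::{finite,linorder} set \<Rightarrow> 'n" where
    "\<And>I. I \<in> intervals \<Longrightarrow> f I \<in> I" "\<And>I. I \<in> intervals \<Longrightarrow> g I \<in> I"
    "weak_vertex R = (\<Sum>I\<in>intervals. axis (g I) 1 - axis (f I) 1)"
    "\<And>v. v \<in> weak_cone R \<longleftrightarrow> (\<forall>I\<in>intervals. \<forall>j\<in>I. v $ f I \<le> v $ j \<and> v $ j \<le> v $ g I)"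
proof -
  interpret S: binary_search_tree "source_tree R :: direction \<Rightarrow> 'n \<Rightarrow> 'n \<Rightarrow> bool" Ver Hor
    by (rule binary_search_trees(1)[OF assms])
  interpret T: binary_search_tree "target_tree R :: direction \<Rightarrow> 'n \<Rightarrow> 'n \<Rightarrow> bool" Hor Ver
    by (rule binary_search_trees(2)[OF assms])
  have "weak_vertex R = (\<Sum>I\<in>intervals. axis (T.root I) 1 - axis (S.root I) 1)"
  proof (subst vec_eq_iff, rule allI)
    fix k :: 'n
    let ?f = "\<lambda>i. axis i (1::real) $ k"
    have "weak_vertex R $ k = (\<Sum>i\<in>UNIV. real (num_leaves (target_tree R) Hor i) * real (num_leaves (target_tree R) Ver i) * ?f i)
        - (\<Sum>i\<in>UNIV. real (num_leaves (source_tree R) Ver i) * real (num_leaves (source_tree R) Hor i) * ?f i)"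
      by (simp add: weak_vertex_def sum_subtractf[symmetric] algebra_simps)
    also have "\<dots> = (\<Sum>I\<in>intervals. ?f (T.root I)) - (\<Sum>I\<in>intervals. ?f (S.root I))"
      unfolding T.sum_num_leaves S.sum_num_leaves ..
    finally show "weak_vertex R $ k = (\<Sum>I\<in>intervals. axis (T.root I) 1 - axis (S.root I) 1) $ k"
      by (simp add: sum_subtractf)
  qed
  moreover have "v \<in> weak_cone R \<longleftrightarrow> (\<forall>I\<in>intervals. \<forall>j\<in>I. v $ S.root I \<le> v $ j \<and> v $ j \<le> v $ T.root I)" for v
  proof
    assume "v \<in> weak_cone R"
    \<comment> \<open>Along the target tree, entries of \<open>v\<close> decrease from parent to
      child; replacing \<open>v\<close> by \<open>- v\<close> allows the use of
      \<open>root_le\<close> for both trees.\<close>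
    then have S: "source_tree R d i j \<Longrightarrow> v $ i \<le> v $ j" and T: "target_tree R d i j \<Longrightarrow> (- v) $ i \<le> (- v) $ j" for d i j
      by (auto simp: weak_cone_iff source_tree_def target_tree_def)
    show "\<forall>I\<in>intervals. \<forall>j\<in>I. v $ S.root I \<le> v $ j \<and> v $ j \<le> v $ T.root I"
      using S.root_le[of v, OF S] T.root_le[of "- v", OF T] by auto
  next
    assume v: "\<forall>I\<in>intervals. \<forall>j\<in>I. v $ S.root I \<le> v $ j \<and> v $ j \<le> v $ T.root I"
    \<comment> \<open>Every tree edge is seen by an interval whose root is the parent and which
      contains the child.\<close>
    have "v $ i \<le> v $ j" if "source_edge R d i j \<or> target_edge R d i j" for d i j
      using that v S.root_edge[of d i j] T.root_edge[of d j i] unfolding source_tree_def target_tree_def by metis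
    then show "v \<in> weak_cone R" by (auto simp: weak_cone_iff)
  qed
  ultimately show ?thesis using that[of S.root T.root] S.root_in T.root_in by blast
qed

subsection \<open>Diagonal rectangulations\<close>

text \<open>The diagonal rectangulation of a permutation w, in matrix coordinates: the cell in column p
  and row q, with rows counted from the top, belongs to the position of the minimum of w on {p..q}
  if p \<le> q, and to the position of the maximum of w on {q..p} if q \<le> p.\<close>

locale injective_weights =
  fixes n :: nat and w :: "nat \<Rightarrow> nat"
  assumes n_pos: "0 < n" and w_inj: "inj_on w {..<n}"
begin

text \<open>Left end of the maximal run of positions directly before \<open>i\<close> that are in
  relation \<open>P\<close> to \<open>i\<close>; it is \<open>i\<close> itself when the run is
  empty.\<close>

definition lo :: "(nat \<Rightarrow> nat \<Rightarrow> bool) \<Rightarrow> nat \<Rightarrow> nat" where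
  "lo P i = (LEAST a. \<forall>k. a \<le> k \<and> k < i \<longrightarrow> P k i)"

text \<open>Exclusive right end of the corresponding run after \<open>i\<close>. For
  \<open>i < n\<close> position \<open>n\<close> always stops the run, so the value is at most
  \<open>n\<close>.\<close>

definition hi :: "(nat \<Rightarrow> nat \<Rightarrow> bool) \<Rightarrow> nat \<Rightarrow> nat" where
  "hi P i = (LEAST d. i < d \<and> (d < n \<longrightarrow> \<not> P d i))"

abbreviation "smaller k i \<equiv> w k < w i"
abbreviation "larger k i \<equiv> w i < w k"

lemma lo_le_iff: "lo P i \<le> a \<longleftrightarrow> (\<forall>k. a \<le> k \<and> k < i \<longrightarrow> P k i)"
proof
  have "\<forall>k. lo P i \<le> k \<and> k < i \<longrightarrow> P k i"
    unfolding lo_def by (rule LeastI[of _ i]) auto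
  then show "lo P i \<le> a \<Longrightarrow> \<forall>k. a \<le> k \<and> k < i \<longrightarrow> P k i" by force
  show "\<forall>k. a \<le> k \<and> k < i \<longrightarrow> P k i \<Longrightarrow> lo P i \<le> a"
    unfolding lo_def by (rule Least_le)
qed

lemma less_hi_iff:
  assumes "i < n" "a < n"
  shows "a < hi P i \<longleftrightarrow> (\<forall>k. i < k \<and> k \<le> a \<longrightarrow> P k i)"
proof
  show "a < hi P i \<Longrightarrow> \<forall>k. i < k \<and> k \<le> a \<longrightarrow> P k i"
    unfolding hi_def using not_less_Least assms(2) by (metis (no_types, lifting) le_less_trans)
  have "i < hi P i \<and> (hi P i < n \<longrightarrow> \<not> P (hi P i) i)"
    unfolding hi_def by (rule LeastI[of _ n]) (use assms in auto)
  then show "\<forall>k. i < k \<and> k \<le> a \<longrightarrow> P k i \<Longrightarrow> a < hi P i"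
    using assms(2) by (meson le_less_trans not_le)
qed

lemma lo_le: "lo P i \<le> i"
  by (auto simp: lo_le_iff)

lemma less_hi: "i < n \<Longrightarrow> i < hi P i"
  by (auto simp: less_hi_iff)

lemma hi_le: "i < n \<Longrightarrow> hi P i \<le> n"
  unfolding hi_def by (rule Least_le) auto

text \<open>The conditions on the column and on the row of a cell of \<open>i\<close> are
  independent, so the cells fill a rectangle: the columns extend over larger weights to the left and
  smaller ones to the right, the rows the other way round. Rows are counted from the top, hence the
  heights \<open>n\<close> minus row.\<close>

definition tile :: "nat \<Rightarrow> rect" where
  "tile i = Rect (real (lo larger i)) (real (hi smaller i)) (real n - real (hi larger i)) (real n - real (lo smaller i))"

lemma tile_simps [simp]:
  "xmin (tile i) = real (lo larger i)" "xmax (tile i) = real (hi smaller i)"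
  "ymin (tile i) = real n - real (hi larger i)" "ymax (tile i) = real n - real (lo smaller i)"
  by (simp_all add: tile_def)

definition has_cell :: "nat \<Rightarrow> nat \<Rightarrow> nat \<Rightarrow> bool" where
  "has_cell i p q \<longleftrightarrow> lo larger i \<le> p \<and> p < hi smaller i \<and> lo smaller i \<le> q \<and> q < hi larger i"

lemma has_cell_iff:
  assumes "i < n" "p < n" "q < n"
  shows "has_cell i p q \<longleftrightarrow> (\<forall>k. p \<le> k \<and> k < i \<longrightarrow> w i < w k) \<and> (\<forall>k. i < k \<and> k \<le> p \<longrightarrow> w k < w i) \<and>
    (\<forall>k. q \<le> k \<and> k < i \<longrightarrow> w k < w i) \<and> (\<forall>k. i < k \<and> k \<le> q \<longrightarrow> w i < w k)"
  using assms by (simp add: has_cell_def lo_le_iff less_hi_iff)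

lemma w_neq: "i < n \<Longrightarrow> j < n \<Longrightarrow> i \<noteq> j \<Longrightarrow> w i < w j \<or> w j < w i"
  using inj_onD[OF w_inj, of i j] by (metis lessThan_iff nat_neq_iff)

text \<open>If \<open>i\<close> were outside \<open>{p..q}\<close>, the column and row conditions
  would compare \<open>w i\<close> in opposite ways with the weight at the nearer end of the range.
  Inside it, the two conditions together say that \<open>w i\<close> is minimal.\<close>

lemma has_cell_below:
  assumes "p \<le> q" "q < n" "i < n"
  shows "has_cell i p q \<longleftrightarrow> p \<le> i \<and> i \<le> q \<and> (\<forall>k. p \<le> k \<and> k \<le> q \<longrightarrow> w i \<le> w k)"
proof
  assume c: "has_cell i p q"
  note c' = c[unfolded has_cell_iff[OF assms(3) le_less_trans[OF assms(1,2)] assms(2)]]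
  have "p \<le> i"
  proof (rule ccontr)
    assume "\<not> p \<le> i"
    then have "w p < w i \<and> w i < w p" using c' assms(1) by auto
    then show False by linarith
  qed
  moreover have "i \<le> q"
  proof (rule ccontr)
    assume "\<not> i \<le> q"
    then have "w i < w q \<and> w q < w i" using c' assms(1) by auto
    then show False by linarith
  qed
  moreover have "w i \<le> w k" if "p \<le> k" "k \<le> q" for k
    using c' that by (cases k i rule: linorder_cases) auto
  ultimately show "p \<le> i \<and> i \<le> q \<and> (\<forall>k. p \<le> k \<and> k \<le> q \<longrightarrow> w i \<le> w k)" by blast
next
  assume c: "p \<le> i \<and> i \<le> q \<and> (\<forall>k. p \<le> k \<and> k \<le> q \<longrightarrow> w i \<le> w k)"
  have "w i < w k" if "p \<le> k" "k \<le> q" "k \<noteq> i" for k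
    using c w_neq[of k i] that assms by fastforce
  then show "has_cell i p q"
    using c assms by (subst has_cell_iff) auto
qed

lemma has_cell_right:
  assumes "q \<le> p" "p < n" "i < n"
  shows "has_cell i p q \<longleftrightarrow> q \<le> i \<and> i \<le> p \<and> (\<forall>k. q \<le> k \<and> k \<le> p \<longrightarrow> w k \<le> w i)"
proof
  assume c: "has_cell i p q"
  note c' = c[unfolded has_cell_iff[OF assms(3,2) le_less_trans[OF assms(1,2)]]]
  have "q \<le> i"
  proof (rule ccontr)
    assume "\<not> q \<le> i"
    then have "w q < w i \<and> w i < w q" using c' assms(1) by auto
    then show False by linarith
  qed
  moreover have "i \<le> p"
  proof (rule ccontr)
    assume "\<not> i \<le> p"
    then have "w i < w p \<and> w p < w i" using c' assms(1) by auto
    then show False by linarith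
  qed
  moreover have "w k \<le> w i" if "q \<le> k" "k \<le> p" for k
    using c' that by (cases k i rule: linorder_cases) auto
  ultimately show "q \<le> i \<and> i \<le> p \<and> (\<forall>k. q \<le> k \<and> k \<le> p \<longrightarrow> w k \<le> w i)" by blast
next
  assume c: "q \<le> i \<and> i \<le> p \<and> (\<forall>k. q \<le> k \<and> k \<le> p \<longrightarrow> w k \<le> w i)"
  have "w k < w i" if "q \<le> k" "k \<le> p" "k \<noteq> i" for k
    using c w_neq[of k i] that assms by fastforce
  then show "has_cell i p q"
    using c assms by (subst has_cell_iff) auto
qed

lemma has_cell_unique:
  assumes "i < n" "j < n" "p < n" "q < n" "has_cell i p q" "has_cell j p q"
  shows "i = j"
proof (rule ccontr)
  assume "i \<noteq> j"
  then have ne: "w i < w j \<or> w j < w i" using w_neq assms by blast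
  show False
  proof (cases "p \<le> q")
    case True
    then have "w i \<le> w j" "w j \<le> w i" using assms by (auto simp: has_cell_below)
    then show False using ne by simp
  next
    case False
    then have "w i \<le> w j" "w j \<le> w i" using assms by (auto simp: has_cell_right)
    then show False using ne by simp
  qed
qed

lemma ex_has_cell:
  assumes "p < n" "q < n"
  shows "\<exists>i<n. has_cell i p q"
proof (cases "p \<le> q")
  case True
  have "Min (w ` {p..q}) \<in> w ` {p..q}" using True by (intro Min_in) auto
  then obtain i where i: "i \<in> {p..q}" "w i = Min (w ` {p..q})" by auto
  then have "w i \<le> w k" if "p \<le> k" "k \<le> q" for k using that by simp
  then show ?thesis using i True assms by (intro exI[of _ i]) (auto simp: has_cell_below)
next
  case False
  then have "Max (w ` {q..p}) \<in> w ` {q..p}" by (intro Max_in) auto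
  then obtain i where i: "i \<in> {q..p}" "w i = Max (w ` {q..p})" by auto
  then have "w k \<le> w i" if "q \<le> k" "k \<le> p" for k using that by simp
  then show ?thesis using i False assms by (intro exI[of _ i]) (auto simp: has_cell_right)
qed

section \<open>The diagonal tiling as a generic rectangulation\<close>

definition tiling :: "rect set" where
  "tiling = tile ` {..<n}"

lemma tile_proper:
  "i < n \<Longrightarrow> xmin (tile i) < xmax (tile i)" "i < n \<Longrightarrow> ymin (tile i) < ymax (tile i)"
  using le_less_trans[OF lo_le less_hi] by (auto simp: of_nat_less_iff)

lemma tiles_overlap:
  assumes ij: "i < n" "j < n"
    and x: "xmin (tile i) < xmax (tile j)" "xmin (tile j) < xmax (tile i)"
    and y: "ymin (tile i) < ymax (tile j)" "ymin (tile j) < ymax (tile i)"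
  shows "i = j"
proof (rule has_cell_unique)
  \<comment> \<open>The top left cell of the common part of the two tiles.\<close>
  let ?p = "max (lo larger i) (lo larger j)" and ?q = "max (lo smaller i) (lo smaller j)"
  show "?p < n" "?q < n" using ij by (simp_all add: le_less_trans[OF lo_le])
  show "has_cell i ?p ?q" "has_cell j ?p ?q"
    using x y le_less_trans[OF lo_le less_hi] ij by (auto simp: has_cell_def)
qed (use ij in auto)

lemma inj_tile: "inj_on tile {..<n}"
proof (rule inj_onI)
  fix i j assume "i \<in> {..<n}" "j \<in> {..<n}" "tile i = tile j"
  then show "i = j" using tiles_overlap[of i j] tile_proper[of j] by simp
qed

lemma card_tiling: "card tiling = n"
  by (simp add: tiling_def card_image[OF inj_tile])

text \<open>The tile of the first diagonal cell touches the left and top sides of the square, that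
  of the last diagonal cell the right and bottom sides.\<close>

lemma bounding_box_tiling: "bounding_box tiling = Rect 0 (real n) 0 (real n)"
proof -
  obtain i where i: "i < n" "has_cell i 0 0" using ex_has_cell[of 0 0] n_pos by blast
  obtain j where j: "j < n" "has_cell j (n - 1) (n - 1)" using ex_has_cell[of "n - 1" "n - 1"] n_pos by auto
  have j': "hi smaller j = n" "hi larger j = n"
    using j hi_le[OF j(1), of smaller] hi_le[OF j(1), of larger] by (auto simp: has_cell_def)
  have i': "lo smaller i = 0" "lo larger i = 0" using i(2) by (auto simp: has_cell_def)
  have "Min (xmin ` tiling) = 0"
    by (rule Min_eqI) (use i i' in \<open>force simp: tiling_def\<close>)+
  moreover have "Max (xmax ` tiling) = real n"
    by (rule Max_eqI) (use j j' hi_le in \<open>force simp: tiling_def\<close>)+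
  moreover have "Min (ymin ` tiling) = 0"
    by (rule Min_eqI) (use j j' hi_le in \<open>force simp: tiling_def\<close>)+
  moreover have "Max (ymax ` tiling) = real n"
    by (rule Max_eqI) (use i i' in \<open>force simp: tiling_def\<close>)+
  ultimately show ?thesis by (simp add: bounding_box_def)
qed

lemma ex_unit_interval:
  assumes "0 \<le> x" "x \<le> real n"
  shows "\<exists>p<n. real p \<le> x \<and> x \<le> real p + 1"
proof (cases "x = real n")
  case True
  then show ?thesis using n_pos by (intro exI[of _ "n - 1"]) auto
next
  case False
  then have "x < real n" using assms by simp
  then have "nat \<lfloor>x\<rfloor> < n" using assms by linarith
  then show ?thesis using assms by (intro exI[of _ "nat \<lfloor>x\<rfloor>"]) linarith
qed

lemma rectangulation_tiling: "rectangulation tiling"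
proof -
  have region_subset: "region (tile i) \<subseteq> region (bounding_box tiling)" if "i < n" for i
    using hi_le[OF that, of smaller] hi_le[OF that, of larger]
    by (auto simp: bounding_box_tiling region_eq)
  have cover: "\<exists>i<n. z \<in> region (tile i)" if z: "z \<in> region (bounding_box tiling)" for z
  proof -
    obtain x y where xy: "z = (x, y)" "0 \<le> x" "x \<le> n" "0 \<le> y" "y \<le> n"
      using z by (cases z) (auto simp: bounding_box_tiling region_eq)
    obtain p where p: "p < n" "real p \<le> x" "x \<le> real p + 1" using ex_unit_interval xy by blast
    obtain q where q: "q < n" "real q \<le> n - y" "n - y \<le> real q + 1"
      using ex_unit_interval[of "n - y"] xy by auto
    obtain i where i: "i < n" "has_cell i p q" using ex_has_cell p q by blast
    then have "real (lo larger i) \<le> p" "p + 1 \<le> real (hi smaller i)" "real (lo smaller i) \<le> q" "q + 1 \<le> real (hi larger i)"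
      by (auto simp: has_cell_def)
    then have "z \<in> region (tile i)" using p q xy(1) by (auto simp: region_eq)
    then show ?thesis using i by blast
  qed
  have "(region ` tiling) division_of region (bounding_box tiling)"
    unfolding division_of_def
  proof (intro conjI ballI impI)
    show "finite (region ` tiling)" by (simp add: tiling_def)
    fix K assume "K \<in> region ` tiling"
    then obtain i where i: "i < n" "K = region (tile i)" by (auto simp: tiling_def)
    show "K \<subseteq> region (bounding_box tiling)" using region_subset i by simp
    show "K \<noteq> {}" using tile_proper[OF i(1)] i(2) by (auto simp: region_eq)
    show "\<exists>a b. K = cbox a b" using i(2) by (auto simp: region_def)
    fix K' assume "K' \<in> region ` tiling" "K \<noteq> K'"
    then obtain j where j: "j < n" "K' = region (tile j)" "i \<noteq> j" using i by (auto simp: tiling_def)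
    show "interior K \<inter> interior K' = {}"
    proof (rule ccontr)
      assume "interior K \<inter> interior K' \<noteq> {}"
      then obtain z where "z \<in> interior K" "z \<in> interior K'" by blast
      then have "i = j" unfolding i(2) j(2) interior_region by (intro tiles_overlap[OF i(1) j(1)]) auto
      then show False using j(3) by simp
    qed
  next
    show "\<Union> (region ` tiling) = region (bounding_box tiling)"
      using region_subset cover by (fastforce simp: tiling_def)
  qed
  moreover have "finite tiling" "\<forall>r\<in>tiling. proper_rect r" "is_square (bounding_box tiling)"
    using tile_proper n_pos unfolding bounding_box_tiling is_square_def proper_rect_def
    by (auto simp: tiling_def)
  ultimately show ?thesis by (simp add: rectangulation_def)
qed

sublocale rectangulated tiling
  by unfold_locales (rule rectangulation_tiling)

text \<open>Consider the four cells around a common corner. Below the diagonal the cell with the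
  longest range has its minimum either at the first position, and then shares its tile with the cell
  above, or later, and then with the cell to the right. Above the diagonal the same holds with
  maxima. On the diagonal an off-diagonal cell belongs to one of the two neighbouring diagonal
  cells. So the four tiles are never distinct.\<close>

lemma generic_tiling: "generic tiling"
  unfolding generic_iff
proof (intro notI, elim exE conjE)
  fix z r1 r2 r3 r4
  assume R: "r1 \<in> tiling" "r2 \<in> tiling" "r3 \<in> tiling" "r4 \<in> tiling"
    and z: "bottom_left r1 = z" "bottom_right r2 = z" "top_left r3 = z" "top_right r4 = z"
  obtain i1 i2 i3 i4 where i: "i1 < n" "i2 < n" "i3 < n" "i4 < n"
    and r: "r1 = tile i1" "r2 = tile i2" "r3 = tile i3" "r4 = tile i4"
    using R by (auto simp: tiling_def)
  have "bottom_left r1 = bottom_right r2" "bottom_right r2 = top_left r3" "top_left r3 = top_right r4"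
    using z by auto
  then have x: "hi smaller i2 = lo larger i1" "lo larger i3 = lo larger i1" "hi smaller i4 = lo larger i1"
    and y: "hi larger i2 = hi larger i1" "lo smaller i3 = hi larger i1" "lo smaller i4 = hi larger i1"
    by (auto simp: r bottom_left_def bottom_right_def top_left_def top_right_def)
  define X where "X = lo larger i1"
  define Y where "Y = hi larger i1"
  note xy = x[folded X_def] y[folded Y_def]
  have lt: "X < n" "Y < n" "0 < X" "0 < Y"
    using lo_le[of larger i1] lo_le[of smaller i3] less_hi[OF i(2), of smaller] less_hi[OF i(1), of larger] i xy
    by (auto simp: X_def Y_def)
  \<comment> \<open>\<open>P\<close> and \<open>Q\<close> are the column to the left of the corner
    and the row above it; \<open>X\<close> and \<open>Y\<close> are the column to its right and the
    row below it.\<close>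
  define P where "P = X - 1"
  define Q where "Q = Y - 1"
  have PQ: "X = Suc P" "Y = Suc Q" using lt by (auto simp: P_def Q_def)
  note lohi = le_less_trans[OF lo_le less_hi[OF i(1)]] le_less_trans[OF lo_le less_hi[OF i(2)]]
    le_less_trans[OF lo_le less_hi[OF i(3)]] le_less_trans[OF lo_le less_hi[OF i(4)]]
  have c1: "has_cell i1 X Q" using lohi(1)[of larger smaller] lohi(1)[of smaller larger] xy PQ
    by (auto simp: has_cell_def X_def[symmetric] Y_def[symmetric])
  have c2: "has_cell i2 P Q" using lohi(2)[of larger smaller] lohi(2)[of smaller larger] xy PQ
    by (auto simp: has_cell_def)
  have c3: "has_cell i3 X Y" using lohi(3)[of larger smaller] lohi(3)[of smaller larger] xy PQ
    by (auto simp: has_cell_def)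
  have c4: "has_cell i4 P Y" using lohi(4)[of larger smaller] lohi(4)[of smaller larger] xy PQ
    by (auto simp: has_cell_def)
  have ne: "i1 \<noteq> i2" "i3 \<noteq> i4" "i1 \<noteq> i3" "i2 \<noteq> i4"
    using lohi(1)[of larger smaller] lohi(3)[of larger smaller] lohi(1)[of smaller larger]
      lohi(2)[of smaller larger] xy by (auto simp: X_def Y_def)
  have PQn: "P < n" "Q < n" using lt by (auto simp: P_def Q_def)
  consider "P < Q" | "Q < P" | "P = Q" by linarith
  then show False
  proof cases
    case 1
    have c4': "P \<le> i4 \<and> i4 \<le> Y \<and> (\<forall>k. P \<le> k \<and> k \<le> Y \<longrightarrow> w i4 \<le> w k)"
      using c4 has_cell_below[of P Y i4] 1 PQ lt i by simp
    show False
    proof (cases "i4 = P")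
      case True
      then have "has_cell i4 P Q" using c4' has_cell_below[of P Q i4] 1 PQ PQn i by simp
      then show False using has_cell_unique[OF i(2,4) PQn c2] ne by simp
    next
      case False
      then have "has_cell i4 X Y" using c4' has_cell_below[of X Y i4] 1 PQ lt i by simp
      then show False using has_cell_unique[OF i(3,4) lt(1,2) c3] ne by simp
    qed
  next
    case 2
    have c1': "Q \<le> i1 \<and> i1 \<le> X \<and> (\<forall>k. Q \<le> k \<and> k \<le> X \<longrightarrow> w k \<le> w i1)"
      using c1 has_cell_right[of Q X i1] 2 PQ lt i by simp
    show False
    proof (cases "i1 = Q")
      case True
      then have "has_cell i1 P Q" using c1' has_cell_right[of Q P i1] 2 PQ PQn i by simp
      then show False using has_cell_unique[OF i(2,1) PQn c2] ne by simp
    next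
      case False
      then have "has_cell i1 X Y" using c1' has_cell_right[of Y X i1] 2 PQ lt i by simp
      then show False using has_cell_unique[OF i(3,1) lt(1,2) c3] ne by simp
    qed
  next
    case 3
    have "Q \<le> i1 \<and> i1 \<le> X" using c1 has_cell_right[of Q X i1] 3 PQ lt i by simp
    moreover have "i2 = P" using c2 has_cell_below[of P Q i2] 3 PQn i by simp
    moreover have "i3 = X" using c3 has_cell_below[of X Y i3] 3 PQ lt i by simp
    ultimately show False using 3 PQ ne by simp
  qed
qed

sublocale generic_rectangulation tiling
  by unfold_locales (rule generic_tiling)

text \<open>An ascent of \<open>w\<close> at \<open>k\<close> puts the two tiles side by side at the
  line x = k + 1, a descent puts tile \<open>k\<close> on top of the next one. Their facing edges
  meet, so they join into one composed segment.\<close>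

lemma precedes_Suc:
  assumes k: "Suc k < n"
  shows "precedes (tile k) (tile (Suc k))"
proof -
  have kn: "k < n" using k by simp
  have R: "tile k \<in> tiling" "tile (Suc k) \<in> tiling" using k by (auto simp: tiling_def)
  note pr = proper[OF R(1)] proper[OF R(2)]
  have "w k < w (Suc k) \<or> w (Suc k) < w k" using w_neq[OF kn k] by simp
  then show ?thesis
  proof
    assume less: "w k < w (Suc k)"
    have "\<not> Suc k < hi smaller k" using less less_hi_iff[OF kn k, of smaller] by auto
    then have hi: "hi smaller k = Suc k" using less_hi[OF kn, of smaller] by simp
    have "\<not> lo larger (Suc k) \<le> k" using less lo_le_iff[of larger "Suc k" k] by auto
    then have lo: "lo larger (Suc k) = Suc k" using lo_le[of larger "Suc k"] by simp
    have x: "xmax (tile k) = xmin (tile (Suc k))" using hi lo by simp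
    have "lo smaller (Suc k) \<le> k" using less by (auto simp: lo_le_iff less_Suc_eq)
    then have y: "ymin (tile k) \<le> ymax (tile (Suc k))" "ymin (tile (Suc k)) \<le> ymax (tile k)"
      using less_hi[OF kn, of larger] less_hi[OF k, of larger] lo_le[of smaller k] by auto
    have "composed_of_edges tiling ({xmax (tile k)} \<times> {min (ymin (tile k)) (ymin (tile (Suc k)))..max (ymax (tile k)) (ymax (tile (Suc k)))})"
    proof (rule composed_vertical_Un)
      show "composed_of_edges tiling ({xmax (tile k)} \<times> {ymin (tile k)..ymax (tile k)})"
        using composed_edge[OF R(1), of "right_edge (tile k)"] edge_eq(4)[OF R(1)] by (simp add: edges_def)
      show "composed_of_edges tiling ({xmax (tile k)} \<times> {ymin (tile (Suc k))..ymax (tile (Suc k))})"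
        using composed_edge[OF R(2), of "left_edge (tile (Suc k))"] edge_eq(3)[OF R(2)] x by (simp add: edges_def)
    qed (use pr y in linarith)+
    then have "left_of tiling (tile k) (tile (Suc k))"
      by (rule left_ofI[OF R _ _ _ x]) (use x in \<open>auto simp: edge_eq(3)[OF R(2)] edge_eq(4)[OF R(1)]\<close>)
    then show ?thesis by (rule precedes_left)
  next
    assume less: "w (Suc k) < w k"
    have "\<not> Suc k < hi larger k" using less less_hi_iff[OF kn k, of larger] by auto
    then have hi: "hi larger k = Suc k" using less_hi[OF kn, of larger] by simp
    have "\<not> lo smaller (Suc k) \<le> k" using less lo_le_iff[of smaller "Suc k" k] by auto
    then have lo: "lo smaller (Suc k) = Suc k" using lo_le[of smaller "Suc k"] by simp
    have y: "ymin (tile k) = ymax (tile (Suc k))" using hi lo by simp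
    have "lo larger (Suc k) \<le> k" using less by (auto simp: lo_le_iff less_Suc_eq)
    then have x: "xmin (tile k) \<le> xmax (tile (Suc k))" "xmin (tile (Suc k)) \<le> xmax (tile k)"
      using less_hi[OF kn, of smaller] less_hi[OF k, of smaller] lo_le[of larger k] by auto
    have "composed_of_edges tiling ({min (xmin (tile k)) (xmin (tile (Suc k)))..max (xmax (tile k)) (xmax (tile (Suc k)))} \<times> {ymin (tile k)})"
    proof (rule composed_horizontal_Un)
      show "composed_of_edges tiling ({xmin (tile k)..xmax (tile k)} \<times> {ymin (tile k)})"
        using composed_edge[OF R(1), of "bottom_edge (tile k)"] edge_eq(1)[OF R(1)] by (simp add: edges_def)
      show "composed_of_edges tiling ({xmin (tile (Suc k))..xmax (tile (Suc k))} \<times> {ymin (tile k)})"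
        using composed_edge[OF R(2), of "top_edge (tile (Suc k))"] edge_eq(2)[OF R(2)] y by (simp add: edges_def)
    qed (use pr x in linarith)+
    then have "above tiling (tile k) (tile (Suc k))"
      by (rule aboveI[OF R _ _ _ y]) (use y in \<open>auto simp: edge_eq(2)[OF R(2)] edge_eq(1)[OF R(1)]\<close>)
    then show ?thesis by (rule precedes_above)
  qed
qed

lemma precedes_tile:
  assumes "i < j" "j < n" shows "precedes (tile i) (tile j)"
  using assms
proof (induction j)
  case (Suc j)
  show ?case
  proof (cases "i = j")
    case True
    then show ?thesis using precedes_Suc Suc.prems by simp
  next
    case False
    then have "precedes (tile i) (tile j)" using Suc by simp
    then show ?thesis using precedes_trans precedes_Suc[OF Suc.prems(2)] by blast
  qed
qed simp

text \<open>Together with \<open>target_child_weight\<close>, this says that weights increase along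
  all edges of both trees, so \<open>w\<close> gives a linear extension of the weak poset.\<close>

lemma source_child_weight:
  assumes ij: "i < n" "j < n" and c: "source_child d (tile i) (tile j)"
  shows "w i < w j"
proof (cases d)
  case Hor
  then have e: "lo larger j = hi smaller i" "hi larger j = hi larger i"
    using c by (auto simp: source_child_def corner_defs)
  have "i < j" using less_hi[OF ij(1), of smaller] lo_le[of larger j] e by simp
  moreover have "j < hi larger i" using less_hi[OF ij(2), of larger] e by simp
  ultimately show ?thesis using less_hi_iff[OF ij, of larger] by simp
next
  case Ver
  then have e: "lo larger j = lo larger i" "hi larger j = lo smaller i"
    using c by (auto simp: source_child_def corner_defs)
  have "j < i" using less_hi[OF ij(2), of larger] lo_le[of smaller i] e by simp
  moreover have "lo larger i \<le> j" using lo_le[of larger j] e by simp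
  ultimately show ?thesis using lo_le_iff[of larger i j] by simp
qed

lemma target_child_weight:
  assumes ij: "i < n" "j < n" and c: "target_child d (tile j) (tile i)"
  shows "w i < w j"
proof (cases d)
  case Hor
  then have e: "hi smaller i = lo larger j" "lo smaller i = lo smaller j"
    using c by (auto simp: target_child_def corner_defs)
  have "i < j" using less_hi[OF ij(1), of smaller] lo_le[of larger j] e by simp
  moreover have "lo smaller j \<le> i" using lo_le[of smaller i] e by simp
  ultimately show ?thesis using lo_le_iff[of smaller j i] by simp
next
  case Ver
  then have e: "hi smaller i = hi smaller j" "lo smaller i = hi larger j"
    using c by (auto simp: target_child_def corner_defs)
  have "j < i" using less_hi[OF ij(2), of larger] lo_le[of smaller i] e by simp
  moreover have "i < hi smaller j" using less_hi[OF ij(1), of smaller] e by simp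
  ultimately show ?thesis using less_hi_iff[OF ij(2,1), of smaller] by simp
qed

end

lemma ex_weak_cone:
  fixes v :: "real ^ 'n::{finite,linorder}"
  shows "\<exists>R\<in>rectangulations CARD('n). v \<in> weak_cone R"
proof -
  \<comment> \<open>The rank in the order by entries of \<open>v\<close>, with ties broken by labels
    so that the weights are injective.\<close>
  define u where "u i = card {j. v $ j < v $ i \<or> v $ j = v $ i \<and> j < i}" for i
  let ?lt = "\<lambda>i j. v $ i < v $ j \<or> v $ i = v $ j \<and> i < j"
  have order: "\<And>i. \<not> ?lt i i" "\<And>i j k. ?lt i j \<Longrightarrow> ?lt j k \<Longrightarrow> ?lt i k" "\<And>i j. i = j \<or> ?lt i j \<or> ?lt j i"
    by auto
  have u_eq: "u i = card {j \<in> UNIV. ?lt j i}" for i by (simp add: u_def)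
  have u_bij: "bij_betw u UNIV {..<CARD('n)}"
    unfolding u_eq[abs_def] by (rule rank_strict_order(1)[OF finite order(1)]) (use order in blast)+
  have u_less: "?lt i j \<longleftrightarrow> u i < u j" for i j
    unfolding u_eq by (rule rank_strict_order(2)[OF finite order(1)]) (use order in blast)+
  \<comment> \<open>The order isomorphism from labels to the positions below n.\<close>
  define e where "e i = card {j. j < i}" for i :: 'n
  have e: "bij_betw e UNIV {..<CARD('n)}" using rank_linorder unfolding e_def .
  have e_less: "e i < e j \<longleftrightarrow> i < j" for i j
    using rank_strict_order(2)[of "UNIV :: 'n set" "(<)" i j] by (force simp: e_def)
  define w where "w = u \<circ> inv e"
  have w_e: "w (e i) = u i" for i using e by (simp add: w_def bij_betw_def)
  have "inj_on w {..<CARD('n)}"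
  proof -
    have "bij_betw w {..<CARD('n)} {..<CARD('n)}"
      unfolding w_def by (rule bij_betw_trans[OF bij_betw_inv_into[OF e] u_bij])
    then show ?thesis by (simp add: bij_betw_def)
  qed
  then interpret injective_weights "CARD('n)" w
    by unfold_locales simp_all
  have en: "e i < CARD('n)" for i using e by (auto simp: bij_betw_def)
  let ?l = "tile \<circ> e"
  have "bij_betw ?l UNIV tiling"
    unfolding tiling_def by (rule bij_betw_trans[OF e inj_on_imp_bij_betw[OF inj_tile]])
  moreover have "i < j \<longleftrightarrow> precedes (?l i) (?l j)" for i j
  proof
    show "i < j \<Longrightarrow> precedes (?l i) (?l j)" using precedes_tile[OF _ en] e_less by simp
    show "i < j" if ij: "precedes (?l i) (?l j)"
    proof (rule ccontr)
      assume "\<not> i < j"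
      then have "i = j \<or> precedes (?l j) (?l i)" using precedes_tile[OF _ en[of i], of "e j"] e_less[of j i] by auto
      then have "precedes (?l i) (?l i)" using ij precedes_trans[OF ij] by auto
      then show False by (simp add: precedes_irrefl)
    qed
  qed
  ultimately have l: "inorder_labeling tiling ?l" by (simp add: inorder_labeling_iff)
  have "v $ i \<le> v $ j" if "source_edge tiling d i j \<or> target_edge tiling d i j" for d i j
  proof -
    have "source_child d (tile (e i)) (tile (e j)) \<or> target_child d (tile (e j)) (tile (e i))"
      using that by (simp add: source_edge_iff[OF l] target_edge_iff[OF l])
    then have "w (e i) < w (e j)"
      using source_child_weight[OF en en] target_child_weight[OF en en] by blast
    then show ?thesis using u_less[of i j] by (auto simp: w_e)
  qed
  then have "v \<in> weak_cone tiling" by (auto simp: weak_cone_iff)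
  moreover have "tiling \<in> rectangulations CARD('n)"
    using rectangulation_tiling generic_tiling card_tiling by (simp add: rectangulations_def)
  ultimately show ?thesis by blast
qed

subsection \<open>The weak rectangulotope\<close>

definition spread :: "real ^ 'n::{finite,linorder} \<Rightarrow> real" where
  "spread v = (\<Sum>I\<in>intervals. Max (($) v ` I) - Min (($) v ` I))"

lemma interval_nonempty: "I \<in> intervals \<Longrightarrow> I \<noteq> {}"
  by (auto simp: intervals_def)

lemma Min_le_Max_interval:
  fixes v :: "real ^ 'n::{finite,linorder}"
  assumes "I \<in> intervals" shows "Min (($) v ` I) \<le> Max (($) v ` I)"
proof -
  obtain i where "i \<in> I" using interval_nonempty[OF assms] by blast
  then have "Min (($) v ` I) \<le> v $ i" "v $ i \<le> Max (($) v ` I)" by simp_all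
  then show ?thesis by linarith
qed

lemma Max_Min_constant:
  fixes v :: "real ^ 'n::{finite,linorder}"
  assumes "I \<in> intervals" "\<And>i. i \<in> I \<Longrightarrow> v $ i = c"
  shows "Max (($) v ` I) = c" "Min (($) v ` I) = c"
proof -
  have "($) v ` I = {c}" using interval_nonempty[OF assms(1)] assms(2) by (auto simp: image_iff)
  then show "Max (($) v ` I) = c" "Min (($) v ` I) = c" by simp_all
qed

definition crossing :: "'n::{finite,linorder} set \<Rightarrow> 'n set set" where
  "crossing X = {I \<in> intervals. \<not> I \<subseteq> X \<and> \<not> I \<subseteq> UNIV - X}"

lemma sum_crossing:
  fixes X :: "'n::{finite,linorder} set"
  shows "(\<Sum>I\<in>intervals. if \<not> I \<subseteq> X \<and> \<not> I \<subseteq> UNIV - X then c else 0) = c * real (card (crossing X))"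
proof -
  have "(\<Sum>I\<in>intervals. if \<not> I \<subseteq> X \<and> \<not> I \<subseteq> UNIV - X then c else 0) = (\<Sum>I\<in>crossing X. c)"
    unfolding crossing_def by (rule sum.inter_filter[symmetric]) simp
  then show ?thesis by simp
qed

text \<open>Truncating v at its second largest value peels off a multiple of the indicator of the set X
  where v is maximal; iterating, spread turns out to be the Lovasz extension of the set function
  in the inequalities.\<close>

lemma spread_truncate:
  fixes v :: "real ^ 'n::{finite,linorder}"
  assumes M: "M' < M" "\<And>i. v $ i = M \<or> v $ i \<le> M'" and X: "X = {i. v $ i = M}"
  shows "spread v = spread (\<chi> i. min (v $ i) M') + (M - M') * real (card (crossing X))"
proof -
  let ?v = "\<chi> i. min (v $ i) M'"
  have "Max (($) v ` I) - Min (($) v ` I)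
    = (Max (($) ?v ` I) - Min (($) ?v ` I)) + (if \<not> I \<subseteq> X \<and> \<not> I \<subseteq> UNIV - X then M - M' else 0)"
    if I: "I \<in> intervals" for I
  proof -
    consider "I \<subseteq> X" | "I \<subseteq> UNIV - X" | "\<not> I \<subseteq> X" "\<not> I \<subseteq> UNIV - X" by blast
    then show ?thesis
    proof cases
      case 1
      then have "v $ i = M" "?v $ i = M'" if "i \<in> I" for i using that X M by auto
      then show ?thesis
        using Max_Min_constant[OF I, of v M] Max_Min_constant[OF I, of ?v M'] 1 by simp
    next
      case 2
      then have "?v $ i = v $ i" if "i \<in> I" for i using that X M(2)[of i] by auto
      then have "($) ?v ` I = ($) v ` I" by (intro image_cong) auto
      then show ?thesis using 2 by simp
    next
      case 3
      then obtain i j where i: "i \<in> I" "v $ i = M" and j: "j \<in> I" "v $ j \<le> M'"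
        using X M(2) by blast
      have le: "v $ k \<le> M" for k using M(1) M(2)[of k] by auto
      have "Max (($) v ` I) = M" by (rule Max_eqI) (use i le in auto)
      moreover have "Max (($) ?v ` I) = M'" by (rule Max_eqI) (use i M(1) in \<open>auto intro!: image_eqI[of _ _ i]\<close>)
      moreover have "Min (($) ?v ` I) = Min (($) v ` I)"
      proof -
        have "Min (($) v ` I) \<in> ($) v ` I" using i by (intro Min_in) auto
        then obtain k where k: "k \<in> I" "v $ k = Min (($) v ` I)" by auto
        then have "v $ k \<le> v $ l" if "l \<in> I" for l using that by simp
        moreover from this[OF j(1)] have "v $ k \<le> M'" using j by linarith
        ultimately show ?thesis
          unfolding k(2)[symmetric] using k(1) by (intro Min_eqI) (auto intro!: image_eqI[of _ _ k])
      qed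
      ultimately show ?thesis using 3 by simp
    qed
  qed
  then have "spread v = (\<Sum>I\<in>intervals. (Max (($) ?v ` I) - Min (($) ?v ` I))
      + (if \<not> I \<subseteq> X \<and> \<not> I \<subseteq> UNIV - X then M - M' else 0))"
    unfolding spread_def by (intro sum.cong refl)
  then show ?thesis by (simp only: sum.distrib spread_def sum_crossing)
qed

text \<open>Induction on the number of values of \<open>v\<close>, as truncation removes the largest
  one. For constant \<open>v\<close> the hyperplane equation makes the left side zero.\<close>

lemma weak_halfspaces_le_spread:
  fixes x v :: "real ^ 'n::{finite,linorder}"
  assumes x: "x \<in> weak_halfspaces"
  shows "v \<bullet> x \<le> spread v"
proof (induction "card (range (($) v))" arbitrary: v rule: less_induct)
  case less
  define M where "M = Max (range (($) v))"
  have le_M: "v $ i \<le> M" for i by (simp add: M_def)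
  show ?case
  proof (cases "\<exists>i. v $ i \<noteq> M")
    case False
    then have "v \<bullet> x = M * (\<Sum>i\<in>UNIV. x $ i)" by (simp add: inner_vec_def sum_distrib_left)
    also have "\<dots> = 0" using x by (simp add: weak_halfspaces_def)
    also have "0 \<le> spread v"
      unfolding spread_def using Min_le_Max_interval by (intro sum_nonneg) simp
    finally show ?thesis .
  next
    case True
    define M' where "M' = Max (range (($) v) - {M})"
    have "M' \<in> range (($) v) - {M}" unfolding M'_def using True by (intro Max_in) auto
    then obtain j where j: "v $ j = M'" "M' \<noteq> M" by auto
    have lt: "M' < M" using le_M[of j] j by simp
    have cases: "v $ i = M \<or> v $ i \<le> M'" for i
      unfolding M'_def by (cases "v $ i = M") (auto intro: Max_ge)
    define X where "X = {i. v $ i = M}"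
    have "M \<in> range (($) v)" unfolding M_def by (rule Max_in) auto
    then have X: "X \<noteq> {}" "X \<noteq> UNIV" using True by (auto simp: X_def)
    let ?v = "\<chi> i. min (v $ i) M'"
    have "?v $ i \<in> range (($) v) - {M}" for i
      using cases[of i] lt j by (cases "v $ i = M") (auto simp: min_def image_iff)
    then have "range (($) ?v) \<subseteq> range (($) v) - {M}" by blast
    then have "card (range (($) ?v)) < card (range (($) v))"
      using \<open>M \<in> range (($) v)\<close> by (intro psubset_card_mono) auto
    then have IH: "?v \<bullet> x \<le> spread ?v" by (rule less)
    have "v $ i * x $ i = ?v $ i * x $ i + (if i \<in> X then (M - M') * x $ i else 0)" for i
      using cases[of i] lt by (auto simp: X_def algebra_simps)
    then have "v \<bullet> x = (\<Sum>i\<in>UNIV. ?v $ i * x $ i + (if i \<in> X then (M - M') * x $ i else 0))"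
      by (simp add: inner_vec_def)
    also have "\<dots> = ?v \<bullet> x + (\<Sum>i\<in>UNIV. if i \<in> X then (M - M') * x $ i else 0)"
      by (simp add: sum.distrib inner_vec_def)
    also have "(\<Sum>i\<in>UNIV. if i \<in> X then (M - M') * x $ i else 0) = (M - M') * (\<Sum>i\<in>X. x $ i)"
      by (simp add: sum.If_cases sum_distrib_left)
    also have "(M - M') * (\<Sum>i\<in>X. x $ i) \<le> (M - M') * real (card (crossing X))"
      using x X lt by (intro mult_left_mono) (auto simp: weak_halfspaces_def crossing_def)
    finally show ?thesis using IH spread_truncate[OF lt cases X_def] by linarith
  qed
qed

text \<open>The constant vectors 1 and -1 have spread zero and give the equation; the indicator
  vector of \<open>X\<close> gives the inequality for \<open>X\<close>.\<close>

lemma in_weak_halfspacesI: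
  fixes x :: "real ^ 'n::{finite,linorder}"
  assumes x: "\<And>v. v \<bullet> x \<le> spread v"
  shows "x \<in> weak_halfspaces"
proof -
  have const: "c * (\<Sum>i\<in>UNIV. x $ i) \<le> 0" for c
  proof -
    define v :: "real ^ 'n::{finite,linorder}" where "v = (\<chi> i. c)"
    have "spread v = 0"
      unfolding spread_def using Max_Min_constant[of _ v c] by (intro sum.neutral ballI) (simp add: v_def)
    then show ?thesis using x[of v] by (simp add: v_def inner_vec_def sum_distrib_left)
  qed
  have "(\<Sum>i\<in>X. x $ i) \<le> real (card (crossing X))" for X
  proof -
    define v :: "real ^ 'n::{finite,linorder}" where "v = (\<chi> i. if i \<in> X then 1 else 0)"
    have v: "0 \<le> v $ i" "v $ i \<le> 1" for i by (auto simp: v_def)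
    have "Max (($) v ` I) - Min (($) v ` I) \<le> (if \<not> I \<subseteq> X \<and> \<not> I \<subseteq> UNIV - X then 1 else 0)"
      if I: "I \<in> intervals" for I
    proof -
      have ne: "($) v ` I \<noteq> {}" using interval_nonempty[OF I] by simp
      have "Max (($) v ` I) \<le> 1" "0 \<le> Min (($) v ` I)" using v ne by auto
      moreover have "Max (($) v ` I) - Min (($) v ` I) = 0" if "I \<subseteq> X"
      proof -
        have "v $ i = 1" if "i \<in> I" for i using that \<open>I \<subseteq> X\<close> by (auto simp: v_def)
        then show ?thesis using Max_Min_constant[OF I, of v 1] by simp
      qed
      moreover have "Max (($) v ` I) - Min (($) v ` I) = 0" if "I \<subseteq> UNIV - X"
      proof -
        have "v $ i = 0" if "i \<in> I" for i using that \<open>I \<subseteq> UNIV - X\<close> by (auto simp: v_def)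
        then show ?thesis using Max_Min_constant[OF I, of v 0] by simp
      qed
      ultimately show ?thesis by auto
    qed
    then have "spread v \<le> 1 * real (card (crossing X))"
      unfolding spread_def sum_crossing[symmetric] by (rule sum_mono)
    moreover have "v \<bullet> x = (\<Sum>i\<in>X. x $ i)"
      by (simp add: v_def inner_vec_def if_distrib[of "\<lambda>c. c * _"] sum.If_cases cong: if_cong)
    ultimately show ?thesis using x[of v] by simp
  qed
  moreover have "(\<Sum>i\<in>UNIV. x $ i) = 0" using const[of 1] const[of "-1"] by simp
  ultimately show ?thesis by (simp add: weak_halfspaces_def crossing_def)
qed

section \<open>Support function and normal cones of the hull\<close>

lemma rectangulationsD:
  assumes "R \<in> rectangulations n" shows "generic_rectangulation R" "card R = n"
  using assms by (auto simp: rectangulations_def intro!: generic_rectangulation.intro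
    rectangulated.intro generic_rectangulation_axioms.intro)

lemma weak_rectangulations_representatives:
  "(\<exists>W\<in>weak_rectangulations n. R \<in> W) \<longleftrightarrow> R \<in> rectangulations n"
proof
  assume "\<exists>W\<in>weak_rectangulations n. R \<in> W"
  then show "R \<in> rectangulations n"
    by (auto simp: weak_rectangulations_def quotient_def weak_equivalence_def)
next
  assume R: "R \<in> rectangulations n"
  then have "(R, R) \<in> weak_equivalence n"
    unfolding weak_equivalence_def by (auto intro!: exI[of _ id])
  then show "\<exists>W\<in>weak_rectangulations n. R \<in> W"
    using R by (intro bexI[of _ "weak_equivalence n `` {R}"]) (auto simp: weak_rectangulations_def quotientI)
qed

lemma
  fixes v :: "real ^ 'n::{finite,linorder}"
  assumes R: "R \<in> rectangulations CARD('n)"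
  shows inner_weak_vertex_le: "v \<bullet> weak_vertex R \<le> spread v"
    and inner_weak_vertex_eq_iff: "v \<bullet> weak_vertex R = spread v \<longleftrightarrow> v \<in> weak_cone R"
proof -
  interpret generic_rectangulation R by (rule rectangulationsD(1)[OF R])
  obtain f g :: "'n set \<Rightarrow> 'n" where f: "\<And>I. I \<in> intervals \<Longrightarrow> f I \<in> I"
    and g: "\<And>I. I \<in> intervals \<Longrightarrow> g I \<in> I"
    and vertex: "weak_vertex R = (\<Sum>I\<in>intervals. axis (g I) 1 - axis (f I) 1)"
    and cone: "\<And>v. v \<in> weak_cone R \<longleftrightarrow> (\<forall>I\<in>intervals. \<forall>j\<in>I. v $ f I \<le> v $ j \<and> v $ j \<le> v $ g I)"
    using weak_vertex_roots[OF rectangulationsD(2)[OF R]] by blast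
  \<comment> \<open>Two nonnegative defects per interval, at its maximum and at its minimum; their
    total vanishes only if each does.\<close>
  let ?d = "\<lambda>I. (Max (($) v ` I) - v $ g I) + (v $ f I - Min (($) v ` I))"
  have "spread v - v \<bullet> weak_vertex R = (\<Sum>I\<in>intervals. ?d I)"
    by (simp add: spread_def vertex inner_sum_right inner_diff_right inner_axis sum_subtractf sum.distrib)
  moreover have nonneg: "v $ g I \<le> Max (($) v ` I)" "Min (($) v ` I) \<le> v $ f I" if "I \<in> intervals" for I
    using f[OF that] g[OF that] by simp_all
  ultimately have le: "0 \<le> spread v - v \<bullet> weak_vertex R"
    and iff: "spread v - v \<bullet> weak_vertex R = 0 \<longleftrightarrow> (\<forall>I\<in>intervals. ?d I = 0)"
    by (auto intro!: sum_nonneg simp: sum_nonneg_eq_0_iff)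
  show "v \<bullet> weak_vertex R \<le> spread v" using le by simp
  have "?d I = 0 \<longleftrightarrow> (\<forall>j\<in>I. v $ f I \<le> v $ j \<and> v $ j \<le> v $ g I)" if I: "I \<in> intervals" for I
  proof
    assume "?d I = 0"
    then have "v $ g I = Max (($) v ` I)" "v $ f I = Min (($) v ` I)" using nonneg[OF I] by linarith+
    then show "\<forall>j\<in>I. v $ f I \<le> v $ j \<and> v $ j \<le> v $ g I" by simp
  next
    assume "\<forall>j\<in>I. v $ f I \<le> v $ j \<and> v $ j \<le> v $ g I"
    then have "Max (($) v ` I) = v $ g I" "Min (($) v ` I) = v $ f I"
      using f[OF I] g[OF I] by (auto intro!: Max_eqI Min_eqI)
    then show "?d I = 0" by simp
  qed
  then show "v \<bullet> weak_vertex R = spread v \<longleftrightarrow> v \<in> weak_cone R" using iff cone by auto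
qed

definition weak_vertices :: "(real ^ 'n::{finite,linorder}) set" where
  "weak_vertices = weak_vertex ` rectangulations CARD('n)"

lemma weak_hull_eq: "weak_hull = convex hull (weak_vertices :: (real ^ 'n::{finite,linorder}) set)"
proof -
  have "{weak_vertex R | R W. W \<in> weak_rectangulations CARD('n) \<and> R \<in> W} = (weak_vertices :: (real ^ 'n::{finite,linorder}) set)"
    using weak_rectangulations_representatives[of "CARD('n)"] unfolding weak_vertices_def by blast
  then show ?thesis by (simp add: weak_hull_def)
qed

text \<open>Rectangulations of a given size are infinitely many, but a vertex depends only on two
  functions from intervals to labels.\<close>

lemma finite_weak_vertices: "finite (weak_vertices :: (real ^ 'n::{finite,linorder}) set)"
proof -
  have "weak_vertices \<subseteq> range (\<lambda>(f, g). \<Sum>I\<in>(intervals :: 'n set set). axis (g I) 1 - axis (f I :: 'n) (1 :: real))"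
  proof
    fix x :: "real ^ 'n::{finite,linorder}" assume "x \<in> weak_vertices"
    then obtain R where R: "R \<in> rectangulations CARD('n)" "x = weak_vertex R"
      by (auto simp: weak_vertices_def)
    interpret generic_rectangulation R by (rule rectangulationsD(1)[OF R(1)])
    obtain f g :: "'n set \<Rightarrow> 'n" where "x = (\<Sum>I\<in>intervals. axis (g I) 1 - axis (f I) 1)"
      by (rule weak_vertex_roots[OF rectangulationsD(2)[OF R(1)]]) (use R(2) in blast)
    then show "x \<in> range (\<lambda>(f, g). \<Sum>I\<in>(intervals :: 'n set set). axis (g I) 1 - axis (f I :: 'n) (1 :: real))"
      by (intro image_eqI[of _ _ "(f, g)"]) simp_all
  qed
  then show ?thesis by (rule finite_subset) simp
qed

lemma ex_maximal_weak_vertex: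
  fixes v :: "real ^ 'n::{finite,linorder}"
  shows "\<exists>x\<in>weak_vertices. v \<bullet> x = spread v"
proof -
  obtain R where "R \<in> rectangulations CARD('n)" "v \<in> weak_cone R" using ex_weak_cone by blast
  then show ?thesis unfolding weak_vertices_def using inner_weak_vertex_eq_iff by blast
qed

lemma normal_cone_weak_vertex:
  assumes R: "R \<in> rectangulations CARD('n::{finite,linorder})"
  shows "normal_cone (weak_hull :: (real ^ 'n::{finite,linorder}) set) {weak_vertex R} = weak_cone R"
proof -
  have "v \<in> weak_cone R \<longleftrightarrow> (\<forall>y\<in>weak_vertices. v \<bullet> y \<le> v \<bullet> weak_vertex R)" for v :: "real ^ 'n::{finite,linorder}"
  proof
    assume "v \<in> weak_cone R"
    then have "v \<bullet> weak_vertex R = spread v" using inner_weak_vertex_eq_iff[OF R] by blast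
    then show "\<forall>y\<in>weak_vertices. v \<bullet> y \<le> v \<bullet> weak_vertex R"
      using inner_weak_vertex_le[of _ v] by (auto simp: weak_vertices_def)
  next
    assume max: "\<forall>y\<in>weak_vertices. v \<bullet> y \<le> v \<bullet> weak_vertex R"
    then have "spread v \<le> v \<bullet> weak_vertex R" using ex_maximal_weak_vertex[of v] by metis
    then have "v \<bullet> weak_vertex R = spread v" using inner_weak_vertex_le[OF R, of v] by linarith
    then show "v \<in> weak_cone R" using inner_weak_vertex_eq_iff[OF R] by blast
  qed
  then show ?thesis
    unfolding weak_hull_eq normal_cone_singleton_hull[OF finite_weak_vertices] by blast
qed

text \<open>Every vertex obeys the bound by \<open>spread\<close>, and a point outside the closed
  hull violates it in a separating direction, where some vertex attains
  \<open>spread\<close>.\<close>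

lemma weak_hull_eq_halfspaces: "(weak_hull :: (real ^ 'n::{finite,linorder}) set) = weak_halfspaces"
proof -
  have halfspaces: "x \<in> weak_halfspaces \<longleftrightarrow> (\<forall>v. v \<bullet> x \<le> spread v)" for x :: "real ^ 'n::{finite,linorder}"
    using weak_halfspaces_le_spread in_weak_halfspacesI by blast
  then have eq: "weak_halfspaces = (\<Inter>v. {x :: real ^ 'n::{finite,linorder}. v \<bullet> x \<le> spread v})" by blast
  have "convex (weak_halfspaces :: (real ^ 'n::{finite,linorder}) set)"
    unfolding eq by (intro convex_INT convex_halfspace_le)
  moreover have "weak_vertices \<subseteq> (weak_halfspaces :: (real ^ 'n::{finite,linorder}) set)"
    using inner_weak_vertex_le by (auto simp: halfspaces weak_vertices_def)
  ultimately have "weak_hull \<subseteq> (weak_halfspaces :: (real ^ 'n::{finite,linorder}) set)"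
    unfolding weak_hull_eq by (simp add: hull_minimal)
  moreover have "x \<in> weak_hull" if x: "x \<in> weak_halfspaces" for x :: "real ^ 'n::{finite,linorder}"
  proof (rule ccontr)
    assume "x \<notin> weak_hull"
    moreover have "closed (weak_hull :: (real ^ 'n::{finite,linorder}) set)"
      unfolding weak_hull_eq
      by (intro compact_imp_closed compact_convex_hull finite_imp_compact finite_weak_vertices)
    ultimately obtain a b where ab: "a \<bullet> x < b" "\<forall>y\<in>weak_hull. b < a \<bullet> y"
      using separating_hyperplane_closed_point[of weak_hull x] unfolding weak_hull_eq by auto
    \<comment> \<open>The separation makes \<open>a\<close> smaller at \<open>x\<close> than on the
      hull, so the direction to maximise is \<open>- a\<close>.\<close>
    obtain y where y: "y \<in> weak_vertices" "(- a) \<bullet> y = spread (- a)" using ex_maximal_weak_vertex by blast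
    have "y \<in> weak_hull" unfolding weak_hull_eq using y(1) by (rule hull_inc)
    then have "spread (- a) < (- a) \<bullet> x" using ab y(2) by force
    then show False using x halfspaces[of x] by (meson not_less)
  qed
  ultimately show ?thesis by blast
qed

theorem theorem2:
  shows "(weak_hull :: (real ^ 'n::{finite,linorder}) set) = weak_halfspaces \<and>
    realizes_weak_rectangulotope (weak_hull :: (real ^ 'n::{finite,linorder}) set)"
proof -
  let ?P = "weak_hull :: (real ^ 'n::{finite,linorder}) set"
  have "polytope ?P"
    unfolding polytope_def weak_hull_eq using finite_weak_vertices by blast
  moreover have "normal_fan ?P = weak_fan"
  proof -
    have "normal_fan ?P = {K. K \<noteq> {} \<and> (\<exists>x\<in>weak_vertices. K face_of normal_cone ?P {x})}"
      unfolding weak_hull_eq by (rule normal_fan_convex_hull[OF finite_weak_vertices])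
    also have "\<dots> = {K. K \<noteq> {} \<and> (\<exists>R\<in>rectangulations CARD('n). K face_of weak_cone R)}"
    proof -
      have "normal_cone ?P {weak_vertex R} = weak_cone R" if "R \<in> rectangulations CARD('n)" for R
        using that by (rule normal_cone_weak_vertex)
      then show ?thesis by (auto simp: weak_vertices_def)
    qed
    also have "\<dots> = weak_fan"
      unfolding weak_fan_def using weak_rectangulations_representatives[of "CARD('n)"] by blast
    finally show ?thesis .
  qed
  ultimately show ?thesis
    using weak_hull_eq_halfspaces by (simp add: realizes_weak_rectangulotope_def)
qed

end
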